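(* Let $X$ be an integral scheme of characteristic $p>0$ and let $\mathcal{D}$ be a Cartier subalgebra on $X$. The minimal $\beth$ log discrepancy $\mathrm{mld}_\beth(-;\mathcal{D}):X\to[-\infty,\infty]$ is lower-semicontinuous in the constructible topology on $X$. Explicitly, for any $x\in X$ and $\varepsilon>0$, there is a locally closed subset $G\subset X$ containing $x$ such that $\mathrm{mld}_\beth(x';\mathcal{D})>\mathrm{mld}_\beth(x;\mathcal{D})-\varepsilon$ for all $x'\in G$.
   Context: Schemes are separated and noetherian. Let $L$ be the function field of $X$. The constructible topology on $X$ is the smallest topology containing all Zariski open and all Zariski closed subsets. A function $f:Y\to[-\infty,\infty]$ on a topological space $Y$ is lower-semicontinuous if $f^{-1}(a,\infty]$ is open for every $a\in\mathbb{R}$; equivalently, at each $y_0\in Y$ either $f(y_0)=-\infty$ or $f(y_0)\le\liminf_\alpha f(y_\alpha)$ for every net $y_\alpha\to y_0$. **The $\beth$-space.** $X^\beth$ is the set of pairs $\zeta=(w,x)$ with $x\in X$ and $w$ a real-valued valuation (values in $\mathbb{R}\cup\{+\infty\}$, possibly trivial) on $\kappa(x)$, centered on $X$, i.e. non-negative on a local ring $\mathcal{O}_{Z,z}$ of $Z=\overline{\{x\}}$ (reduced structure). For $f\in\mathcal{O}_{X,x}$, $\zeta(f)=w(f(x))$ where $f(x)\in\kappa(x)$ is the residue. The home of $\zeta$ is $x$; the center $c_X(\zeta)$ is the point $z\in Z$ such that the valuation ring of $w$ dominates $\mathcal{O}_{Z,z}$. $\mathrm{Val}_X$ denotes the semivaluations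 whose home is the generic point. If $X=\mathrm{Spec}(R)$, $X^\beth$ has the weakest topology making all maps $\zeta\mapsto\zeta(f)\in[0,\infty]$, $f\in R$, continuous. In general, $\mathcal{U}\subseteq X^\beth$ is open iff $\mathcal{U}\cap V^\beth$ is open in $V^\beth$ for each affine open $V\subseteq X$ (here $V^\beth$ is identified with the $\zeta\in X^\beth$ having center in $V$). Let $\mathfrak{D}(X)$ be the closure in $X^\beth$ of the set of $w\in\mathrm{Val}_X$ with $w(L^\times)\subseteq\mathbb{Z}$. **Cartier algebras.** A $p^{-e}$-linear map on $L$ is an additive $\psi:L\to L$ with $\psi(f^{p^e}g)=f\psi(g)$; it is a $p^{-e}$-linear map on $X$ if $\psi(\mathcal{O}_X)\subseteq\mathcal{O}_X$. $\mathcal{C}^X=\bigoplus_{e\ge0}\mathcal{C}^X_e$ is the sheaf of graded rings of $p^{-e}$-linear maps on open subsets of $X$, with composition as product, $\mathcal{C}^X_0=\mathcal{O}_X$. A Cartier subalgebra is a quasi-coherent sheaf of graded subrings $\mathcal{D}=\bigoplus\mathcal{D}_e\subseteq\mathcal{C}^X$ with $\mathcal{D}_0=\mathcal{O}_X$. **Log discrepancies.** For a nonzero $p^{-e}$-linear $\psi:L\to L$ ($e\ge1$), $0\ne f\in L$, $v\in\mathrm{Val}_X$: $E(f,\psi,v)=\frac{v(f)-p^ev(\psi(f))}{p^e-1}$, $A(v;\psi)=\sup_{f\neq0,n\ge1}E(f,\psi^n,v)$, and $A(v;\mathcal{D})=\sup_{e\ge1}\sup_{0\ne\psi\in(\mathcal{D}_e)_x}A(v;\psi)$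 with $x=c_X(v)$ (and $\sup\varnothing=-\infty$). A closed integral subscheme $Z\subseteq X$ with ideal $\mathcal{I}_Z$ is uniformly $\mathcal{D}$-compatible if $\psi(\mathcal{I}_{Z,x})\subseteq\mathcal{I}_{Z,x}$ for all $x\in X$, $e\ge1$, $\psi\in(\mathcal{D}_e)_x$; then each $\psi$ induces a $p^{-e}$-linear map $\psi\|_Z$ on $Z$, and these form a Cartier subalgebra $\mathcal{D}\|_Z$ on $Z$. For $\zeta\in X^\beth$ with home $x$ and $Z=\overline{\{x\}}$, $A(\zeta;\mathcal{D}):=A(\zeta;\mathcal{D}\|_Z)$ (viewing $\zeta\in\mathrm{Val}_Z$) if $Z$ is uniformly $\mathcal{D}$-compatible, and $A(\zeta;\mathcal{D}):=+\infty$ otherwise. The minimal $\beth$ log discrepancy is $\mathrm{mld}_\beth(x;\mathcal{D})=\min\{A(\zeta;\mathcal{D}):\zeta\in\mathfrak{D}(X),\ c_X(\zeta)=x\}$ (the minimum is achieved).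
   Formalization: The explicit ε-statement is proved only at points x where mld_ℶ(x;D) is finite; if it is ±∞ the strict inequality fails at x'=x (e.g. D_e=0 for all e≥1 gives mld ≡ −∞). Lower-semicontinuity itself is proved for all values in [−∞,∞]. *)

theory Defs
  imports
    "HOL-Analysis.Analysis"
    "HOL-Algebra.QuotRing"
    "HOL-Algebra.Ring_Divisibility"
    "HOL-Algebra.Generated_Rings"
begin

section \<open>Ringed spaces and schemes\<close>

record ('a, 'b) ringed_space =
  zariski :: "'a topology"
  sect :: "'a set \<Rightarrow> 'b ring"
  rst :: "'a set \<Rightarrow> 'a set \<Rightarrow> 'b \<Rightarrow> 'b"

text \<open>\<open>rst X U V\<close> is the restriction from \<open>U\<close> to \<open>V \<subseteq> U\<close>. Only the values of \<open>sect\<close> and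
  \<open>rst\<close> at open sets (and, for \<open>rst\<close>, at sections) are meaningful.\<close>

abbreviation points :: "('a, 'b) ringed_space \<Rightarrow> 'a set" where
  "points X \<equiv> topspace (zariski X)"

text \<open>In the sheaf axioms the covering family may be empty; this forces \<open>sect X {}\<close> to be the
  zero ring.\<close>

definition is_ringed_space :: "('a, 'b) ringed_space \<Rightarrow> bool" where
  "is_ringed_space X \<longleftrightarrow>
     (\<forall>U. openin (zariski X) U \<longrightarrow> cring (sect X U)) \<and>
     (\<forall>U V. openin (zariski X) U \<longrightarrow> openin (zariski X) V \<longrightarrow> V \<subseteq> U \<longrightarrow>
        rst X U V \<in> ring_hom (sect X U) (sect X V)) \<and>
     (\<forall>U. openin (zariski X) U \<longrightarrow> (\<forall>s\<in>carrier (sect X U). rst X U U s = s)) \<and>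
     (\<forall>U V W. openin (zariski X) U \<longrightarrow> openin (zariski X) V \<longrightarrow> openin (zariski X) W \<longrightarrow>
        W \<subseteq> V \<longrightarrow> V \<subseteq> U \<longrightarrow>
        (\<forall>s\<in>carrier (sect X U). rst X V W (rst X U V s) = rst X U W s)) \<and>
     (\<forall>\<U>. (\<forall>V\<in>\<U>. openin (zariski X) V) \<longrightarrow>
        (\<forall>s\<in>carrier (sect X (\<Union>\<U>)). \<forall>t\<in>carrier (sect X (\<Union>\<U>)).
           (\<forall>V\<in>\<U>. rst X (\<Union>\<U>) V s = rst X (\<Union>\<U>) V t) \<longrightarrow> s = t)) \<and>
     (\<forall>\<U> s. (\<forall>V\<in>\<U>. openin (zariski X) V \<and> s V \<in> carrier (sect X V)) \<longrightarrow>
        (\<forall>V\<in>\<U>. \<forall>W\<in>\<U>. rst X V (V \<inter> W) (s V) = rst X W (V \<inter> W) (s W)) \<longrightarrow>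
        (\<exists>t\<in>carrier (sect X (\<Union>\<U>)). \<forall>V\<in>\<U>. rst X (\<Union>\<U>) V t = s V))"

definition open_subspace :: "('a, 'b) ringed_space \<Rightarrow> 'a set \<Rightarrow> ('a, 'b) ringed_space" where
  "open_subspace X U = X\<lparr>zariski := subtopology (zariski X) U\<rparr>"

definition ringed_space_iso ::
    "('a, 'b) ringed_space \<Rightarrow> ('c, 'd) ringed_space \<Rightarrow> bool" where
  "ringed_space_iso X Y \<longleftrightarrow>
     (\<exists>\<phi> \<theta>. homeomorphic_map (zariski X) (zariski Y) \<phi> \<and>
        (\<forall>V. openin (zariski Y) V \<longrightarrow>
           \<theta> V \<in> ring_iso (sect Y V) (sect X {x \<in> points X. \<phi> x \<in> V})) \<and>
        (\<forall>V W. openin (zariski Y) V \<longrightarrow> openin (zariski Y) W \<longrightarrow> W \<subseteq> V \<longrightarrow>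
           (\<forall>s\<in>carrier (sect Y V).
              rst X {x \<in> points X. \<phi> x \<in> V} {x \<in> points X. \<phi> x \<in> W} (\<theta> V s) =
              \<theta> W (rst Y V W s))))"


subsection \<open>Localization and the spectrum of a ring\<close>

definition frac :: "('r, 'm) ring_scheme \<Rightarrow> 'r set \<Rightarrow> 'r \<Rightarrow> 'r \<Rightarrow> ('r \<times> 'r) set" where
  "frac A S a s = {(b, t). b \<in> carrier A \<and> t \<in> S \<and>
     (\<exists>u\<in>S. u \<otimes>\<^bsub>A\<^esub> (t \<otimes>\<^bsub>A\<^esub> a) = u \<otimes>\<^bsub>A\<^esub> (s \<otimes>\<^bsub>A\<^esub> b))}"

definition localization :: "('r, 'm) ring_scheme \<Rightarrow> 'r set \<Rightarrow> ('r \<times> 'r) set ring" where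
  "localization A S =
     \<lparr>carrier = {frac A S a s | a s. a \<in> carrier A \<and> s \<in> S},
      mult = (\<lambda>P Q. \<Union>(a, s)\<in>P. \<Union>(b, t)\<in>Q. frac A S (a \<otimes>\<^bsub>A\<^esub> b) (s \<otimes>\<^bsub>A\<^esub> t)),
      one = frac A S \<one>\<^bsub>A\<^esub> \<one>\<^bsub>A\<^esub>,
      zero = frac A S \<zero>\<^bsub>A\<^esub> \<one>\<^bsub>A\<^esub>,
      add = (\<lambda>P Q. \<Union>(a, s)\<in>P. \<Union>(b, t)\<in>Q.
               frac A S ((t \<otimes>\<^bsub>A\<^esub> a) \<oplus>\<^bsub>A\<^esub> (s \<otimes>\<^bsub>A\<^esub> b)) (s \<otimes>\<^bsub>A\<^esub> t))\<rparr>"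

abbreviation local_at :: "('r, 'm) ring_scheme \<Rightarrow> 'r set \<Rightarrow> ('r \<times> 'r) set ring" where
  "local_at A P \<equiv> localization A (carrier A - P)"

definition spec_top :: "('r, 'm) ring_scheme \<Rightarrow> 'r set topology" where
  "spec_top A = topology_generated_by {{P. primeideal P A \<and> f \<notin> P} | f. f \<in> carrier A}"

text \<open>Sections over \<open>U\<close> are the dependent functions \<open>\<sigma>\<close> on \<open>U\<close> with \<open>\<sigma> P \<in> A\<^sub>P\<close> that are
  locally given by a single fraction.\<close>

definition spec_sect ::
    "('r, 'm) ring_scheme \<Rightarrow> 'r set set \<Rightarrow> ('r set \<Rightarrow> ('r \<times> 'r) set) ring" where
  "spec_sect A U =
     \<lparr>carrier = {\<sigma> \<in> (\<Pi>\<^sub>E P\<in>U. carrier (local_at A P)).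
        \<forall>P\<in>U. \<exists>V a s. openin (spec_top A) V \<and> P \<in> V \<and> V \<subseteq> U \<and> a \<in> carrier A \<and> s \<in> carrier A \<and>
          (\<forall>Q\<in>V. s \<notin> Q \<and> \<sigma> Q = frac A (carrier A - Q) a s)},
      mult = (\<lambda>\<sigma> \<tau>. \<lambda>P\<in>U. \<sigma> P \<otimes>\<^bsub>local_at A P\<^esub> \<tau> P),
      one = (\<lambda>P\<in>U. \<one>\<^bsub>local_at A P\<^esub>),
      zero = (\<lambda>P\<in>U. \<zero>\<^bsub>local_at A P\<^esub>),
      add = (\<lambda>\<sigma> \<tau>. \<lambda>P\<in>U. \<sigma> P \<oplus>\<^bsub>local_at A P\<^esub> \<tau> P)\<rparr>"

definition Spec :: "('r, 'm) ring_scheme \<Rightarrow> ('r set, 'r set \<Rightarrow> ('r \<times> 'r) set) ringed_space" where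
  "Spec A = \<lparr>zariski = spec_top A, sect = spec_sect A, rst = (\<lambda>U V \<sigma>. restrict \<sigma> V)\<rparr>"


subsection \<open>Schemes\<close>

definition affine_open :: "('a, 'b) ringed_space \<Rightarrow> 'a set \<Rightarrow> bool" where
  "affine_open X U \<longleftrightarrow> openin (zariski X) U \<and>
     (\<exists>A :: 'b ring. cring A \<and> ringed_space_iso (open_subspace X U) (Spec A))"

text \<open>Stalks need not be assumed local: they are, by the isomorphism with spectra.\<close>

definition scheme :: "('a, 'b) ringed_space \<Rightarrow> bool" where
  "scheme X \<longleftrightarrow> is_ringed_space X \<and> (\<forall>x\<in>points X. \<exists>U. x \<in> U \<and> affine_open X U)"

definition integral_scheme :: "('a, 'b) ringed_space \<Rightarrow> bool" where
  "integral_scheme X \<longleftrightarrow> scheme X \<and> points X \<noteq> {} \<and>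
     (\<forall>U. openin (zariski X) U \<longrightarrow> U \<noteq> {} \<longrightarrow> domain (sect X U))"

definition noetherian_scheme :: "('a, 'b) ringed_space \<Rightarrow> bool" where
  "noetherian_scheme X \<longleftrightarrow> scheme X \<and>
     (\<exists>\<U>. finite \<U> \<and> \<Union>\<U> = points X \<and>
        (\<forall>U\<in>\<U>. affine_open X U \<and> noetherian_ring (sect X U)))"

text \<open>\<open>X \<times> X\<close> is covered by the affine schemes \<open>U \<times> V\<close>, \<open>U\<close> and \<open>V\<close> affine open. The diagonal is a
  closed immersion iff each of its restrictions \<open>U \<inter> V \<rightarrow> U \<times> V = Spec (\<O>(U) \<otimes> \<O>(V))\<close> is one, that is,
  iff \<open>U \<inter> V\<close> is affine and \<open>\<O>(U) \<otimes> \<O>(V) \<rightarrow> \<O>(U \<inter> V)\<close> is surjective. The image of the latter is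
  the subring generated by the images of \<open>\<O>(U)\<close> and \<open>\<O>(V)\<close>.\<close>

definition separated_scheme :: "('a, 'b) ringed_space \<Rightarrow> bool" where
  "separated_scheme X \<longleftrightarrow> scheme X \<and>
     (\<forall>U V. affine_open X U \<longrightarrow> affine_open X V \<longrightarrow>
        affine_open X (U \<inter> V) \<and>
        generate_ring (sect X (U \<inter> V))
          (rst X U (U \<inter> V) ` carrier (sect X U) \<union> rst X V (U \<inter> V) ` carrier (sect X V)) =
        carrier (sect X (U \<inter> V)))"

definition scheme_char :: "('a, 'b) ringed_space \<Rightarrow> nat \<Rightarrow> bool" where
  "scheme_char X p \<longleftrightarrow> Factorial_Ring.prime p \<and>
     (\<forall>U. openin (zariski X) U \<longrightarrow> [p] \<cdot>\<^bsub>sect X U\<^esub> \<one>\<^bsub>sect X U\<^esub> = \<zero>\<^bsub>sect X U\<^esub>)"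


section \<open>Function field, local rings and residue fields of an integral scheme\<close>

definition germ :: "('a, 'b) ringed_space \<Rightarrow> 'a \<Rightarrow> 'a set \<Rightarrow> 'b \<Rightarrow> ('a set \<times> 'b) set" where
  "germ X x U s = {(V, t). openin (zariski X) V \<and> x \<in> V \<and> t \<in> carrier (sect X V) \<and>
     (\<exists>W. openin (zariski X) W \<and> x \<in> W \<and> W \<subseteq> U \<inter> V \<and> rst X U W s = rst X V W t)}"

definition stalk :: "('a, 'b) ringed_space \<Rightarrow> 'a \<Rightarrow> ('a set \<times> 'b) set ring" where
  "stalk X x =
     \<lparr>carrier = {germ X x U s | U s. openin (zariski X) U \<and> x \<in> U \<and> s \<in> carrier (sect X U)},
      mult = (\<lambda>P Q. \<Union>(U, s)\<in>P. \<Union>(V, t)\<in>Q.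
        germ X x (U \<inter> V) (rst X U (U \<inter> V) s \<otimes>\<^bsub>sect X (U \<inter> V)\<^esub> rst X V (U \<inter> V) t)),
      one = germ X x (points X) \<one>\<^bsub>sect X (points X)\<^esub>,
      zero = germ X x (points X) \<zero>\<^bsub>sect X (points X)\<^esub>,
      add = (\<lambda>P Q. \<Union>(U, s)\<in>P. \<Union>(V, t)\<in>Q.
        germ X x (U \<inter> V) (rst X U (U \<inter> V) s \<oplus>\<^bsub>sect X (U \<inter> V)\<^esub> rst X V (U \<inter> V) t))\<rparr>"

definition generic_point :: "('a, 'b) ringed_space \<Rightarrow> 'a" where
  "generic_point X =
     (THE \<eta>. \<eta> \<in> points X \<and> Abstract_Topology.closure_of (zariski X) {\<eta>} = points X)"

type_synonym ('a, 'b) rat_fun = "('a set \<times> 'b) set"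

definition func_field :: "('a, 'b) ringed_space \<Rightarrow> ('a, 'b) rat_fun ring" where
  "func_field X = stalk X (generic_point X)"

text \<open>On an integral scheme the maps from \<open>\<O>\<^sub>X(U)\<close>, \<open>U\<close> nonempty open, and from \<open>\<O>\<^sub>X\<^sub>,\<^sub>x\<close> to the
  function field \<open>L\<close> are injective. The next two sets are their images, with which
  \<open>\<O>\<^sub>X(U)\<close> and \<open>\<O>\<^sub>X\<^sub>,\<^sub>x\<close> are identified from now on; restriction and specialization maps become
  inclusions.\<close>

definition regular :: "('a, 'b) ringed_space \<Rightarrow> 'a set \<Rightarrow> ('a, 'b) rat_fun set" where
  "regular X U = germ X (generic_point X) U ` carrier (sect X U)"

definition regular_at :: "('a, 'b) ringed_space \<Rightarrow> 'a \<Rightarrow> ('a, 'b) rat_fun set" where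
  "regular_at X x = \<Union>{regular X U | U. openin (zariski X) U \<and> x \<in> U}"

definition local_ring :: "('a, 'b) ringed_space \<Rightarrow> 'a \<Rightarrow> ('a, 'b) rat_fun ring" where
  "local_ring X x = (func_field X)\<lparr>carrier := regular_at X x\<rparr>"

definition max_ideal :: "('a, 'b) ringed_space \<Rightarrow> 'a \<Rightarrow> ('a, 'b) rat_fun set" where
  "max_ideal X x = regular_at X x - Units (local_ring X x)"

definition residue_field :: "('a, 'b) ringed_space \<Rightarrow> 'a \<Rightarrow> ('a, 'b) rat_fun set ring" where
  "residue_field X x = local_ring X x Quot max_ideal X x"

definition residue ::
    "('a, 'b) ringed_space \<Rightarrow> 'a \<Rightarrow> ('a, 'b) rat_fun \<Rightarrow> ('a, 'b) rat_fun set" where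
  "residue X x f = max_ideal X x +>\<^bsub>local_ring X x\<^esub> f"

text \<open>The reduced closed subscheme on the closure \<open>Z\<close> of \<open>x\<close>: its points, the stalk at \<open>y\<close> of its
  ideal sheaf (the functions vanishing on \<open>Z\<close>; for \<open>y \<notin> Z\<close> this is all of \<open>\<O>\<^sub>X\<^sub>,\<^sub>y\<close>), and, for \<open>z \<in> Z\<close>,
  its local ring \<open>\<O>\<^sub>Z\<^sub>,\<^sub>z\<close> and maximal ideal, as subsets of its function field \<open>\<kappa>(x)\<close>.\<close>

definition pt_closure :: "('a, 'b) ringed_space \<Rightarrow> 'a \<Rightarrow> 'a set" where
  "pt_closure X x = Abstract_Topology.closure_of (zariski X) {x}"

definition ideal_at :: "('a, 'b) ringed_space \<Rightarrow> 'a \<Rightarrow> 'a \<Rightarrow> ('a, 'b) rat_fun set" where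
  "ideal_at X x y = {f. \<exists>U. openin (zariski X) U \<and> y \<in> U \<and> f \<in> regular X U \<and>
     (\<forall>z \<in> pt_closure X x \<inter> U. f \<in> max_ideal X z)}"

definition sub_regular_at ::
    "('a, 'b) ringed_space \<Rightarrow> 'a \<Rightarrow> 'a \<Rightarrow> ('a, 'b) rat_fun set set" where
  "sub_regular_at X x z = residue X x ` regular_at X z"

definition sub_max_ideal ::
    "('a, 'b) ringed_space \<Rightarrow> 'a \<Rightarrow> 'a \<Rightarrow> ('a, 'b) rat_fun set set" where
  "sub_max_ideal X x z = residue X x ` max_ideal X z"


section \<open>The beth space\<close>

definition valuation :: "('k, 'm) ring_scheme \<Rightarrow> ('k \<Rightarrow> ereal) \<Rightarrow> bool" where
  "valuation K w \<longleftrightarrow> w \<in> extensional (carrier K) \<and>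
     (\<forall>a\<in>carrier K. w a \<noteq> -\<infinity> \<and> (w a = \<infinity> \<longleftrightarrow> a = \<zero>\<^bsub>K\<^esub>)) \<and>
     (\<forall>a\<in>carrier K. \<forall>b\<in>carrier K.
        w (a \<otimes>\<^bsub>K\<^esub> b) = w a + w b \<and> min (w a) (w b) \<le> w (a \<oplus>\<^bsub>K\<^esub> b))"

type_synonym ('a, 'b) semival = "(('a, 'b) rat_fun set \<Rightarrow> ereal) \<times> 'a"

abbreviation home :: "('a, 'b) semival \<Rightarrow> 'a" where
  "home \<equiv> snd"

definition beth :: "('a, 'b) ringed_space \<Rightarrow> ('a, 'b) semival set" where
  "beth X = {(w, x). x \<in> points X \<and> valuation (residue_field X x) w \<and>
     (\<exists>z\<in>pt_closure X x. \<forall>a\<in>sub_regular_at X x z. 0 \<le> w a)}"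

definition semival_at ::
    "('a, 'b) ringed_space \<Rightarrow> ('a, 'b) semival \<Rightarrow> ('a, 'b) rat_fun \<Rightarrow> ereal" where
  "semival_at X \<zeta> f = fst \<zeta> (residue X (home \<zeta>) f)"

text \<open>The valuation ring \<open>{w \<ge> 0}\<close>, with maximal ideal \<open>{w > 0}\<close>, dominates \<open>\<O>\<^sub>Z\<^sub>,\<^sub>z\<close>.\<close>

definition center :: "('a, 'b) ringed_space \<Rightarrow> ('a, 'b) semival \<Rightarrow> 'a" where
  "center X \<zeta> = (THE z. z \<in> pt_closure X (home \<zeta>) \<and>
     (\<forall>a\<in>sub_regular_at X (home \<zeta>) z. 0 \<le> fst \<zeta> a) \<and>
     {a \<in> sub_regular_at X (home \<zeta>) z. 0 < fst \<zeta> a} = sub_max_ideal X (home \<zeta>) z)"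

definition beth_on :: "('a, 'b) ringed_space \<Rightarrow> 'a set \<Rightarrow> ('a, 'b) semival set" where
  "beth_on X V = {\<zeta> \<in> beth X. center X \<zeta> \<in> V}"

definition beth_top_affine ::
    "('a, 'b) ringed_space \<Rightarrow> 'a set \<Rightarrow> ('a, 'b) semival topology" where
  "beth_top_affine X V = topology_generated_by
     {{\<zeta> \<in> beth_on X V. semival_at X \<zeta> f \<in> W} | f W. f \<in> regular X V \<and> open W}"

definition beth_top :: "('a, 'b) ringed_space \<Rightarrow> ('a, 'b) semival topology" where
  "beth_top X = topology (\<lambda>\<U>. \<U> \<subseteq> beth X \<and>
     (\<forall>V. affine_open X V \<longrightarrow> openin (beth_top_affine X V) (\<U> \<inter> beth_on X V)))"

lemma openin_beth_top:
  "openin (beth_top X) \<U> \<longleftrightarrow> \<U> \<subseteq> beth X \<and>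
     (\<forall>V. affine_open X V \<longrightarrow> openin (beth_top_affine X V) (\<U> \<inter> beth_on X V))"
proof -
  let ?P = "\<lambda>\<U>. \<U> \<subseteq> beth X \<and>
     (\<forall>V. affine_open X V \<longrightarrow> openin (beth_top_affine X V) (\<U> \<inter> beth_on X V))"
  have "istopology ?P"
    unfolding istopology_def
  proof (intro conjI allI impI)
    fix S T V assume S: "?P S" and T: "?P T"
    show "S \<inter> T \<subseteq> beth X" using S by blast
    assume "affine_open X V"
    then have "openin (beth_top_affine X V) ((S \<inter> beth_on X V) \<inter> (T \<inter> beth_on X V))"
      using S T by blast
    moreover have "(S \<inter> beth_on X V) \<inter> (T \<inter> beth_on X V) = S \<inter> T \<inter> beth_on X V" by blast
    ultimately show "openin (beth_top_affine X V) (S \<inter> T \<inter> beth_on X V)" by simp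
  next
    fix K V assume K: "\<forall>S\<in>K. ?P S"
    show "\<Union>K \<subseteq> beth X" using K by blast
    assume "affine_open X V"
    then have "openin (beth_top_affine X V) (\<Union>S\<in>K. S \<inter> beth_on X V)"
      using K by blast
    moreover have "(\<Union>S\<in>K. S \<inter> beth_on X V) = \<Union>K \<inter> beth_on X V" by blast
    ultimately show "openin (beth_top_affine X V) (\<Union>K \<inter> beth_on X V)" by simp
  qed
  then show ?thesis
    unfolding beth_top_def by (simp add: topology_inverse')
qed

text \<open>\<open>Val\<^sub>X\<close>. The function field of \<open>X\<close> appears here as the residue field of the generic point.\<close>

definition Val :: "('a, 'b) ringed_space \<Rightarrow> ('a, 'b) semival set" where
  "Val X = {\<zeta> \<in> beth X. home \<zeta> = generic_point X}"

definition discrete_closure ::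
    "('a, 'b) ringed_space \<Rightarrow> ('a, 'b) semival set"  (\<open>\<DD>\<close>) where
  "\<DD> X = Abstract_Topology.closure_of (beth_top X)
     {\<zeta> \<in> Val X. \<forall>f \<in> carrier (func_field X) - {\<zero>\<^bsub>func_field X\<^esub>}.
        \<exists>n :: int. semival_at X \<zeta> f = ereal (of_int n)}"


section \<open>Cartier subalgebras\<close>

definition p_linear :: "('k, 'm) ring_scheme \<Rightarrow> nat \<Rightarrow> nat \<Rightarrow> ('k \<Rightarrow> 'k) set" where
  "p_linear K p e = {\<psi> \<in> carrier K \<rightarrow>\<^sub>E carrier K.
     (\<forall>f\<in>carrier K. \<forall>g\<in>carrier K. \<psi> (f \<oplus>\<^bsub>K\<^esub> g) = \<psi> f \<oplus>\<^bsub>K\<^esub> \<psi> g) \<and>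
     (\<forall>f\<in>carrier K. \<forall>g\<in>carrier K. \<psi> ((f [^]\<^bsub>K\<^esub> (p ^ e)) \<otimes>\<^bsub>K\<^esub> g) = f \<otimes>\<^bsub>K\<^esub> \<psi> g)}"

type_synonym ('a, 'b) rat_map = "('a, 'b) rat_fun \<Rightarrow> ('a, 'b) rat_fun"

definition cartier_maps ::
    "('a, 'b) ringed_space \<Rightarrow> nat \<Rightarrow> nat \<Rightarrow> 'a set \<Rightarrow> ('a, 'b) rat_map set" where
  "cartier_maps X p e U = {\<psi> \<in> p_linear (func_field X) p e.
     \<forall>V. openin (zariski X) V \<longrightarrow> V \<noteq> {} \<longrightarrow> V \<subseteq> U \<longrightarrow> \<psi> ` regular X V \<subseteq> regular X V}"

text \<open>A Cartier subalgebra is given by its homogeneous components \<open>D e U = \<D>\<^sub>e(U)\<close>, \<open>U\<close> nonempty open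
  (sections over the empty set carry no information, and \<open>D e {}\<close> is never used). They are sets of
  self-maps of \<open>L\<close>, so restriction maps are inclusions. The last clause is quasi-coherence: for \<open>U\<close>
  affine, the localization of the \<open>\<O>(U)\<close>-module \<open>\<D>\<^sub>e(U)\<close> at \<open>f\<close> maps isomorphically to the sections
  over the basic open set of \<open>f\<close>. This map is automatically injective here. Left and right module
  structures give the same condition because \<open>f\<psi> = \<psi>f\<^sup>q\<close>, \<open>q = p\<^sup>e\<close>.\<close>

definition cartier_subalgebra ::
    "('a, 'b) ringed_space \<Rightarrow> nat \<Rightarrow> (nat \<Rightarrow> 'a set \<Rightarrow> ('a, 'b) rat_map set) \<Rightarrow> bool" where
  "cartier_subalgebra X p D \<longleftrightarrow>
     (let L = func_field X; opn = (\<lambda>U. openin (zariski X) U \<and> U \<noteq> {}) in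
     (\<forall>e U. opn U \<longrightarrow> D e U \<subseteq> cartier_maps X p e U) \<and>
     (\<forall>e U. opn U \<longrightarrow>
        (\<lambda>g\<in>carrier L. \<zero>\<^bsub>L\<^esub>) \<in> D e U \<and>
        (\<forall>\<psi>\<in>D e U. (\<lambda>g\<in>carrier L. \<ominus>\<^bsub>L\<^esub> \<psi> g) \<in> D e U) \<and>
        (\<forall>\<psi>\<in>D e U. \<forall>\<phi>\<in>D e U. (\<lambda>g\<in>carrier L. \<psi> g \<oplus>\<^bsub>L\<^esub> \<phi> g) \<in> D e U)) \<and>
     (\<forall>d e U. opn U \<longrightarrow>
        (\<forall>\<psi>\<in>D d U. \<forall>\<phi>\<in>D e U. compose (carrier L) \<psi> \<phi> \<in> D (d + e) U)) \<and>
     (\<forall>U. opn U \<longrightarrow> D 0 U = {\<lambda>g\<in>carrier L. f \<otimes>\<^bsub>L\<^esub> g | f. f \<in> regular X U}) \<and>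
     (\<forall>e U V. opn U \<longrightarrow> opn V \<longrightarrow> V \<subseteq> U \<longrightarrow> D e U \<subseteq> D e V) \<and>
     (\<forall>e \<U>. \<U> \<noteq> {} \<longrightarrow> (\<forall>V\<in>\<U>. opn V) \<longrightarrow> (\<Inter>V\<in>\<U>. D e V) \<subseteq> D e (\<Union>\<U>)) \<and>
     (\<forall>e U f. opn U \<longrightarrow> affine_open X U \<longrightarrow> f \<in> regular X U \<longrightarrow> f \<noteq> \<zero>\<^bsub>L\<^esub> \<longrightarrow>
        D e {y \<in> U. f \<notin> max_ideal X y} =
        {\<psi> \<in> p_linear L p e. \<exists>n::nat. (\<lambda>g\<in>carrier L. (f [^]\<^bsub>L\<^esub> n) \<otimes>\<^bsub>L\<^esub> \<psi> g) \<in> D e U}))"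

definition cartier_stalk ::
    "('a, 'b) ringed_space \<Rightarrow> (nat \<Rightarrow> 'a set \<Rightarrow> ('a, 'b) rat_map set) \<Rightarrow>
     nat \<Rightarrow> 'a \<Rightarrow> ('a, 'b) rat_map set" where
  "cartier_stalk X D e x = \<Union>{D e U | U. openin (zariski X) U \<and> x \<in> U}"

text \<open>Closed integral subschemes \<open>Z\<close> are given by their generic points \<open>x\<close>.\<close>

definition uniformly_compatible ::
    "('a, 'b) ringed_space \<Rightarrow> (nat \<Rightarrow> 'a set \<Rightarrow> ('a, 'b) rat_map set) \<Rightarrow> 'a \<Rightarrow> bool" where
  "uniformly_compatible X D x \<longleftrightarrow>
     (\<forall>y\<in>points X. \<forall>e\<ge>1. \<forall>\<psi>\<in>cartier_stalk X D e y. \<psi> ` ideal_at X x y \<subseteq> ideal_at X x y)"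

text \<open>The map induced on \<open>\<kappa>(x) = \<O>\<^sub>X\<^sub>,\<^sub>x/\<mm>\<^sub>x\<close> by a map \<open>\<psi>\<close> that preserves \<open>\<O>\<^sub>X\<^sub>,\<^sub>x\<close> and \<open>\<mm>\<^sub>x\<close>
  (all \<open>\<psi> a\<close> with \<open>a\<close> in the coset \<open>P\<close> have the same residue).\<close>

definition induced_map ::
    "('a, 'b) ringed_space \<Rightarrow> 'a \<Rightarrow> ('a, 'b) rat_map \<Rightarrow>
     ('a, 'b) rat_fun set \<Rightarrow> ('a, 'b) rat_fun set" where
  "induced_map X x \<psi> = (\<lambda>P\<in>carrier (residue_field X x). \<Union>a\<in>P. residue X x (\<psi> a))"

text \<open>The stalk at \<open>z \<in> Z\<close> of the degree \<open>e\<close> component of \<open>\<D>\<parallel>\<^sub>Z\<close>.\<close>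

definition induced_stalk ::
    "('a, 'b) ringed_space \<Rightarrow> (nat \<Rightarrow> 'a set \<Rightarrow> ('a, 'b) rat_map set) \<Rightarrow>
     'a \<Rightarrow> nat \<Rightarrow> 'a \<Rightarrow> (('a, 'b) rat_fun set \<Rightarrow> ('a, 'b) rat_fun set) set" where
  "induced_stalk X D x e z = induced_map X x ` cartier_stalk X D e z"


section \<open>Log discrepancies\<close>

text \<open>If \<open>\<psi> f = 0\<close>, then \<open>v (\<psi> f) = \<infinity>\<close> and the value is \<open>-\<infinity>\<close>.\<close>

definition E_disc ::
    "nat \<Rightarrow> nat \<Rightarrow> 'k \<Rightarrow> ('k \<Rightarrow> 'k) \<Rightarrow> ('k \<Rightarrow> ereal) \<Rightarrow> ereal" where
  "E_disc p e f \<psi> v = (v f - ereal (real (p ^ e)) * v (\<psi> f)) / ereal (real (p ^ e) - 1)"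

text \<open>Here \<open>\<psi>\<close> is \<open>p\<close>-linear of exponent \<open>e\<close>, so that its \<open>n\<close>-th iterate has exponent \<open>n * e\<close>.\<close>

definition log_disc_map ::
    "('k, 'm) ring_scheme \<Rightarrow> nat \<Rightarrow> nat \<Rightarrow> ('k \<Rightarrow> 'k) \<Rightarrow> ('k \<Rightarrow> ereal) \<Rightarrow> ereal" where
  "log_disc_map K p e \<psi> v =
     Sup {E_disc p (n * e) f (\<psi> ^^ n) v | f n. f \<in> carrier K \<and> f \<noteq> \<zero>\<^bsub>K\<^esub> \<and> 1 \<le> n}"

text \<open>\<open>A(\<zeta>;\<D>)\<close>, computed on \<open>\<kappa>(x)\<close>, the function field of the closure \<open>Z\<close> of the home \<open>x\<close>. For \<open>x\<close>
  the generic point this is the definition on \<open>Val\<^sub>X\<close>: then \<open>Z = X\<close> is always compatible and \<open>\<kappa>(x)\<close> is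
  \<open>L\<close>. The supremum of the empty set is \<open>-\<infinity>\<close>.\<close>

definition log_disc ::
    "('a, 'b) ringed_space \<Rightarrow> nat \<Rightarrow> (nat \<Rightarrow> 'a set \<Rightarrow> ('a, 'b) rat_map set) \<Rightarrow>
     ('a, 'b) semival \<Rightarrow> ereal" where
  "log_disc X p D \<zeta> =
     (if uniformly_compatible X D (home \<zeta>) then
        (let K = residue_field X (home \<zeta>) in
         Sup {log_disc_map K p e \<psi> (fst \<zeta>) | e \<psi>. 1 \<le> e \<and>
                \<psi> \<in> induced_stalk X D (home \<zeta>) e (center X \<zeta>) \<and>
                (\<exists>a\<in>carrier K. \<psi> a \<noteq> \<zero>\<^bsub>K\<^esub>)})
      else \<infinity>)"

text \<open>The infimum is attained, so it is the minimum.\<close>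

definition mld_beth ::
    "('a, 'b) ringed_space \<Rightarrow> nat \<Rightarrow> (nat \<Rightarrow> 'a set \<Rightarrow> ('a, 'b) rat_map set) \<Rightarrow> 'a \<Rightarrow> ereal" where
  "mld_beth X p D x = Inf {log_disc X p D \<zeta> | \<zeta>. \<zeta> \<in> \<DD> X \<and> center X \<zeta> = x}"


section \<open>Constructible topology and semicontinuity\<close>

definition constructible_top :: "'a topology \<Rightarrow> 'a topology" where
  "constructible_top T = topology_generated_by ({U. openin T U} \<union> {C. closedin T C})"

definition locally_closed_in :: "'a topology \<Rightarrow> 'a set \<Rightarrow> bool" where
  "locally_closed_in T G \<longleftrightarrow> (\<exists>U C. openin T U \<and> closedin T C \<and> G = U \<inter> C)"

definition lower_semicontinuous :: "'a topology \<Rightarrow> ('a \<Rightarrow> ereal) \<Rightarrow> bool" where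
  "lower_semicontinuous T f \<longleftrightarrow> (\<forall>a::real. openin T {y \<in> topspace T. ereal a < f y})"

end

theory Submission
  imports Defs
begin

text \<open>The proof is a compactness argument. For \<open>V\<close> affine open, a point of \<open>V\<^sup>\<beth>\<close> is determined by
  its values on \<open>\<O>(V)\<close>, and \<open>V\<^sup>\<beth>\<close> is compact as a closed subset of a power of \<open>[0, \<infinity>]\<close>.
  Clearing denominators, \<open>A(\<zeta>; \<D>) > a\<close> holds iff for some \<open>e \<ge> 1\<close>, \<open>\<psi> \<in> \<D>\<^sub>e(V)\<close>, \<open>f \<in> \<O>(V)\<close> and real \<open>r\<close>
  one has \<open>\<zeta>(\<psi> f) < r\<close> and \<open>\<zeta>(f) > q r + (q - 1) a\<close>, where \<open>q = p\<^sup>e\<close>; if the home of \<open>\<zeta>\<close> is not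
  compatible with \<open>\<D>\<close>, then \<open>f\<close> can be chosen with \<open>\<zeta>(f) = \<infinity>\<close>. So \<open>{A \<le> a}\<close> is closed in \<open>V\<^sup>\<beth>\<close>. On the
  closure of the discrete valuations no regular function takes a value in \<open>(0, 1)\<close>, so that
  there the center is continuous for the constructible topology. This topology is Hausdorff, and
  therefore the centers of the \<open>\<zeta>\<close> in this closure with \<open>A(\<zeta>; \<D>) \<le> a\<close> form a closed set.\<close>

section \<open>Localizations and spectra\<close>

text \<open>\<open>A(\<zeta>; \<D>)\<close> is computed on a residue field that changes with the
  home of \<open>\<zeta>\<close>, from stalks at its center, and neither varies continuously; hence
  a criterion using only data over a fixed \<open>V\<close>. Nothing is lost in it: replacing
  \<open>f\<close> by c^q f and \<open>\<psi>\<close> by g \<open>\<psi>\<close>, where g does not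
  vanish at the center and so has value 0, changes \<open>\<zeta>(f)\<close> and
  \<open>q \<zeta>(\<psi> f)\<close> by the same finite amount, and iterates of
  \<open>\<psi>\<close> again belong to \<open>\<D>\<close>. The number r is needed because
  \<open>\<zeta>(f) - q \<zeta>(\<psi> f)\<close> has no continuous extension to the place where
  both values are infinite, while each of the two inequalities with r is open by itself.

  A limit of valuations of L may take the value \<infinity> on nonzero functions. For a limit W on
  \<open>\<O>(V)\<close>, the home is the point of the prime ideal \<open>W = \<infinity>\<close>
  and the center that of the prime ideal \<open>W > 0\<close>. Separatedness makes the center
  unique. Noetherianity describes an open set by finitely many functions, so that lying outside it
  is also an open condition on \<open>\<zeta>\<close>. The first half of the proof turns the bare
  definition of a scheme into these facts about primes and fractions.\<close>

lemma UN_pair_const: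
  assumes "(a, s) \<in> P" "(b, t) \<in> Q"
    and "\<And>a s b t. (a, s) \<in> P \<Longrightarrow> (b, t) \<in> Q \<Longrightarrow> F a s b t = C"
  shows "(\<Union>(a, s)\<in>P. \<Union>(b, t)\<in>Q. F a s b t) = C"
proof
  show "(\<Union>(a, s)\<in>P. \<Union>(b, t)\<in>Q. F a s b t) \<subseteq> C" using assms(3) by fastforce
  show "C \<subseteq> (\<Union>(a, s)\<in>P. \<Union>(b, t)\<in>Q. F a s b t)" using assms by fastforce
qed

locale mult_submonoid = cring A for A :: "('r, 'm) ring_scheme" (structure) +
  fixes S :: "'r set"
  assumes S_carr: "S \<subseteq> carrier A" and S_one: "\<one> \<in> S"
    and S_mult: "\<And>s t. s \<in> S \<Longrightarrow> t \<in> S \<Longrightarrow> s \<otimes> t \<in> S"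
begin

lemma S_mem [dest, intro]: "s \<in> S \<Longrightarrow> s \<in> carrier A" using S_carr by blast

lemma frac_rel_trans:
  assumes "a \<in> carrier A" "b \<in> carrier A" "c \<in> carrier A" "s \<in> S" "t \<in> S" "r \<in> S"
    and u: "u \<in> S" "u \<otimes> (t \<otimes> a) = u \<otimes> (s \<otimes> b)"
    and w: "w \<in> S" "w \<otimes> (r \<otimes> b) = w \<otimes> (t \<otimes> c)"
  shows "\<exists>z\<in>S. z \<otimes> (r \<otimes> a) = z \<otimes> (s \<otimes> c)"
proof
  note car = S_mem[OF assms(4)] S_mem[OF assms(5)] S_mem[OF assms(6)] S_mem[OF u(1)] S_mem[OF w(1)] assms(1-3)
  \<comment> \<open>The middle denominator \<open>t\<close> is part of the multiplier: elements of
    \<open>S\<close> may be zero divisors, so it cannot be cancelled afterwards.\<close>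
  show "u \<otimes> w \<otimes> t \<in> S" using assms by (simp add: S_mult)
  have "u \<otimes> w \<otimes> t \<otimes> (r \<otimes> a) = w \<otimes> r \<otimes> (u \<otimes> (t \<otimes> a))" using car by algebra
  also have "\<dots> = u \<otimes> s \<otimes> (w \<otimes> (r \<otimes> b))" unfolding u(2) using car by algebra
  also have "\<dots> = u \<otimes> w \<otimes> t \<otimes> (s \<otimes> c)" unfolding w(2) using car by algebra
  finally show "u \<otimes> w \<otimes> t \<otimes> (r \<otimes> a) = u \<otimes> w \<otimes> t \<otimes> (s \<otimes> c)" .
qed

lemma frac_eq_iff:
  assumes "a \<in> carrier A" "b \<in> carrier A" "s \<in> S" "t \<in> S"
  shows "frac A S a s = frac A S b t \<longleftrightarrow> (\<exists>u\<in>S. u \<otimes> (t \<otimes> a) = u \<otimes> (s \<otimes> b))"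
proof
  assume eq: "frac A S a s = frac A S b t"
  have "(b, t) \<in> frac A S b t" using assms S_one by (auto simp: frac_def)
  then show "\<exists>u\<in>S. u \<otimes> (t \<otimes> a) = u \<otimes> (s \<otimes> b)" unfolding eq[symmetric] by (auto simp: frac_def)
next
  assume "\<exists>u\<in>S. u \<otimes> (t \<otimes> a) = u \<otimes> (s \<otimes> b)"
  then obtain u where u: "u \<in> S" "u \<otimes> (t \<otimes> a) = u \<otimes> (s \<otimes> b)" by blast
  have 1: "(\<exists>z\<in>S. z \<otimes> (r \<otimes> a) = z \<otimes> (s \<otimes> c))" if "c \<in> carrier A" "r \<in> S" "\<exists>z\<in>S. z \<otimes> (r \<otimes> b) = z \<otimes> (t \<otimes> c)" for c r
    using frac_rel_trans[OF assms(1,2) that(1) assms(3,4) that(2) u] that(3) by blast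
  have 2: "(\<exists>z\<in>S. z \<otimes> (r \<otimes> b) = z \<otimes> (t \<otimes> c))" if "c \<in> carrier A" "r \<in> S" "\<exists>z\<in>S. z \<otimes> (r \<otimes> a) = z \<otimes> (s \<otimes> c)" for c r
    using frac_rel_trans[OF assms(2,1) that(1) assms(4,3) that(2) u(1) u(2)[symmetric]] that(3) by blast
  show "frac A S a s = frac A S b t" unfolding frac_def using 1 2 by blast
qed

lemma frac_memD:
  assumes "a \<in> carrier A" "s \<in> S" "(b, t) \<in> frac A S a s"
  shows "b \<in> carrier A" "t \<in> S" "\<exists>u\<in>S. u \<otimes> (t \<otimes> a) = u \<otimes> (s \<otimes> b)"
  using assms by (auto simp: frac_def)

lemma frac_self: "a \<in> carrier A \<Longrightarrow> s \<in> S \<Longrightarrow> (a, s) \<in> frac A S a s"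
  using S_one by (auto simp: frac_def)

text \<open>\<open>localization\<close> defines a product as a union over all pairs of
  representatives. By \<open>UN_pair_const\<close> the union has the intended value once all its
  terms coincide; the multipliers \<open>u\<close> and \<open>w\<close> of the two factors combine
  to \<open>u \<otimes> w\<close>.\<close>

lemma frac_mult:
  assumes a: "a \<in> carrier A" "b \<in> carrier A" "s \<in> S" "t \<in> S"
  shows "frac A S a s \<otimes>\<^bsub>localization A S\<^esub> frac A S b t = frac A S (a \<otimes> b) (s \<otimes> t)"
proof -
  have "frac A S (a' \<otimes> b') (s' \<otimes> t') = frac A S (a \<otimes> b) (s \<otimes> t)"
    if m: "(a', s') \<in> frac A S a s" "(b', t') \<in> frac A S b t" for a' s' b' t'
  proof -
    note m1 = frac_memD[OF a(1,3) m(1)] and m2 = frac_memD[OF a(2,4) m(2)]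
    obtain u w where u: "u \<in> S" "u \<otimes> (s' \<otimes> a) = u \<otimes> (s \<otimes> a')" and w: "w \<in> S" "w \<otimes> (t' \<otimes> b) = w \<otimes> (t \<otimes> b')"
      using m1 m2 by blast
    note car = S_mem[OF a(3)] S_mem[OF a(4)] S_mem[OF m1(2)] S_mem[OF m2(2)] S_mem[OF u(1)] S_mem[OF w(1)] a(1,2) m1(1) m2(1)
    have "(u \<otimes> w) \<otimes> ((s \<otimes> t) \<otimes> (a' \<otimes> b')) = (u \<otimes> (s \<otimes> a')) \<otimes> (w \<otimes> (t \<otimes> b'))" using car by algebra
    also have "\<dots> = (u \<otimes> w) \<otimes> ((s' \<otimes> t') \<otimes> (a \<otimes> b))" unfolding u(2)[symmetric] w(2)[symmetric] using car by algebra
    finally show ?thesis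
      using a m1 m2 u w by (subst frac_eq_iff) (auto intro!: S_mult bexI[of _ "u \<otimes> w"])
  qed
  moreover have "(a, s) \<in> frac A S a s" "(b, t) \<in> frac A S b t" using frac_self a by auto
  ultimately have "(\<Union>(a, s)\<in>frac A S a s. \<Union>(b, t)\<in>frac A S b t. frac A S (a \<otimes> b) (s \<otimes> t)) =
      frac A S (a \<otimes> b) (s \<otimes> t)"
    by (intro UN_pair_const)
  then show ?thesis by (simp add: localization_def)
qed

lemma frac_add:
  assumes a: "a \<in> carrier A" "b \<in> carrier A" "s \<in> S" "t \<in> S"
  shows "frac A S a s \<oplus>\<^bsub>localization A S\<^esub> frac A S b t = frac A S ((t \<otimes> a) \<oplus> (s \<otimes> b)) (s \<otimes> t)"
proof -
  have "frac A S ((t' \<otimes> a') \<oplus> (s' \<otimes> b')) (s' \<otimes> t') = frac A S ((t \<otimes> a) \<oplus> (s \<otimes> b)) (s \<otimes> t)"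
    if m: "(a', s') \<in> frac A S a s" "(b', t') \<in> frac A S b t" for a' s' b' t'
  proof -
    note m1 = frac_memD[OF a(1,3) m(1)] and m2 = frac_memD[OF a(2,4) m(2)]
    obtain u w where u: "u \<in> S" "u \<otimes> (s' \<otimes> a) = u \<otimes> (s \<otimes> a')" and w: "w \<in> S" "w \<otimes> (t' \<otimes> b) = w \<otimes> (t \<otimes> b')"
      using m1 m2 by blast
    note car = S_mem[OF a(3)] S_mem[OF a(4)] S_mem[OF m1(2)] S_mem[OF m2(2)] S_mem[OF u(1)] S_mem[OF w(1)] a(1,2) m1(1) m2(1)
    have "(u \<otimes> w) \<otimes> ((s \<otimes> t) \<otimes> ((t' \<otimes> a') \<oplus> (s' \<otimes> b'))) = (w \<otimes> t \<otimes> t') \<otimes> (u \<otimes> (s \<otimes> a')) \<oplus> (u \<otimes> s \<otimes> s') \<otimes> (w \<otimes> (t \<otimes> b'))" using car by algebra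
    also have "\<dots> = (u \<otimes> w) \<otimes> ((s' \<otimes> t') \<otimes> ((t \<otimes> a) \<oplus> (s \<otimes> b)))" unfolding u(2)[symmetric] w(2)[symmetric] using car by algebra
    finally show ?thesis
      using a m1 m2 u w by (subst frac_eq_iff) (auto intro!: S_mult bexI[of _ "u \<otimes> w"])
  qed
  moreover have "(a, s) \<in> frac A S a s" "(b, t) \<in> frac A S b t" using frac_self a by auto
  ultimately have "(\<Union>(a, s)\<in>frac A S a s. \<Union>(b, t)\<in>frac A S b t. frac A S ((t \<otimes> a) \<oplus> (s \<otimes> b)) (s \<otimes> t)) =
      frac A S ((t \<otimes> a) \<oplus> (s \<otimes> b)) (s \<otimes> t)"
    by (intro UN_pair_const)
  then show ?thesis by (simp add: localization_def)
qed

end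

lemma primeideal_compl:
  assumes "cring A" "primeideal P A" shows "mult_submonoid A (carrier A - P)"
proof -
  interpret primeideal P A by fact
  show ?thesis
  proof (intro mult_submonoid.intro mult_submonoid_axioms.intro)
    show "\<one>\<^bsub>A\<^esub> \<in> carrier A - P" using I_notcarr one_imp_carrier by auto
  qed (use assms I_prime in auto)
qed

section \<open>Topology of the spectrum and constant sections\<close>

definition basic_open :: "('r, 'm) ring_scheme \<Rightarrow> 'r \<Rightarrow> 'r set set" where
  "basic_open A f = {P. primeideal P A \<and> f \<notin> P}"

lemma openin_basic_open: "f \<in> carrier A \<Longrightarrow> openin (spec_top A) (basic_open A f)"
  unfolding spec_top_def basic_open_def by (rule topology_generated_by_Basis) blast

lemma basic_open_mult:
  assumes "cring A" "a \<in> carrier A" "b \<in> carrier A"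
  shows "basic_open A (a \<otimes>\<^bsub>A\<^esub> b) = basic_open A a \<inter> basic_open A b"
proof -
  have "a \<otimes>\<^bsub>A\<^esub> b \<in> P \<longleftrightarrow> a \<in> P \<or> b \<in> P" if "primeideal P A" for P
  proof -
    interpret primeideal P A by fact
    show ?thesis using I_prime assms I_l_closed I_r_closed by auto
  qed
  then show ?thesis unfolding basic_open_def by auto
qed

text \<open>By definition the basic open sets are only a subbasis of \<open>spec_top\<close>. They
  form a basis because \<open>basic_open_mult\<close> makes them closed under intersection.\<close>

lemma spec_basis:
  assumes "cring A" "openin (spec_top A) U" "P \<in> U"
  obtains a where "a \<in> carrier A" "P \<in> basic_open A a" "basic_open A a \<subseteq> U"
proof -
  have "\<forall>P\<in>U. \<exists>a\<in>carrier A. P \<in> basic_open A a \<and> basic_open A a \<subseteq> U"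
    using assms(2) unfolding spec_top_def openin_topology_generated_by_iff
  proof induction
    case (Int U V)
    show ?case
    proof
      fix P assume "P \<in> U \<inter> V"
      then obtain a b where "a\<in>carrier A" "P \<in> basic_open A a" "basic_open A a \<subseteq> U" "b\<in>carrier A" "P \<in> basic_open A b" "basic_open A b \<subseteq> V"
        using Int by blast
      then show "\<exists>a\<in>carrier A. P \<in> basic_open A a \<and> basic_open A a \<subseteq> U \<inter> V"
        using basic_open_mult[OF assms(1)] cring.cring_simprules(5)[OF assms(1)]
        by (intro bexI[of _ "a \<otimes>\<^bsub>A\<^esub> b"]) auto
    qed
  next
    case (UN K) then show ?case by (meson Union_iff Union_upper order_trans)
  next
    case (Basis s) then show ?case unfolding basic_open_def by blast
  qed auto
  then show thesis using assms(3) that by blast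
qed

lemma topspace_spec: 
  assumes "cring A" shows "topspace (spec_top A) = {P. primeideal P A}"
proof -
  have "P \<in> \<Union> {{P. primeideal P A \<and> f \<notin> P} |f. f \<in> carrier A}" if "primeideal P A" for P
    using mult_submonoid.S_one[OF primeideal_compl[OF assms that]] that by auto
  then show ?thesis unfolding spec_top_def topology_generated_by_topspace by auto
qed

text \<open>The canonical map from a ring to the sections of its spectrum over \<open>U\<close>:
  \<open>a\<close> goes to the constant fraction a/1.\<close>

definition const_sect :: "('r, 'm) ring_scheme \<Rightarrow> 'r set set \<Rightarrow> 'r \<Rightarrow> 'r set \<Rightarrow> ('r \<times> 'r) set" where
  "const_sect A U a = (\<lambda>P\<in>U. frac A (carrier A - P) a \<one>\<^bsub>A\<^esub>)"

context cring begin

lemma spec_subset: "openin (spec_top R) U \<Longrightarrow> P \<in> U \<Longrightarrow> primeideal P R"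
  using openin_subset topspace_spec[OF is_cring] by blast

lemma frac_sect:
  assumes "openin (spec_top R) U" "a \<in> carrier R" "s \<in> carrier R" "\<And>P. P \<in> U \<Longrightarrow> s \<notin> P"
  shows "(\<lambda>P\<in>U. frac R (carrier R - P) a s) \<in> carrier (spec_sect R U)"
  unfolding spec_sect_def localization_def using assms by auto

lemma const_sect_closed:
  assumes "openin (spec_top R) U" "a \<in> carrier R"
  shows "const_sect R U a \<in> carrier (spec_sect R U)"
proof -
  have "\<one> \<notin> P" if "P \<in> U" for P
    using mult_submonoid.S_one[OF primeideal_compl[OF is_cring spec_subset[OF assms(1) that]]] by blast
  then show ?thesis unfolding const_sect_def using assms by (intro frac_sect) auto
qed

lemma const_sect_hom:
  assumes "openin (spec_top R) U" 
  shows "const_sect R U \<in> ring_hom R (spec_sect R U)"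
proof (rule ring_hom_memI)
  fix a b assume ab: "a \<in> carrier R" "b \<in> carrier R"
  have 1: "frac R (carrier R - P) (a \<otimes> b) \<one> = frac R (carrier R - P) a \<one> \<otimes>\<^bsub>local_at R P\<^esub> frac R (carrier R - P) b \<one>"
          "frac R (carrier R - P) (a \<oplus> b) \<one> = frac R (carrier R - P) a \<one> \<oplus>\<^bsub>local_at R P\<^esub> frac R (carrier R - P) b \<one>" if "P \<in> U" for P
  proof -
    interpret mult_submonoid R "carrier R - P" using that assms spec_subset primeideal_compl is_cring by blast
    show "frac R (carrier R - P) (a \<otimes> b) \<one> = frac R (carrier R - P) a \<one> \<otimes>\<^bsub>local_at R P\<^esub> frac R (carrier R - P) b \<one>"
          "frac R (carrier R - P) (a \<oplus> b) \<one> = frac R (carrier R - P) a \<one> \<oplus>\<^bsub>local_at R P\<^esub> frac R (carrier R - P) b \<one>" 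
      using frac_mult[OF ab S_one S_one] frac_add[OF ab S_one S_one] ab by auto
  qed
  show "const_sect R U (a \<otimes> b) = const_sect R U a \<otimes>\<^bsub>spec_sect R U\<^esub> const_sect R U b"
    "const_sect R U (a \<oplus> b) = const_sect R U a \<oplus>\<^bsub>spec_sect R U\<^esub> const_sect R U b"
    unfolding const_sect_def spec_sect_def using 1 by (auto simp: fun_eq_iff restrict_def)
qed (use const_sect_closed[OF assms] in \<open>auto simp: const_sect_def spec_sect_def localization_def\<close>)

lemma const_frac_mult:
  assumes "openin (spec_top R) U" "a \<in> carrier R" "s \<in> carrier R" "\<And>P. P \<in> U \<Longrightarrow> s \<notin> P"
  shows "const_sect R U s \<otimes>\<^bsub>spec_sect R U\<^esub> (\<lambda>P\<in>U. frac R (carrier R - P) a s) = const_sect R U a"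
proof -
  have "frac R (carrier R - P) s \<one> \<otimes>\<^bsub>local_at R P\<^esub> frac R (carrier R - P) a s = frac R (carrier R - P) a \<one>"
    if "P \<in> U" for P
  proof -
    interpret mult_submonoid R "carrier R - P" using that assms spec_subset primeideal_compl is_cring by blast
    have s: "s \<in> carrier R - P" using assms that by auto
    show ?thesis unfolding frac_mult[OF assms(3,2) S_one s] using assms s S_one
      by (subst frac_eq_iff) auto
  qed
  then show ?thesis unfolding const_sect_def spec_sect_def by (auto simp: fun_eq_iff)
qed

lemma const_sect_zeroD:
  assumes "openin (spec_top R) U" "a \<in> carrier R" "const_sect R U a = \<zero>\<^bsub>spec_sect R U\<^esub>" "P \<in> U"
  shows "\<exists>u\<in>carrier R - P. u \<otimes> a = \<zero>"
proof -
  interpret mult_submonoid R "carrier R - P" using assms spec_subset primeideal_compl is_cring by blast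
  have "frac R (carrier R - P) a \<one> = frac R (carrier R - P) \<zero> \<one>"
    using fun_cong[OF assms(3), of P] assms(4) by (simp add: const_sect_def spec_sect_def localization_def)
  then show ?thesis using frac_eq_iff[OF assms(2) zero_closed S_one S_one] assms(2) by auto
qed

text \<open>Being locally the fraction a/s is rephrased as the relation s \<sigma> = a. In this form
  it survives transport along ring isomorphisms and can be stated on a scheme without
  \<open>frac\<close>.\<close>

lemma spec_sect_local:
  assumes "openin (spec_top R) U" "\<sigma> \<in> carrier (spec_sect R U)" "P \<in> U"
  obtains V a s where "openin (spec_top R) V" "P \<in> V" "V \<subseteq> U" "a \<in> carrier R" "s \<in> carrier R"
    "\<forall>Q\<in>V. s \<notin> Q" "const_sect R V s \<otimes>\<^bsub>spec_sect R V\<^esub> restrict \<sigma> V = const_sect R V a"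
proof -
  obtain V a s where V: "openin (spec_top R) V" "P \<in> V" "V \<subseteq> U" "a \<in> carrier R" "s \<in> carrier R"
    "\<forall>Q\<in>V. s \<notin> Q \<and> \<sigma> Q = frac R (carrier R - Q) a s"
    using assms(2,3) unfolding spec_sect_def by auto
  have Q: "s \<notin> Q" "\<sigma> Q = frac R (carrier R - Q) a s" if "Q \<in> V" for Q
    using V(6) that by blast+
  have r: "restrict \<sigma> V = (\<lambda>Q\<in>V. frac R (carrier R - Q) a s)"
    by (rule restrict_ext) (rule Q(2))
  show thesis
    by (rule that[OF V(1-5)]) (use V(6) in blast, simp_all only: r const_frac_mult[OF V(1,4,5) Q(1)])
qed

lemma spec_sect_restrict:
  assumes V: "openin (spec_top R) V" "V \<subseteq> U" and \<sigma>: "\<sigma> \<in> carrier (spec_sect R U)"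
  shows "restrict \<sigma> V \<in> carrier (spec_sect R V)"
proof -
  have loc: "\<forall>P\<in>U. \<exists>W a s. openin (spec_top R) W \<and> P \<in> W \<and> W \<subseteq> U \<and> a \<in> carrier R \<and> s \<in> carrier R \<and>
      (\<forall>Q\<in>W. s \<notin> Q \<and> \<sigma> Q = frac R (carrier R - Q) a s)"
    using \<sigma> by (simp add: spec_sect_def)
  have "\<exists>W a s. openin (spec_top R) W \<and> Q \<in> W \<and> W \<subseteq> V \<and> a \<in> carrier R \<and> s \<in> carrier R \<and>
      (\<forall>Q\<in>W. s \<notin> Q \<and> restrict \<sigma> V Q = frac R (carrier R - Q) a s)" if Q: "Q \<in> V" for Q
  proof -
    obtain W a s where b: "openin (spec_top R) W" "Q \<in> W" "a \<in> carrier R" "s \<in> carrier R"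
      "\<forall>Q\<in>W. s \<notin> Q \<and> \<sigma> Q = frac R (carrier R - Q) a s"
      using loc[rule_format, OF subsetD[OF V(2) Q]] by (elim exE conjE) blast
    have "openin (spec_top R) (W \<inter> V)" using b(1) V(1) by blast
    moreover have "\<forall>Q\<in>W \<inter> V. s \<notin> Q \<and> restrict \<sigma> V Q = frac R (carrier R - Q) a s"
      using b(5) by simp
    ultimately show ?thesis using b(2-4) Q by (meson IntI Int_lower2)
  qed
  moreover have "restrict \<sigma> V \<in> (\<Pi>\<^sub>E P\<in>V. carrier (local_at R P))"
    using \<sigma> V(2) unfolding spec_sect_def by auto
  ultimately show ?thesis unfolding spec_sect_def by simp
qed

end

section \<open>Affine charts\<close>

lemma ringed_space_facts:
  assumes "is_ringed_space X"
  shows sect_cring: "openin (zariski X) U \<Longrightarrow> cring (sect X U)"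
    and rst_hom: "openin (zariski X) U \<Longrightarrow> openin (zariski X) V \<Longrightarrow> V \<subseteq> U \<Longrightarrow>
        rst X U V \<in> ring_hom (sect X U) (sect X V)"
    and rst_self: "openin (zariski X) U \<Longrightarrow> s \<in> carrier (sect X U) \<Longrightarrow> rst X U U s = s"
    and rst_rst: "openin (zariski X) U \<Longrightarrow> openin (zariski X) V \<Longrightarrow> openin (zariski X) W \<Longrightarrow>
        W \<subseteq> V \<Longrightarrow> V \<subseteq> U \<Longrightarrow> s \<in> carrier (sect X U) \<Longrightarrow> rst X V W (rst X U V s) = rst X U W s"
    and sect_eqI: "(\<And>V. V \<in> \<U> \<Longrightarrow> openin (zariski X) V) \<Longrightarrow> s \<in> carrier (sect X (\<Union>\<U>)) \<Longrightarrow>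
        t \<in> carrier (sect X (\<Union>\<U>)) \<Longrightarrow> (\<And>V. V \<in> \<U> \<Longrightarrow> rst X (\<Union>\<U>) V s = rst X (\<Union>\<U>) V t) \<Longrightarrow> s = t"
    and sect_glue: "(\<And>V. V \<in> \<U> \<Longrightarrow> openin (zariski X) V \<and> \<sigma> V \<in> carrier (sect X V)) \<Longrightarrow>
        (\<And>V W. V \<in> \<U> \<Longrightarrow> W \<in> \<U> \<Longrightarrow> rst X V (V \<inter> W) (\<sigma> V) = rst X W (V \<inter> W) (\<sigma> W)) \<Longrightarrow>
        \<exists>t\<in>carrier (sect X (\<Union>\<U>)). \<forall>V\<in>\<U>. rst X (\<Union>\<U>) V t = \<sigma> V"
proof goal_cases
  note c = assms[unfolded is_ringed_space_def]
  note c1 = c[THEN conjunct2] note c2 = c1[THEN conjunct2] note c3 = c2[THEN conjunct2]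
  note c4 = c3[THEN conjunct2] note c5 = c4[THEN conjunct2]
  { case 1 then show ?case using c[THEN conjunct1] by blast }
  { case 2 then show ?case using c1[THEN conjunct1] by blast }
  { case 3 then show ?case using c2[THEN conjunct1] by blast }
  { case 4 then show ?case using c3[THEN conjunct1] by blast }
  { case 5 then show ?case using c4[THEN conjunct1, rule_format, of \<U>] by simp }
  { case 6 then show ?case by (rule c5[rule_format]) blast+ }
qed

text \<open>\<open>A\<close> is not identified with the ring of sections over \<open>V\<close>: all that is needed is local information
  about the image of \<open>A\<close> there.\<close>

locale affine_chart = A: cring A for X :: "('a, 'b) ringed_space" and V :: "'a set"
    and A :: "'b ring" and \<phi> :: "'a \<Rightarrow> 'b set" and \<iota> :: "'b \<Rightarrow> 'b" +
  assumes open_V: "openin (zariski X) V"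
    and chart_bij: "bij_betw \<phi> V {P. primeideal P A}"
    and chart_hom: "\<iota> \<in> ring_hom A (sect X V)"
    and chart_basis: "\<And>U x. openin (zariski X) U \<Longrightarrow> x \<in> U \<Longrightarrow> x \<in> V \<Longrightarrow>
          \<exists>a\<in>carrier A. a \<notin> \<phi> x \<and> {y \<in> V. a \<notin> \<phi> y} \<subseteq> U"
    and chart_open: "\<And>a. a \<in> carrier A \<Longrightarrow> openin (zariski X) {y \<in> V. a \<notin> \<phi> y}"
    and chart_frac: "\<And>W s x. openin (zariski X) W \<Longrightarrow> W \<subseteq> V \<Longrightarrow> s \<in> carrier (sect X W) \<Longrightarrow> x \<in> W \<Longrightarrow>
          \<exists>W' a c. openin (zariski X) W' \<and> x \<in> W' \<and> W' \<subseteq> W \<and> a \<in> carrier A \<and> c \<in> carrier A \<and>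
            (\<forall>y\<in>W'. c \<notin> \<phi> y) \<and>
            rst X V W' (\<iota> c) \<otimes>\<^bsub>sect X W'\<^esub> rst X W W' s = rst X V W' (\<iota> a)"
    and chart_zero: "\<And>W a x. openin (zariski X) W \<Longrightarrow> W \<subseteq> V \<Longrightarrow> a \<in> carrier A \<Longrightarrow>
          rst X V W (\<iota> a) = \<zero>\<^bsub>sect X W\<^esub> \<Longrightarrow> x \<in> W \<Longrightarrow> \<exists>u\<in>carrier A - \<phi> x. u \<otimes>\<^bsub>A\<^esub> a = \<zero>\<^bsub>A\<^esub>"
    and chart_unit: "\<And>W c. openin (zariski X) W \<Longrightarrow> W \<subseteq> V \<Longrightarrow> c \<in> carrier A \<Longrightarrow>
          (\<And>y. y \<in> W \<Longrightarrow> c \<notin> \<phi> y) \<Longrightarrow> rst X V W (\<iota> c) \<in> Units (sect X W)"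

text \<open>Here \<open>\<phi>\<close> is the homeomorphism onto the spectrum, and
  \<open>\<iota>\<close> is the map from \<open>A\<close> to the constant sections over the whole
  spectrum followed by the isomorphism onto the sections over \<open>V\<close>. Each chart property
  is a fact about spectra pulled back along these two maps.\<close>

lemma affine_chart_exists:
  fixes X :: "('a, 'b) ringed_space"
  assumes X: "is_ringed_space X" and aff: "affine_open X V"
  obtains A \<phi> \<iota> where "affine_chart X V A \<phi> \<iota>"
proof -
  note opV = aff[unfolded affine_open_def, THEN conjunct1]
  note rsf = ringed_space_facts[OF X]
  obtain A :: "'b ring" where A: "cring A" and iso: "ringed_space_iso (open_subspace X V) (Spec A)"
    using aff unfolding affine_open_def by blast
  interpret cring A by fact
  have VX: "V \<subseteq> points X" using opV openin_subset by blast
  have tV: "topspace (zariski (open_subspace X V)) = V"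
    using VX by (auto simp: open_subspace_def)
  let ?T = "spec_top A"
  obtain \<phi> \<theta> where iso1: "homeomorphic_map (zariski (open_subspace X V)) (zariski (Spec A)) \<phi>"
    "\<forall>U. openin ?T U \<longrightarrow> \<theta> U \<in> ring_iso (spec_sect A U) (sect X {x \<in> V. \<phi> x \<in> U})"
    "\<forall>U W. openin ?T U \<longrightarrow> openin ?T W \<longrightarrow> W \<subseteq> U \<longrightarrow> (\<forall>s\<in>carrier (spec_sect A U).
       rst X {x \<in> V. \<phi> x \<in> U} {x \<in> V. \<phi> x \<in> W} (\<theta> U s) = \<theta> W (restrict s W))"
    using iso unfolding ringed_space_iso_def tV by (simp add: open_subspace_def Spec_def) blast
  have hom: "homeomorphic_map (subtopology (zariski X) V) ?T \<phi>"
    and \<theta>: "\<And>U. openin ?T U \<Longrightarrow> \<theta> U \<in> ring_iso (spec_sect A U) (sect X {x \<in> V. \<phi> x \<in> U})"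
    and \<theta>r: "\<And>U W s. openin ?T U \<Longrightarrow> openin ?T W \<Longrightarrow> W \<subseteq> U \<Longrightarrow> s \<in> carrier (spec_sect A U) \<Longrightarrow>
       rst X {x \<in> V. \<phi> x \<in> U} {x \<in> V. \<phi> x \<in> W} (\<theta> U s) = \<theta> W (restrict s W)"
    using iso1 by (simp_all add: open_subspace_def Spec_def)
  define pre where "pre U = {x \<in> V. \<phi> x \<in> U}" for U
  have tS: "topspace (subtopology (zariski X) V) = V" using VX by auto
  have surj: "\<phi> ` V = topspace ?T" using homeomorphic_imp_surjective_map[OF hom] tS by simp
  have inj: "inj_on \<phi> V" using homeomorphic_imp_injective_map[OF hom] tS by simp
  have TP: "topspace ?T = {P. primeideal P A}" by (rule topspace_spec[OF A])
  have pre_open: "openin (zariski X) (pre U)" if "openin ?T U" for U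
  proof -
    have "openin (subtopology (zariski X) V) {x \<in> topspace (subtopology (zariski X) V). \<phi> x \<in> U}"
      by (rule openin_continuous_map_preimage[OF homeomorphic_imp_continuous_map[OF hom] that])
    then show ?thesis unfolding tS pre_def by (rule openin_trans_full[OF _ opV])
  qed
  have img_open: "openin ?T (\<phi> ` W)" and pre_img: "pre (\<phi> ` W) = W" if "openin (zariski X) W" "W \<subseteq> V" for W
  proof -
    have "openin (subtopology (zariski X) V) W" using that by (metis openin_subtopology Int_absorb2)
    then show "openin ?T (\<phi> ` W)" using homeomorphic_imp_open_map[OF hom] unfolding open_map_def by blast
    show "pre (\<phi> ` W) = W" unfolding pre_def using that(2) inj by (auto simp: inj_on_def)
  qed
  note oT = openin_topspace[of ?T]
  have preT: "pre (topspace ?T) = V" unfolding pre_def using surj by auto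
  define \<iota> where "\<iota> a = \<theta> (topspace ?T) (const_sect A (topspace ?T) a)" for a
  have iota_rst: "rst X V (pre U) (\<iota> a) = \<theta> U (const_sect A U a)" if "openin ?T U" "a \<in> carrier A" for U a
  proof -
    have sub: "U \<subseteq> topspace ?T" using that(1) openin_subset by blast
    have "rst X (pre (topspace ?T)) (pre U) (\<iota> a) = \<theta> U (restrict (const_sect A (topspace ?T) a) U)"
      unfolding \<iota>_def pre_def by (rule \<theta>r[OF oT that(1) sub const_sect_closed[OF oT that(2)]])
    also have "restrict (const_sect A (topspace ?T) a) U = const_sect A U a"
      unfolding const_sect_def using sub by (simp add: Int_absorb1)
    finally show ?thesis unfolding preT .
  qed
  have \<theta>h: "\<theta> U \<in> ring_hom (spec_sect A U) (sect X (pre U))" and 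
    \<theta>b: "bij_betw (\<theta> U) (carrier (spec_sect A U)) (carrier (sect X (pre U)))" if "openin ?T U" for U
    using \<theta>[OF that] unfolding ring_iso_def pre_def by auto
  have c1: "const_sect A U \<one>\<^bsub>A\<^esub> = \<one>\<^bsub>spec_sect A U\<^esub>" if "openin ?T U" for U
    using ring_hom_one[OF const_sect_hom[OF that]] .
  have ihom: "\<iota> \<in> ring_hom A (sect X V)"
  proof -
    have "(\<theta> (topspace ?T) \<circ> const_sect A (topspace ?T)) \<in> ring_hom A (sect X V)"
      using ring_hom_trans[OF const_sect_hom[OF oT] \<theta>h[OF oT]] unfolding preT .
    then show ?thesis unfolding \<iota>_def comp_def .
  qed
  have "affine_chart X V A \<phi> \<iota>"
  proof (intro affine_chart.intro affine_chart_axioms.intro A opV ihom)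
    show "bij_betw \<phi> V {P. primeideal P A}" using inj surj TP unfolding bij_betw_def by simp
  next
    fix U x assume U: "openin (zariski X) U" "x \<in> U" "x \<in> V"
    have o: "openin ?T (\<phi> ` (U \<inter> V))" by (rule img_open) (use U opV in auto)
    obtain a where a: "a \<in> carrier A" "\<phi> x \<in> basic_open A a" "basic_open A a \<subseteq> \<phi> ` (U \<inter> V)"
      using spec_basis[OF A o, of "\<phi> x"] U by blast
    have "y \<in> U" if "y \<in> V" "a \<notin> \<phi> y" for y
    proof -
      have "\<phi> y \<in> basic_open A a" using that surj TP unfolding basic_open_def by blast
      then have "\<phi> y \<in> \<phi> ` (U \<inter> V)" using a(3) by blast
      then show ?thesis using inj that(1) by (auto simp: inj_on_def)
    qed
    then show "\<exists>a\<in>carrier A. a \<notin> \<phi> x \<and> {y \<in> V. a \<notin> \<phi> y} \<subseteq> U" using a unfolding basic_open_def by blast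
  next
    fix a assume a: "a \<in> carrier A"
    have "pre (basic_open A a) = {y \<in> V. a \<notin> \<phi> y}"
      unfolding pre_def basic_open_def using surj TP by blast
    then show "openin (zariski X) {y \<in> V. a \<notin> \<phi> y}"
      using pre_open[OF openin_basic_open[OF a]] by simp
  next
    fix W s x assume W: "openin (zariski X) W" "W \<subseteq> V" "s \<in> carrier (sect X W)" "x \<in> W"
    note o = img_open[OF W(1,2)] and p = pre_img[OF W(1,2)]
    have "s \<in> \<theta> (\<phi> ` W) ` carrier (spec_sect A (\<phi> ` W))"
      using bij_betw_imp_surj_on[OF \<theta>b[OF o]] W(3) p by simp
    then obtain \<sigma> where \<sigma>: "\<sigma> \<in> carrier (spec_sect A (\<phi> ` W))" "\<theta> (\<phi> ` W) \<sigma> = s"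
      by (elim imageE) simp
    obtain V' a c where V': "openin ?T V'" "\<phi> x \<in> V'" "V' \<subseteq> \<phi> ` W" "a \<in> carrier A" "c \<in> carrier A"
      "\<forall>Q\<in>V'. c \<notin> Q" "const_sect A V' c \<otimes>\<^bsub>spec_sect A V'\<^esub> restrict \<sigma> V' = const_sect A V' a"
      by (rule spec_sect_local[OF o \<sigma>(1) imageI[OF W(4)]])
    have sub: "pre V' \<subseteq> W" using V'(3) p unfolding pre_def by blast
    have r: "rst X W (pre V') s = \<theta> V' (restrict \<sigma> V')"
      using \<theta>r[OF o V'(1,3) \<sigma>(1)] p unfolding \<sigma>(2) pre_def by simp
    have rc: "restrict \<sigma> V' \<in> carrier (spec_sect A V')"
      by (rule spec_sect_restrict[OF V'(1,3) \<sigma>(1)])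
    have "rst X V (pre V') (\<iota> c) \<otimes>\<^bsub>sect X (pre V')\<^esub> rst X W (pre V') s = rst X V (pre V') (\<iota> a)"
      unfolding iota_rst[OF V'(1,5)] iota_rst[OF V'(1,4)] r
        ring_hom_mult[OF \<theta>h[OF V'(1)] const_sect_closed[OF V'(1,5)] rc, symmetric] V'(7) ..
    moreover have "x \<in> pre V'" using V'(2) W unfolding pre_def by auto
    moreover have "\<forall>y\<in>pre V'. c \<notin> \<phi> y" using V'(6) unfolding pre_def by auto
    ultimately show "\<exists>W' a c. openin (zariski X) W' \<and> x \<in> W' \<and> W' \<subseteq> W \<and> a \<in> carrier A \<and> c \<in> carrier A \<and>
            (\<forall>y\<in>W'. c \<notin> \<phi> y) \<and>
            rst X V W' (\<iota> c) \<otimes>\<^bsub>sect X W'\<^esub> rst X W W' s = rst X V W' (\<iota> a)"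
      using pre_open[OF V'(1)] sub V'(4,5) by blast
  next
    fix W a x assume W: "openin (zariski X) W" "W \<subseteq> V" "a \<in> carrier A"
      "rst X V W (\<iota> a) = \<zero>\<^bsub>sect X W\<^esub>" "x \<in> W"
    note o = img_open[OF W(1,2)] and p = pre_img[OF W(1,2)]
    have zero: "const_sect A (\<phi> ` W) \<zero>\<^bsub>A\<^esub> = \<zero>\<^bsub>spec_sect A (\<phi> ` W)\<^esub>"
      unfolding const_sect_def spec_sect_def localization_def by simp
    have "rst X V W (\<iota> \<zero>\<^bsub>A\<^esub>) = \<zero>\<^bsub>sect X W\<^esub>"
    proof -
      interpret V: cring "sect X V" by (rule rsf(1)[OF opV])
      interpret W: cring "sect X W" by (rule rsf(1)[OF W(1)])
      show ?thesis using ring_hom_zero[OF ihom ring_axioms V.ring_axioms]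
        ring_hom_zero[OF rsf(2)[OF opV W(1,2)] V.ring_axioms W.ring_axioms] by simp
    qed
    then have "\<theta> (\<phi> ` W) (const_sect A (\<phi> ` W) a) = \<theta> (\<phi> ` W) (const_sect A (\<phi> ` W) \<zero>\<^bsub>A\<^esub>)"
      using W(4) iota_rst[OF o W(3)] iota_rst[OF o zero_closed] unfolding p by simp
    then have "const_sect A (\<phi> ` W) a = const_sect A (\<phi> ` W) \<zero>\<^bsub>A\<^esub>"
      by (rule inj_onD[OF bij_betw_imp_inj_on[OF \<theta>b[OF o]] _
            const_sect_closed[OF o W(3)] const_sect_closed[OF o zero_closed]])
    then show "\<exists>u\<in>carrier A - \<phi> x. u \<otimes>\<^bsub>A\<^esub> a = \<zero>\<^bsub>A\<^esub>"
      using const_sect_zeroD[OF o W(3) _ imageI[OF W(5)]] zero by simp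
  next
    fix W c assume W: "openin (zariski X) W" "W \<subseteq> V" "c \<in> carrier A" "\<And>y. y \<in> W \<Longrightarrow> c \<notin> \<phi> y"
    note o = img_open[OF W(1,2)] and p = pre_img[OF W(1,2)]
    have nc: "c \<notin> P" if "P \<in> \<phi> ` W" for P using W(4) that by blast
    note fr = frac_sect[OF o one_closed W(3) nc] and cm = const_frac_mult[OF o one_closed W(3) nc]
    \<comment> \<open>The inverse is the transported section 1/c.\<close>
    let ?i = "\<theta> (\<phi> ` W) (\<lambda>P\<in>\<phi> ` W. frac A (carrier A - P) \<one>\<^bsub>A\<^esub> c)"
    have i: "?i \<in> carrier (sect X W)" using ring_hom_closed[OF \<theta>h[OF o] fr] unfolding p .
    have "rst X V W (\<iota> c) = \<theta> (\<phi> ` W) (const_sect A (\<phi> ` W) c)" using iota_rst[OF o W(3)] unfolding p .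
    moreover have "\<theta> (\<phi> ` W) (const_sect A (\<phi> ` W) c) \<otimes>\<^bsub>sect X W\<^esub> ?i = \<one>\<^bsub>sect X W\<^esub>"
      using ring_hom_mult[OF \<theta>h[OF o] const_sect_closed[OF o W(3)] fr] cm c1[OF o] ring_hom_one[OF \<theta>h[OF o]]
      unfolding p by simp
    moreover have "\<theta> (\<phi> ` W) (const_sect A (\<phi> ` W) c) \<in> carrier (sect X W)"
      using ring_hom_closed[OF \<theta>h[OF o] const_sect_closed[OF o W(3)]] unfolding p .
    ultimately show "rst X V W (\<iota> c) \<in> Units (sect X W)"
      using i cring.cring_simprules(14)[OF rsf(1)[OF W(1)]] unfolding Units_def by fastforce
  qed
  then show thesis by (rule that)
qed

lemma (in cring) Units_iff: "a \<in> Units R \<longleftrightarrow> a \<in> carrier R \<and> (\<exists>b\<in>carrier R. a \<otimes> b = \<one>)"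
  unfolding Units_def using m_comm by auto

lemma (in cring) Units_mult_zero:
  assumes "a \<in> Units R" "b \<in> carrier R" "a \<otimes> b = \<zero>" shows "b = \<zero>"
proof -
  have "b = (inv a \<otimes> a) \<otimes> b" using assms by simp
  also have "\<dots> = inv a \<otimes> (a \<otimes> b)" using assms(1,2) by (intro m_assoc) auto
  finally show ?thesis using assms(1,3) by simp
qed

lemma ring_hom_Units:
  assumes "cring R" "cring S" "h \<in> ring_hom R S" "a \<in> Units R" shows "h a \<in> Units S"
proof -
  interpret R: cring R by fact
  interpret S: cring S by fact
  obtain b where "a \<in> carrier R" "b \<in> carrier R" "a \<otimes>\<^bsub>R\<^esub> b = \<one>\<^bsub>R\<^esub>" using assms(4) R.Units_iff by blast
  then show ?thesis unfolding S.Units_iff using ring_hom_closed[OF assms(3)] ring_hom_mult[OF assms(3)] ring_hom_one[OF assms(3)]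
    by metis
qed

lemma ring_hom_cring_of:
  "cring R \<Longrightarrow> cring S \<Longrightarrow> h \<in> ring_hom R S \<Longrightarrow> ring_hom_cring R S h"
  by (simp add: ring_hom_cring_def ring_hom_cring_axioms_def)

section \<open>Integral schemes and their function fields\<close>

locale integral_space =
  fixes X :: "('a, 'b) ringed_space"
  assumes integral: "integral_scheme X"
begin

abbreviation opn :: "'a set \<Rightarrow> bool" where "opn U \<equiv> openin (zariski X) U"
abbreviation gp :: 'a (\<open>\<eta>\<close>) where "\<eta> \<equiv> generic_point X"
abbreviation L :: "('a, 'b) rat_fun ring" where "L \<equiv> func_field X"
abbreviation L_mult (infixl \<open>\<cdot>\<close> 70) where "f \<cdot> g \<equiv> f \<otimes>\<^bsub>L\<^esub> g"
abbreviation L_add (infixl \<open>\<boxplus>\<close> 65) where "f \<boxplus> g \<equiv> f \<oplus>\<^bsub>L\<^esub> g"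

lemma schemeX: "scheme X" using integral unfolding integral_scheme_def by blast
lemma ringedX: "is_ringed_space X" using schemeX unfolding scheme_def by blast
lemma sect_domain: "opn U \<Longrightarrow> U \<noteq> {} \<Longrightarrow> domain (sect X U)"
  using integral unfolding integral_scheme_def by blast
lemmas sect_cring = sect_cring[OF ringedX]
lemmas rst_hom = rst_hom[OF ringedX]
lemmas rst_self = rst_self[OF ringedX]
lemmas rst_rst = rst_rst[OF ringedX]
lemmas sect_eqI = sect_eqI[OF ringedX]
lemmas sect_glue = sect_glue[OF ringedX]
lemmas rst_closed = ring_hom_closed[OF rst_hom]
lemmas rst_mult = ring_hom_mult[OF rst_hom]
lemmas rst_add = ring_hom_add[OF rst_hom]
lemmas rst_one = ring_hom_one[OF rst_hom]

lemma rst_zero: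
  assumes "opn U" "opn V" "V \<subseteq> U" shows "rst X U V \<zero>\<^bsub>sect X U\<^esub> = \<zero>\<^bsub>sect X V\<^esub>"
  using ring_hom_zero[OF rst_hom[OF assms]] sect_cring assms cring.axioms(1) by blast

text \<open>The uniqueness axiom for the empty covering of the empty set.\<close>

lemma sect_empty: "s \<in> carrier (sect X {}) \<Longrightarrow> t \<in> carrier (sect X {}) \<Longrightarrow> s = t"
  using sect_eqI[of "{}" s t] by simp

text \<open>Otherwise \<open>0\<close> and \<open>1\<close> could be glued to zero divisors.\<close>

lemma irreducible:
  assumes "opn U" "opn V" "U \<noteq> {}" "V \<noteq> {}" shows "U \<inter> V \<noteq> {}"
proof
  assume d: "U \<inter> V = {}"
  have UV: "\<Union>{U, V} = U \<union> V" by simp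
  have op: "opn (U \<union> V)" using assms by blast
  interpret U: domain "sect X U" by (rule sect_domain[OF assms(1,3)])
  interpret V: domain "sect X V" by (rule sect_domain[OF assms(2,4)])
  interpret UV: domain "sect X (U \<union> V)" using sect_domain[OF op] assms by blast
  have ne: "U \<noteq> V" using d assms by blast
  have glue: "\<exists>t\<in>carrier (sect X (U \<union> V)). rst X (U \<union> V) U t = a \<and> rst X (U \<union> V) V t = b"
    if a: "a \<in> carrier (sect X U)" and b: "b \<in> carrier (sect X V)" for a b
  proof -
    let ?\<sigma> = "\<lambda>W. if W = U then a else b"
    have e: "opn {}" by simp
    have "rst X U {} a = rst X V {} b" 
      by (rule sect_empty) (use rst_closed[OF assms(1) e _ a] rst_closed[OF assms(2) e _ b] in auto)
    then have "\<exists>t\<in>carrier (sect X (\<Union>{U, V})). \<forall>W\<in>{U, V}. rst X (\<Union>{U, V}) W t = ?\<sigma> W"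
      by (intro sect_glue) (use assms a b d ne in \<open>auto simp: Int_commute\<close>)
    then show ?thesis unfolding UV using ne by auto
  qed
  obtain e where e: "e \<in> carrier (sect X (U \<union> V))" "rst X (U \<union> V) U e = \<one>\<^bsub>sect X U\<^esub>" "rst X (U \<union> V) V e = \<zero>\<^bsub>sect X V\<^esub>"
    using glue[OF U.one_closed V.zero_closed] by blast
  obtain f where f: "f \<in> carrier (sect X (U \<union> V))" "rst X (U \<union> V) U f = \<zero>\<^bsub>sect X U\<^esub>" "rst X (U \<union> V) V f = \<one>\<^bsub>sect X V\<^esub>"
    using glue[OF U.zero_closed V.one_closed] by blast
  have "e \<otimes>\<^bsub>sect X (U \<union> V)\<^esub> f = \<zero>\<^bsub>sect X (U \<union> V)\<^esub>"
  proof (rule sect_eqI[of "{U, V}", unfolded UV])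
    fix W assume W: "W \<in> {U, V}"
    then have o: "opn W" "W \<subseteq> U \<union> V" using assms by auto
    show "opn W" by fact
    show "rst X (U \<union> V) W (e \<otimes>\<^bsub>sect X (U \<union> V)\<^esub> f) = rst X (U \<union> V) W \<zero>\<^bsub>sect X (U \<union> V)\<^esub>"
      using W e f unfolding rst_mult[OF op o e(1) f(1)] rst_zero[OF op o] by auto
  qed (use e f in auto)
  then have "e = \<zero>\<^bsub>sect X (U \<union> V)\<^esub> \<or> f = \<zero>\<^bsub>sect X (U \<union> V)\<^esub>" using UV.integral e f by blast
  then show False
    using e f rst_zero[OF op assms(1)] rst_zero[OF op assms(2)] U.one_not_zero V.one_not_zero by auto
qed

lemma chart:
  assumes "x \<in> points X"
  obtains V A \<phi> \<iota> where "x \<in> V" "affine_chart X V A \<phi> \<iota>"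
proof -
  obtain V where V: "x \<in> V" "affine_open X V" using assms schemeX unfolding scheme_def by blast
  show thesis by (rule affine_chart_exists[OF ringedX V(2)]) (rule that[OF V(1)])
qed

text \<open>Vanishing near a point x of \<open>W\<close> yields \<open>u\<close> outside the prime
  of x with u b = 0 in \<open>A\<close>. In the domain of sections over \<open>V\<close> the factor
  \<open>\<iota> u\<close> can be cancelled, being nonzero.\<close>

lemma chart_kernel:
  assumes "affine_chart X V A \<phi> \<iota>" "opn W" "W \<noteq> {}" "W \<subseteq> V" "b \<in> carrier A"
    and b0: "rst X V W (\<iota> b) = \<zero>\<^bsub>sect X W\<^esub>"
  shows "\<iota> b = \<zero>\<^bsub>sect X V\<^esub>"
proof -
  interpret affine_chart X V A \<phi> \<iota> by fact
  obtain x where x: "x \<in> W" using assms by blast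
  interpret V: domain "sect X V" using sect_domain[OF open_V] x assms by blast
  interpret W: domain "sect X W" using sect_domain assms by blast
  obtain u where u: "u \<in> carrier A - \<phi> x" "u \<otimes>\<^bsub>A\<^esub> b = \<zero>\<^bsub>A\<^esub>"
    using chart_zero[OF assms(2,4,5) b0 x] by blast
  have i0: "\<iota> \<zero>\<^bsub>A\<^esub> = \<zero>\<^bsub>sect X V\<^esub>" by (rule ring_hom_zero[OF chart_hom A.ring_axioms V.ring_axioms])
  have "\<iota> u \<otimes>\<^bsub>sect X V\<^esub> \<iota> b = \<zero>\<^bsub>sect X V\<^esub>"
    using ring_hom_mult[OF chart_hom, of u b] u assms(5) i0 by simp
  \<comment> \<open>Otherwise some \<open>u'\<close> outside \<open>\<phi> x\<close> would satisfy
    u' u = 0, although neither factor lies in the prime \<open>\<phi> x\<close>.\<close>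
  moreover have "\<iota> u \<noteq> \<zero>\<^bsub>sect X V\<^esub>"
  proof
    assume "\<iota> u = \<zero>\<^bsub>sect X V\<^esub>"
    then have "rst X V W (\<iota> u) = \<zero>\<^bsub>sect X W\<^esub>" using rst_zero[OF open_V assms(2,4)] by simp
    then obtain u' where u': "u' \<in> carrier A - \<phi> x" "u' \<otimes>\<^bsub>A\<^esub> u = \<zero>\<^bsub>A\<^esub>"
      using chart_zero[OF assms(2,4) _ _ x] u by blast
    interpret primeideal "\<phi> x" A using chart_bij x assms(4) unfolding bij_betw_def by blast
    show False using I_prime[of u' u] u u' by auto
  qed
  ultimately show ?thesis
    using V.integral[of "\<iota> u" "\<iota> b"] ring_hom_closed[OF chart_hom] u assms(5) by blast
qed

text \<open>Near any y in \<open>U\<close> one has c s = a with c a unit and a from a chart. The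
  neighbourhood meets \<open>V\<close> by irreducibility, so a vanishes on a nonempty open set and
  then, by \<open>chart_kernel\<close>, on the whole chart. Thus s vanishes near every point of
  \<open>U\<close>.\<close>

lemma rst_zeroD:
  assumes "opn U" "opn V" "V \<subseteq> U" "V \<noteq> {}" "s \<in> carrier (sect X U)" "rst X U V s = \<zero>\<^bsub>sect X V\<^esub>"
  shows "s = \<zero>\<^bsub>sect X U\<^esub>"
proof -
  have "\<exists>W. opn W \<and> y \<in> W \<and> W \<subseteq> U \<and> rst X U W s = \<zero>\<^bsub>sect X W\<^esub>" if y: "y \<in> U" for y
  proof -
    obtain W0 A \<phi> \<iota> where W0: "y \<in> W0" and ch: "affine_chart X W0 A \<phi> \<iota>"
      using chart y assms(1) openin_subset by blast
    interpret affine_chart X W0 A \<phi> \<iota> by fact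
    have o: "opn (U \<inter> W0)" using assms(1) open_V by blast
    obtain W a c where W: "opn W" "y \<in> W" "W \<subseteq> U \<inter> W0" "a \<in> carrier A" "c \<in> carrier A"
        "\<forall>y\<in>W. c \<notin> \<phi> y"
        and eq: "rst X W0 W (\<iota> c) \<otimes>\<^bsub>sect X W\<^esub> rst X (U \<inter> W0) W (rst X U (U \<inter> W0) s) = rst X W0 W (\<iota> a)"
      using chart_frac[OF o _ rst_closed[OF assms(1) o _ assms(5)], of y] y W0 by blast
    have W': "W \<subseteq> U" "W \<subseteq> W0" using W(3) by auto
    have eq: "rst X W0 W (\<iota> c) \<otimes>\<^bsub>sect X W\<^esub> rst X U W s = rst X W0 W (\<iota> a)"
      using eq rst_rst[OF assms(1) o W(1,3) _ assms(5)] by simp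
    let ?Z = "W \<inter> V"
    have Z: "opn ?Z" "?Z \<noteq> {}" "?Z \<subseteq> W" "?Z \<subseteq> V"
      using irreducible[OF W(1) assms(2)] W(1,2) assms(2,4) by auto
    interpret W: domain "sect X W" using sect_domain W by blast
    interpret Z: domain "sect X ?Z" using sect_domain Z by blast
    have ic: "\<iota> c \<in> carrier (sect X W0)" "\<iota> a \<in> carrier (sect X W0)" using ring_hom_closed[OF chart_hom] W by auto
    have sZ: "rst X W ?Z (rst X U W s) = \<zero>\<^bsub>sect X ?Z\<^esub>"
      using rst_rst[OF assms(1) W(1) Z(1,3) W'(1) assms(5)] rst_rst[OF assms(1,2) Z(1,4) assms(3,5)]
        assms(6) rst_zero[OF assms(2) Z(1,4)] by simp
    have "rst X W0 ?Z (\<iota> a) = rst X W ?Z (rst X W0 W (\<iota> a))"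
      using rst_rst[OF open_V W(1) Z(1,3) W'(2) ic(2)] by simp
    also have "\<dots> = \<zero>\<^bsub>sect X ?Z\<^esub>"
      unfolding eq[symmetric] using rst_mult[OF W(1) Z(1,3) rst_closed[OF open_V W(1) W'(2) ic(1)] rst_closed[OF assms(1) W(1) W'(1) assms(5)]]
        sZ rst_closed[OF W(1) Z(1,3) rst_closed[OF open_V W(1) W'(2) ic(1)]] by simp
    finally have "\<iota> a = \<zero>\<^bsub>sect X W0\<^esub>"
      using chart_kernel[OF ch Z(1,2) _ W(4)] Z(3) W'(2) by blast
    then have "rst X W0 W (\<iota> c) \<otimes>\<^bsub>sect X W\<^esub> rst X U W s = \<zero>\<^bsub>sect X W\<^esub>"
      using eq rst_zero[OF open_V W(1) W'(2)] by simp
    moreover have "rst X W0 W (\<iota> c) \<in> Units (sect X W)"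
      using chart_unit[OF W(1) W'(2) W(5)] W(6) by blast
    ultimately have "rst X U W s = \<zero>\<^bsub>sect X W\<^esub>"
      using W.Units_mult_zero rst_closed[OF assms(1) W(1) W'(1) assms(5)] by blast
    then show ?thesis using W W' by blast
  qed
  then obtain F where F: "\<And>y. y \<in> U \<Longrightarrow> opn (F y) \<and> y \<in> F y \<and> F y \<subseteq> U \<and> rst X U (F y) s = \<zero>\<^bsub>sect X (F y)\<^esub>"
    by metis
  have UF: "\<Union>(F ` U) = U" using F by blast
  interpret U: cring "sect X U" by (rule sect_cring[OF assms(1)])
  show ?thesis
    by (rule sect_eqI[of "F ` U", unfolded UF]) (use F assms rst_zero in auto)
qed

lemma rst_inj:
  assumes "opn U" "opn V" "V \<subseteq> U" "V \<noteq> {}" "s \<in> carrier (sect X U)" "t \<in> carrier (sect X U)"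
    and "rst X U V s = rst X U V t"
  shows "s = t"
proof -
  interpret U: cring "sect X U" by (rule sect_cring[OF assms(1)])
  interpret V: cring "sect X V" by (rule sect_cring[OF assms(2)])
  note h = rst_hom[OF assms(1-3)]
  interpret h: ring_hom_cring "sect X U" "sect X V" "rst X U V"
    by (rule ring_hom_cring_of[OF U.is_cring V.is_cring h])
  have "rst X U V (s \<ominus>\<^bsub>sect X U\<^esub> t) = \<zero>\<^bsub>sect X V\<^esub>"
    using assms(5-7) by (simp add: a_minus_def V.r_neg)
  then have "s \<ominus>\<^bsub>sect X U\<^esub> t = \<zero>\<^bsub>sect X U\<^esub>" using rst_zeroD[OF assms(1-4)] assms(5,6) by blast
  then show ?thesis using assms(5,6) by simp
qed

text \<open>Topologically indistinguishable points lie in the same charts, where they correspond to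
  different primes. An element of one prime outside the other has an open nonvanishing locus that
  separates them.\<close>

lemma T0:
  assumes "x \<in> points X" "y \<in> points X" "x \<noteq> y"
  obtains U where "opn U" "(x \<in> U) \<noteq> (y \<in> U)"
proof (rule ccontr)
  note nn = that
  assume n: "\<not> thesis"
  have same: "x \<in> U \<longleftrightarrow> y \<in> U" if "opn U" for U 
  proof (rule ccontr)
    assume "(x \<in> U) \<noteq> (y \<in> U)"
    then have thesis by (rule nn[OF that])
    then show False using n by contradiction
  qed
  obtain V A \<phi> \<iota> where V: "x \<in> V" "affine_chart X V A \<phi> \<iota>" using chart assms(1) by blast
  interpret affine_chart X V A \<phi> \<iota> by fact
  have yV: "y \<in> V" using same open_V V by blast
  have "\<phi> x \<noteq> \<phi> y" using chart_bij V yV assms(3) unfolding bij_betw_def inj_on_def by blast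
  moreover have "\<phi> z \<subseteq> carrier A" if "z \<in> V" for z
  proof -
    interpret primeideal "\<phi> z" A using chart_bij that unfolding bij_betw_def by blast
    show ?thesis using a_subset .
  qed
  then have "\<phi> x \<subseteq> carrier A" "\<phi> y \<subseteq> carrier A" using V yV by auto
  ultimately obtain a where "a \<in> carrier A" "(a \<in> \<phi> x) \<noteq> (a \<in> \<phi> y)" by blast
  then show False using same[OF chart_open] V yV by blast
qed

lemma closure_singleton:
  "y \<in> Abstract_Topology.closure_of (zariski X) {x} \<longleftrightarrow> y \<in> points X \<and> (\<forall>U. opn U \<longrightarrow> y \<in> U \<longrightarrow> x \<in> U)"
  by (auto simp: in_closure_of)

text \<open>The point is that of the kernel of \<open>\<iota>\<close>, which is prime since the
  sections over \<open>V\<close> form a domain. It lies in every nonempty \<open>U\<close>: inside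
  \<open>U\<close> there is the nonvanishing locus of some \<open>a\<close> outside the prime of a
  point y, and \<open>\<iota> a = 0\<close> would give u a = 0 with neither factor in that
  prime.\<close>

lemma generic_exists:
  "\<exists>g V A \<phi> \<iota>. g \<in> V \<and> affine_chart X V A \<phi> \<iota> \<and> (\<forall>U. opn U \<longrightarrow> U \<noteq> {} \<longrightarrow> g \<in> U) \<and>
     \<phi> g = {a \<in> carrier A. \<iota> a = \<zero>\<^bsub>sect X V\<^esub>}"
proof -
  obtain x where "x \<in> points X" using integral unfolding integral_scheme_def by blast
  then obtain V A \<phi> \<iota> where V: "x \<in> V" "affine_chart X V A \<phi> \<iota>" using chart by blast
  interpret affine_chart X V A \<phi> \<iota> by fact
  interpret V: domain "sect X V" using sect_domain open_V V by blast
  interpret h: ring_hom_cring A "sect X V" \<iota>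
    by (rule ring_hom_cring_of[OF A.is_cring V.is_cring chart_hom])
  let ?K = "{a \<in> carrier A. \<iota> a = \<zero>\<^bsub>sect X V\<^esub>}"
  have "primeideal ?K A"
  proof (rule primeidealI[OF ring_hom_ring.kernel_is_ideal[OF ring_hom_ringI2[OF A.ring_axioms V.ring_axioms chart_hom], unfolded a_kernel_def' ] A.is_cring])
    show "carrier A \<noteq> ?K" using h.hom_one A.one_closed V.one_not_zero by force
    show "a \<in> ?K \<or> b \<in> ?K" if "a \<in> carrier A" "b \<in> carrier A" "a \<otimes>\<^bsub>A\<^esub> b \<in> ?K" for a b
      using that V.integral[of "\<iota> a" "\<iota> b"] by simp
  qed
  then have "?K \<in> \<phi> ` V" using bij_betw_imp_surj_on[OF chart_bij] by simp
  then obtain g where g': "?K = \<phi> g" "g \<in> V" by (rule imageE)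
  note g = g'(2) g'(1)[symmetric]
  have "g \<in> U" if U: "opn U" "U \<noteq> {}" for U
  proof -
    obtain y where y: "y \<in> U" "y \<in> V" using irreducible[OF U(1) open_V U(2)] V by blast
    obtain a where a: "a \<in> carrier A" "a \<notin> \<phi> y" "{y \<in> V. a \<notin> \<phi> y} \<subseteq> U"
      using chart_basis[OF U(1) y] by (elim bexE conjE)
    have "\<iota> a \<noteq> \<zero>\<^bsub>sect X V\<^esub>"
    proof
      assume "\<iota> a = \<zero>\<^bsub>sect X V\<^esub>"
      moreover have "rst X V V (\<iota> a) = \<iota> a" using rst_self[OF open_V] a by simp
      ultimately obtain u where u: "u \<in> carrier A - \<phi> y" "u \<otimes>\<^bsub>A\<^esub> a = \<zero>\<^bsub>A\<^esub>"
        using chart_zero[OF open_V order_refl a(1) _ y(2)] by auto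
      interpret primeideal "\<phi> y" A using chart_bij y(2) unfolding bij_betw_def by blast
      show False using I_prime[of u a] u a by auto
    qed
    then show ?thesis using g a by blast
  qed
  then show ?thesis using g V(2) by blast
qed

text \<open>\<open>generic_point\<close> is a definite description; the point of
  \<open>generic_exists\<close> meets it by lying in all nonempty open sets, and uniqueness follows
  from \<open>T0\<close>.\<close>

lemma generic_in: "opn U \<Longrightarrow> U \<noteq> {} \<Longrightarrow> \<eta> \<in> U"
  and generic_points: "\<eta> \<in> points X"
  and generic_chart: "\<exists>V A \<phi> \<iota>. \<eta> \<in> V \<and> affine_chart X V A \<phi> \<iota> \<and> \<phi> \<eta> = {a \<in> carrier A. \<iota> a = \<zero>\<^bsub>sect X V\<^esub>}"
proof -
  obtain g V A \<phi> \<iota> where gg: "g \<in> V \<and> affine_chart X V A \<phi> \<iota> \<and> (\<forall>U. opn U \<longrightarrow> U \<noteq> {} \<longrightarrow> g \<in> U) \<and>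
     \<phi> g = {a \<in> carrier A. \<iota> a = \<zero>\<^bsub>sect X V\<^esub>}"
    using generic_exists by (elim exE) (rule that)
  then have g3: "g \<in> U" if "opn U" "U \<noteq> {}" for U using that by blast
  have gX: "g \<in> points X" using g3[OF openin_topspace] integral unfolding integral_scheme_def by blast
  have "generic_point X = g" unfolding generic_point_def
  proof (rule the_equality)
    show "g \<in> points X \<and> Abstract_Topology.closure_of (zariski X) {g} = points X"
      using gX g3 closure_singleton by blast
    fix h assume h: "h \<in> points X \<and> Abstract_Topology.closure_of (zariski X) {h} = points X"
    show "h = g"
    proof (rule ccontr)
      assume "h \<noteq> g"
      then obtain U where "opn U" "(h \<in> U) \<noteq> (g \<in> U)" using T0 h gX by metis
      moreover have "g \<in> Abstract_Topology.closure_of (zariski X) {h}" using h gX by blast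
      ultimately show False using g3[of U] closure_singleton[of g h] by blast
    qed
  qed
  then have e: "g = \<eta>" by simp
  show "opn U \<Longrightarrow> U \<noteq> {} \<Longrightarrow> \<eta> \<in> U" "\<eta> \<in> points X"
    using g3 gX unfolding e by blast+
  show
    "\<exists>V A \<phi> \<iota>. \<eta> \<in> V \<and> affine_chart X V A \<phi> \<iota> \<and> \<phi> \<eta> = {a \<in> carrier A. \<iota> a = \<zero>\<^bsub>sect X V\<^esub>}"
    using gg unfolding e by (intro exI[of _ V] exI[of _ A] exI[of _ \<phi>] exI[of _ \<iota>]) blast
qed

end

section \<open>Germs at the generic point and the field structure of the function field\<close>

context integral_space begin

abbreviation nopn :: "'a set \<Rightarrow> bool" where "nopn U \<equiv> opn U \<and> U \<noteq> {}"

lemma nopn_Int: "nopn U \<Longrightarrow> nopn V \<Longrightarrow> nopn (U \<inter> V)"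
  using irreducible by blast

lemma nopn_points: "nopn (points X)"
  using generic_points by blast

text \<open>The generic point lies in every nonempty open set, and restrictions are injective. So
  agreement on some small open set already is agreement on the whole intersection.\<close>

lemma mem_germ_iff:
  assumes "nopn U" "s \<in> carrier (sect X U)"
  shows "(V, t) \<in> germ X \<eta> U s \<longleftrightarrow>
    nopn V \<and> t \<in> carrier (sect X V) \<and> rst X U (U \<inter> V) s = rst X V (U \<inter> V) t"
proof
  assume "(V, t) \<in> germ X \<eta> U s"
  then obtain W where V: "opn V" "\<eta> \<in> V" "t \<in> carrier (sect X V)" and
    W: "opn W" "\<eta> \<in> W" "W \<subseteq> U \<inter> V" "rst X U W s = rst X V W t"
    unfolding germ_def by blast
  have o: "opn (U \<inter> V)" using assms V by blast
  have "rst X U (U \<inter> V) s = rst X V (U \<inter> V) t"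
  proof (rule rst_inj[OF o W(1,3)])
    show "rst X (U \<inter> V) W (rst X U (U \<inter> V) s) = rst X (U \<inter> V) W (rst X V (U \<inter> V) t)"
      using rst_rst[OF _ o W(1,3) _ assms(2)] rst_rst[OF V(1) o W(1,3) _ V(3)] assms(1) W(4) by simp
  qed (use W(2) assms V o rst_closed[OF _ o] in auto)
  then show "nopn V \<and> t \<in> carrier (sect X V) \<and> rst X U (U \<inter> V) s = rst X V (U \<inter> V) t"
    using V by blast
next
  assume *: "nopn V \<and> t \<in> carrier (sect X V) \<and> rst X U (U \<inter> V) s = rst X V (U \<inter> V) t"
  then have "opn (U \<inter> V)" "\<eta> \<in> U \<inter> V" "\<eta> \<in> V" using assms generic_in by auto
  then show "(V, t) \<in> germ X \<eta> U s" using * unfolding germ_def by blast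
qed

lemma germ_self: "nopn U \<Longrightarrow> s \<in> carrier (sect X U) \<Longrightarrow> (U, s) \<in> germ X \<eta> U s"
  by (subst mem_germ_iff) auto

text \<open>All three sections are compared on the triple intersection, which is nonempty by
  irreducibility; injectivity of restriction then gives the claim on
  \<open>U \<inter> W\<close>.\<close>

lemma germ_rel_trans:
  assumes U: "nopn U" "nopn V" "nopn W" "s \<in> carrier (sect X U)" "t \<in> carrier (sect X V)" "r \<in> carrier (sect X W)"
    and st: "rst X U (U \<inter> V) s = rst X V (U \<inter> V) t" and tr: "rst X V (V \<inter> W) t = rst X W (V \<inter> W) r"
  shows "rst X U (U \<inter> W) s = rst X W (U \<inter> W) r"
proof -
  let ?Z = "U \<inter> V \<inter> W"
  have o: "opn ?Z" "?Z \<noteq> {}" "opn (U \<inter> V)" "opn (V \<inter> W)" "opn (U \<inter> W)" using U nopn_Int by auto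
  have i: "?Z \<subseteq> U \<inter> V" "U \<inter> V \<subseteq> U" "U \<inter> V \<subseteq> V" "?Z \<subseteq> V \<inter> W" "V \<inter> W \<subseteq> V" "V \<inter> W \<subseteq> W"
    "?Z \<subseteq> U \<inter> W" "U \<inter> W \<subseteq> U" "U \<inter> W \<subseteq> W" by auto
  have 1: "rst X U ?Z s = rst X V ?Z t"
    using arg_cong[OF st, of "rst X (U \<inter> V) ?Z"] rst_rst[OF _ o(3,1) i(1,2) U(4)] rst_rst[OF _ o(3,1) i(1,3) U(5)] U by simp
  have 2: "rst X V ?Z t = rst X W ?Z r"
    using arg_cong[OF tr, of "rst X (V \<inter> W) ?Z"] rst_rst[OF _ o(4,1) i(4,5) U(5)] rst_rst[OF _ o(4,1) i(4,6) U(6)] U by simp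
  show ?thesis
  proof (rule rst_inj[OF o(5,1) _ o(2)])
    show "rst X (U \<inter> W) ?Z (rst X U (U \<inter> W) s) = rst X (U \<inter> W) ?Z (rst X W (U \<inter> W) r)"
      using 1 2 rst_rst[OF _ o(5,1) i(7,8) U(4)] rst_rst[OF _ o(5,1) i(7,9) U(6)] U by simp
  qed (use U rst_closed[OF _ o(5)] in auto)
qed

lemma germ_eq_iff:
  assumes U: "nopn U" "nopn V" "s \<in> carrier (sect X U)" "t \<in> carrier (sect X V)"
  shows "germ X \<eta> U s = germ X \<eta> V t \<longleftrightarrow> rst X U (U \<inter> V) s = rst X V (U \<inter> V) t"
proof
  assume "germ X \<eta> U s = germ X \<eta> V t"
  then have "(V, t) \<in> germ X \<eta> U s" using germ_self U by simp
  then show "rst X U (U \<inter> V) s = rst X V (U \<inter> V) t" using mem_germ_iff[OF U(1,3)] by blast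
next
  assume e: "rst X U (U \<inter> V) s = rst X V (U \<inter> V) t"
  then have e': "rst X V (V \<inter> U) t = rst X U (V \<inter> U) s" by (simp add: Int_commute)
  have "(W, r) \<in> germ X \<eta> U s \<longleftrightarrow> (W, r) \<in> germ X \<eta> V t" for W r
    unfolding mem_germ_iff[OF U(1,3)] mem_germ_iff[OF U(2,4)]
    using germ_rel_trans[OF U(1,2) _ U(3,4) _ e] germ_rel_trans[OF U(2,1) _ U(4,3) _ e'] by blast
  then show "germ X \<eta> U s = germ X \<eta> V t" by auto
qed

lemma germ_inj: "nopn U \<Longrightarrow> s \<in> carrier (sect X U) \<Longrightarrow> t \<in> carrier (sect X U) \<Longrightarrow>
    germ X \<eta> U s = germ X \<eta> U t \<longleftrightarrow> s = t"
  using germ_eq_iff[of U U s t] rst_self[of U] by auto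

lemma germ_rst:
  assumes "nopn U" "nopn V" "V \<subseteq> U" "s \<in> carrier (sect X U)"
  shows "germ X \<eta> V (rst X U V s) = germ X \<eta> U s"
proof (subst germ_eq_iff)
  show "rst X U V s \<in> carrier (sect X V)" using assms rst_closed by blast
  have "V \<inter> U = V" using assms by blast
  then show "rst X V (V \<inter> U) (rst X U V s) = rst X U (V \<inter> U) s"
    using assms rst_self rst_closed by auto
qed (use assms in auto)

lemma mem_germD:
  assumes "nopn U" "s \<in> carrier (sect X U)" "(V, t) \<in> germ X \<eta> U s"
  shows "nopn V" "t \<in> carrier (sect X V)" "germ X \<eta> V t = germ X \<eta> U s"
proof -
  have m: "nopn V \<and> t \<in> carrier (sect X V) \<and> rst X U (U \<inter> V) s = rst X V (U \<inter> V) t"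
    using mem_germ_iff[OF assms(1,2)] assms(3) by blast
  then show "nopn V" "t \<in> carrier (sect X V)" by auto
  show "germ X \<eta> V t = germ X \<eta> U s" using germ_eq_iff[OF assms(1) _ assms(2)] m by metis
qed

text \<open>Treats addition and multiplication of germs at once: \<open>f\<close> stands for either
  operation, of which only closure and compatibility with restriction matter. Any two
  representatives are compared with the given ones on one common open set.\<close>

lemma stalk_op_aux:
  fixes f :: "'b ring \<Rightarrow> 'b \<Rightarrow> 'b \<Rightarrow> 'b"
  assumes f_closed: "\<And>U s t. opn U \<Longrightarrow> s \<in> carrier (sect X U) \<Longrightarrow> t \<in> carrier (sect X U) \<Longrightarrow> f (sect X U) s t \<in> carrier (sect X U)"
    and f_rst: "\<And>U V s t. opn U \<Longrightarrow> opn V \<Longrightarrow> V \<subseteq> U \<Longrightarrow> s \<in> carrier (sect X U) \<Longrightarrow> t \<in> carrier (sect X U) \<Longrightarrow>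
        rst X U V (f (sect X U) s t) = f (sect X V) (rst X U V s) (rst X U V t)"
    and U: "nopn U" "s \<in> carrier (sect X U)" "t \<in> carrier (sect X U)"
  shows "(\<Union>(A, s)\<in>germ X \<eta> U s. \<Union>(B, t)\<in>germ X \<eta> U t.
        germ X \<eta> (A \<inter> B) (f (sect X (A \<inter> B)) (rst X A (A \<inter> B) s) (rst X B (A \<inter> B) t))) =
      germ X \<eta> U (f (sect X U) s t)"
proof (rule UN_pair_const[OF germ_self[OF U(1,2)] germ_self[OF U(1,3)]])
  fix A s' B t' assume m: "(A, s') \<in> germ X \<eta> U s" "(B, t') \<in> germ X \<eta> U t"
  note a = mem_germD[OF U(1,2) m(1)] and b = mem_germD[OF U(1,3) m(2)]
  let ?Z = "U \<inter> (A \<inter> B)"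
  have Z: "nopn ?Z" "nopn (A \<inter> B)" using nopn_Int U a b by simp_all
  have sub: "?Z \<subseteq> A \<inter> B" "?Z \<subseteq> U" "A \<inter> B \<subseteq> A" "A \<inter> B \<subseteq> B" by auto
  have e1: "rst X A ?Z s' = rst X U ?Z s"
    using germ_rst[OF a(1) Z(1) _ a(2)] germ_rst[OF U(1) Z(1) sub(2) U(2)] a(3) sub
      germ_inj[OF Z(1) rst_closed[OF _ _ _ a(2)] rst_closed[OF _ _ _ U(2)]] a(1) U(1) Z by auto
  have e2: "rst X B ?Z t' = rst X U ?Z t"
    using germ_rst[OF b(1) Z(1) _ b(2)] germ_rst[OF U(1) Z(1) sub(2) U(3)] b(3) sub
      germ_inj[OF Z(1) rst_closed[OF _ _ _ b(2)] rst_closed[OF _ _ _ U(3)]] b(1) U(1) Z by auto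
  have rc: "rst X A (A \<inter> B) s' \<in> carrier (sect X (A \<inter> B))" "rst X B (A \<inter> B) t' \<in> carrier (sect X (A \<inter> B))"
    using rst_closed[OF _ _ sub(3) a(2)] rst_closed[OF _ _ sub(4) b(2)] a b Z by auto
  let ?g = "f (sect X (A \<inter> B)) (rst X A (A \<inter> B) s') (rst X B (A \<inter> B) t')"
  have "germ X \<eta> (A \<inter> B) ?g = germ X \<eta> ?Z (rst X (A \<inter> B) ?Z ?g)"
    using germ_rst[OF Z(2,1) sub(1) f_closed[OF _ rc]] Z by simp
  also have "rst X (A \<inter> B) ?Z ?g = f (sect X ?Z) (rst X A ?Z s') (rst X B ?Z t')"
    using f_rst[OF _ _ sub(1) rc] rst_rst[OF _ _ _ sub(1) sub(3) a(2)] rst_rst[OF _ _ _ sub(1) sub(4) b(2)] Z a b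
    by simp
  also have "\<dots> = rst X U ?Z (f (sect X U) s t)"
    unfolding e1 e2 using f_rst[OF _ _ sub(2) U(2,3)] U(1) Z(1) by simp
  also have "germ X \<eta> ?Z \<dots> = germ X \<eta> U (f (sect X U) s t)"
    using germ_rst[OF U(1) Z(1) sub(2) f_closed[OF _ U(2,3)]] U(1) by blast
  finally show "germ X \<eta> (A \<inter> B) ?g = germ X \<eta> U (f (sect X U) s t)" .
qed

lemma carrier_L: "carrier L = {germ X \<eta> U s | U s. nopn U \<and> s \<in> carrier (sect X U)}"
  unfolding func_field_def stalk_def using generic_in by auto

lemma germ_closed: "nopn U \<Longrightarrow> s \<in> carrier (sect X U) \<Longrightarrow> germ X \<eta> U s \<in> carrier L"
  unfolding carrier_L by blast

lemma germ_mult: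
  assumes "nopn U" "s \<in> carrier (sect X U)" "t \<in> carrier (sect X U)"
  shows "germ X \<eta> U s \<cdot> germ X \<eta> U t = germ X \<eta> U (s \<otimes>\<^bsub>sect X U\<^esub> t)"
  unfolding func_field_def stalk_def
  using stalk_op_aux[of mult, OF _ rst_mult assms] cring.cring_simprules(5)[OF sect_cring] by simp

lemma germ_add:
  assumes "nopn U" "s \<in> carrier (sect X U)" "t \<in> carrier (sect X U)"
  shows "germ X \<eta> U s \<boxplus> germ X \<eta> U t = germ X \<eta> U (s \<oplus>\<^bsub>sect X U\<^esub> t)"
  unfolding func_field_def stalk_def
  using stalk_op_aux[of add, OF _ rst_add assms] cring.cring_simprules(1)[OF sect_cring] by simp

lemma germ_one: "nopn U \<Longrightarrow> germ X \<eta> U \<one>\<^bsub>sect X U\<^esub> = \<one>\<^bsub>L\<^esub>"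
  using germ_rst[OF nopn_points, of U] rst_one[of "points X" U] openin_subset
    cring.cring_simprules(6)[OF sect_cring[OF openin_topspace]]
  unfolding func_field_def stalk_def by fastforce

lemma germ_zero: "nopn U \<Longrightarrow> germ X \<eta> U \<zero>\<^bsub>sect X U\<^esub> = \<zero>\<^bsub>L\<^esub>"
  using germ_rst[OF nopn_points, of U] rst_zero[of "points X" U] openin_subset
    cring.cring_simprules(2)[OF sect_cring[OF openin_topspace]]
  unfolding func_field_def stalk_def by fastforce

lemma common_germ2:
  assumes "f \<in> carrier L" "g \<in> carrier L"
  obtains U s t where "nopn U" "s \<in> carrier (sect X U)" "t \<in> carrier (sect X U)"
    "f = germ X \<eta> U s" "g = germ X \<eta> U t"
proof -
  obtain U s V t where s: "nopn U" "s \<in> carrier (sect X U)" "f = germ X \<eta> U s"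
    and t: "nopn V" "t \<in> carrier (sect X V)" "g = germ X \<eta> V t"
    using assms unfolding carrier_L by blast
  have o: "nopn (U \<inter> V)" using nopn_Int s t by blast
  show thesis
    by (rule that[OF o rst_closed[OF _ _ _ s(2)] rst_closed[OF _ _ _ t(2)]])
      (use s t o germ_rst[OF s(1) o _ s(2)] germ_rst[OF t(1) o _ t(2)] in auto)
qed

lemma common_germ3:
  assumes "f \<in> carrier L" "g \<in> carrier L" "h \<in> carrier L"
  obtains U s t r where "nopn U" "s \<in> carrier (sect X U)" "t \<in> carrier (sect X U)" "r \<in> carrier (sect X U)"
    "f = germ X \<eta> U s" "g = germ X \<eta> U t" "h = germ X \<eta> U r"
proof -
  obtain V s t where s: "nopn V" "s \<in> carrier (sect X V)" "t \<in> carrier (sect X V)" "f = germ X \<eta> V s" "g = germ X \<eta> V t"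
    using common_germ2[OF assms(1,2)] by blast
  obtain U r where r: "nopn U" "r \<in> carrier (sect X U)" "h = germ X \<eta> U r"
    using assms(3) unfolding carrier_L by blast
  have o: "nopn (U \<inter> V)" using nopn_Int s r by blast
  show thesis
    by (rule that[OF o rst_closed[OF _ _ _ s(2)] rst_closed[OF _ _ _ s(3)] rst_closed[OF _ _ _ r(2)]])
      (use s r o germ_rst[OF s(1) o _ s(2)] germ_rst[OF s(1) o _ s(3)] germ_rst[OF r(1) o _ r(2)] in auto)
qed

lemma L_cring: "cring L"
proof (rule cringI)
  show "abelian_group L"
  proof (rule abelian_groupI)
    fix f g h assume f: "f \<in> carrier L" and g: "g \<in> carrier L"
    show "f \<boxplus> g \<in> carrier L" "f \<boxplus> g = g \<boxplus> f"
    proof -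
      obtain U s t where U: "nopn U" "s \<in> carrier (sect X U)" "t \<in> carrier (sect X U)"
        "f = germ X \<eta> U s" "g = germ X \<eta> U t" using common_germ2[OF f g] .
      interpret U: cring "sect X U" using sect_cring U by blast
      show "f \<boxplus> g \<in> carrier L" "f \<boxplus> g = g \<boxplus> f"
        using U by (simp_all add: germ_add germ_closed U.a_comm)
    qed
    assume h: "h \<in> carrier L"
    obtain U s t r where U: "nopn U" "s \<in> carrier (sect X U)" "t \<in> carrier (sect X U)" "r \<in> carrier (sect X U)"
      "f = germ X \<eta> U s" "g = germ X \<eta> U t" "h = germ X \<eta> U r" using common_germ3[OF f g h] .
    interpret U: cring "sect X U" using sect_cring U by blast
    show "f \<boxplus> g \<boxplus> h = f \<boxplus> (g \<boxplus> h)" using U by (simp add: germ_add U.a_assoc)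
  next
    show "\<zero>\<^bsub>L\<^esub> \<in> carrier L"
      using germ_closed[OF nopn_points] germ_zero[OF nopn_points] sect_cring[OF openin_topspace] cring.cring_simprules(2)
      by metis
  next
    fix f assume "f \<in> carrier L"
    then obtain U s where U: "nopn U" "s \<in> carrier (sect X U)" "f = germ X \<eta> U s" unfolding carrier_L by blast
    interpret U: cring "sect X U" using sect_cring U by blast
    show "\<zero>\<^bsub>L\<^esub> \<boxplus> f = f" using germ_zero[OF U(1), symmetric] U by (simp add: germ_add)
    have "germ X \<eta> U (\<ominus>\<^bsub>sect X U\<^esub> s) \<boxplus> f = \<zero>\<^bsub>L\<^esub>"
      using germ_zero[OF U(1)] U by (simp add: germ_add U.l_neg)
    then show "\<exists>g\<in>carrier L. g \<boxplus> f = \<zero>\<^bsub>L\<^esub>"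
      by (rule bexI) (use germ_closed U in simp)
  qed
  show "Group.comm_monoid L"
  proof (rule comm_monoidI)
    fix f g h assume f: "f \<in> carrier L" and g: "g \<in> carrier L"
    show "f \<cdot> g \<in> carrier L" "f \<cdot> g = g \<cdot> f"
    proof -
      obtain U s t where U: "nopn U" "s \<in> carrier (sect X U)" "t \<in> carrier (sect X U)"
        "f = germ X \<eta> U s" "g = germ X \<eta> U t" using common_germ2[OF f g] .
      interpret U: cring "sect X U" using sect_cring U by blast
      show "f \<cdot> g \<in> carrier L" "f \<cdot> g = g \<cdot> f"
        using U by (simp_all add: germ_mult germ_closed U.m_comm)
    qed
    assume h: "h \<in> carrier L"
    obtain U s t r where U: "nopn U" "s \<in> carrier (sect X U)" "t \<in> carrier (sect X U)" "r \<in> carrier (sect X U)"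
      "f = germ X \<eta> U s" "g = germ X \<eta> U t" "h = germ X \<eta> U r" using common_germ3[OF f g h] .
    interpret U: cring "sect X U" using sect_cring U by blast
    show "f \<cdot> g \<cdot> h = f \<cdot> (g \<cdot> h)" using U by (simp add: germ_mult U.m_assoc)
  next
    show "\<one>\<^bsub>L\<^esub> \<in> carrier L"
      using germ_closed[OF nopn_points] germ_one[OF nopn_points] sect_cring[OF openin_topspace] cring.cring_simprules(6)
      by metis
  next
    fix f assume "f \<in> carrier L"
    then obtain U s where U: "nopn U" "s \<in> carrier (sect X U)" "f = germ X \<eta> U s" unfolding carrier_L by blast
    interpret U: cring "sect X U" using sect_cring U by blast
    show "\<one>\<^bsub>L\<^esub> \<cdot> f = f" using germ_one[OF U(1), symmetric] U by (simp add: germ_mult)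
  qed
  fix f g h assume f: "f \<in> carrier L" "g \<in> carrier L" "h \<in> carrier L"
  obtain U s t r where U: "nopn U" "s \<in> carrier (sect X U)" "t \<in> carrier (sect X U)" "r \<in> carrier (sect X U)"
      "f = germ X \<eta> U s" "g = germ X \<eta> U t" "h = germ X \<eta> U r" using common_germ3[OF f] .
  interpret U: cring "sect X U" using sect_cring U by blast
  show "(f \<boxplus> g) \<cdot> h = f \<cdot> h \<boxplus> g \<cdot> h"
    using U by (simp add: germ_mult germ_add U.l_distr)
qed

sublocale L: cring L by (rule L_cring)

lemma germ_hom: "nopn U \<Longrightarrow> germ X \<eta> U \<in> ring_hom (sect X U) L"
  by (rule ring_hom_memI) (auto simp: germ_closed germ_mult germ_add germ_one)

text \<open>Near the generic point c f = a with c a unit. If f is nonzero, then a does not vanish at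
  the generic point and is a unit on its nonvanishing locus. Hence c f, and with it f, is
  invertible.\<close>

lemma L_field: "field L"
proof (rule L.cring_fieldI)
  have one: "\<one>\<^bsub>L\<^esub> \<noteq> \<zero>\<^bsub>L\<^esub>"
  proof
    assume e: "\<one>\<^bsub>L\<^esub> = \<zero>\<^bsub>L\<^esub>"
    interpret U: domain "sect X (points X)" using sect_domain nopn_points by blast
    show False using e germ_one[OF nopn_points] germ_zero[OF nopn_points] 
      germ_inj[OF nopn_points U.one_closed U.zero_closed] U.one_not_zero by simp
  qed
  have "f \<in> Units L" if f: "f \<in> carrier L" "f \<noteq> \<zero>\<^bsub>L\<^esub>" for f
  proof -
    obtain V A \<phi> \<iota> where VA: "\<eta> \<in> V \<and> affine_chart X V A \<phi> \<iota> \<and> \<phi> \<eta> = {a \<in> carrier A. \<iota> a = \<zero>\<^bsub>sect X V\<^esub>}"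
      using generic_chart by (elim exE) (rule that)
    then interpret affine_chart X V A \<phi> \<iota> by blast
    obtain U0 s0 where U0: "nopn U0" "s0 \<in> carrier (sect X U0)" "f = germ X \<eta> U0 s0"
      using f unfolding carrier_L by blast
    define U where "U = U0 \<inter> V"
    define s where "s = rst X U0 U s0"
    have V: "nopn V" using VA open_V by blast
    have U: "nopn U" "U \<subseteq> U0" "U \<subseteq> V" unfolding U_def using nopn_Int[OF U0(1) V] by auto
    have s: "s \<in> carrier (sect X U)" "f = germ X \<eta> U s"
      unfolding s_def using rst_closed[OF _ _ U(2) U0(2)] germ_rst[OF U0(1) U(1,2) U0(2)] U U0 by auto
    obtain W a c where W: "opn W" "\<eta> \<in> W" "W \<subseteq> U" "a \<in> carrier A" "c \<in> carrier A" "\<forall>y\<in>W. c \<notin> \<phi> y"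
      and eq: "rst X V W (\<iota> c) \<otimes>\<^bsub>sect X W\<^esub> rst X U W s = rst X V W (\<iota> a)"
      using chart_frac[OF _ U(3) s(1), of \<eta>] U generic_in by blast
    interpret W: domain "sect X W" using sect_domain W by blast
    have sW: "rst X U W s \<in> carrier (sect X W)" using rst_closed[OF _ W(1,3) s(1)] U by blast
    have WV: "W \<subseteq> V" using W U by blast
    have fW: "f = germ X \<eta> W (rst X U W s)" using germ_rst[OF U(1) _ W(3) s(1)] s W by auto
    have cU: "rst X V W (\<iota> c) \<in> Units (sect X W)" using chart_unit[OF W(1) WV W(5)] W by blast
    \<comment> \<open>By the choice of the chart, \<open>\<phi> \<eta>\<close> is the kernel of
      \<open>\<iota>\<close>, so otherwise c f would be zero.\<close>
    have "a \<notin> \<phi> \<eta>"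
    proof
      assume "a \<in> \<phi> \<eta>"
      then have "\<iota> a = \<zero>\<^bsub>sect X V\<^esub>" using VA by blast
      then have "rst X V W (\<iota> c) \<otimes>\<^bsub>sect X W\<^esub> rst X U W s = \<zero>\<^bsub>sect X W\<^esub>" 
        using eq rst_zero[OF open_V W(1) WV] by simp
      then have "rst X U W s = \<zero>\<^bsub>sect X W\<^esub>" using W.Units_mult_zero[OF cU sW] by blast
      then show False using fW f germ_zero[of W] W by auto
    qed
    define Z where "Z = W \<inter> {y \<in> V. a \<notin> \<phi> y}"
    have Z: "opn Z" "\<eta> \<in> Z" "Z \<subseteq> W" "Z \<subseteq> V" using W \<open>a \<notin> \<phi> \<eta>\<close> chart_open[OF W(4)] VA unfolding Z_def by auto
    have aU: "rst X V Z (\<iota> a) \<in> Units (sect X Z)" using chart_unit[OF Z(1,4) W(4)] unfolding Z_def by blast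
    interpret Z: domain "sect X Z" using sect_domain Z by blast
    have ia: "\<iota> a \<in> carrier (sect X V)" using ring_hom_closed[OF chart_hom W(4)] .
    have nZ: "nopn Z" "nopn W" using Z W by auto
    have cW: "rst X V W (\<iota> c) \<in> carrier (sect X W)" using cU by blast
    have "germ X \<eta> W (rst X V W (\<iota> c)) \<cdot> f = germ X \<eta> W (rst X V W (\<iota> a))"
      unfolding fW germ_mult[OF nZ(2) cW sW] eq ..
    also have "\<dots> = germ X \<eta> Z (rst X V Z (\<iota> a))"
      using germ_rst[OF V nZ(2) WV ia] germ_rst[OF V nZ(1) Z(4) ia] by simp
    finally have "germ X \<eta> W (rst X V W (\<iota> c)) \<cdot> f \<in> Units L"
      using ring_hom_Units[OF Z.is_cring L_cring germ_hom[OF nZ(1)] aU] by simp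
    then obtain h where "h \<in> carrier L" "germ X \<eta> W (rst X V W (\<iota> c)) \<cdot> f \<cdot> h = \<one>\<^bsub>L\<^esub>"
      unfolding L.Units_iff by blast
    moreover have "germ X \<eta> W (rst X V W (\<iota> c)) \<in> carrier L" using germ_closed[OF nZ(2) cW] .
    ultimately have "f \<cdot> (germ X \<eta> W (rst X V W (\<iota> c)) \<cdot> h) = \<one>\<^bsub>L\<^esub>" 
      "germ X \<eta> W (rst X V W (\<iota> c)) \<cdot> h \<in> carrier L"
      using f by (simp_all add: L.m_assoc L.m_lcomm)
    then show ?thesis unfolding L.Units_iff using f by blast
  qed
  moreover have "\<zero>\<^bsub>L\<^esub> \<notin> Units L" using one unfolding L.Units_iff by auto
  ultimately show "Units L = carrier L - {\<zero>\<^bsub>L\<^esub>}" using L.Units_closed by blast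
qed

end

section \<open>Local rings and affine open sets\<close>

context integral_space begin

sublocale L: field L by (rule L_field)

abbreviation loc :: "'a \<Rightarrow> ('a, 'b) rat_fun set" (\<open>\<O>\<close>) where "\<O> x \<equiv> regular_at X x"
abbreviation mx :: "'a \<Rightarrow> ('a, 'b) rat_fun set" (\<open>\<mm>\<close>) where "\<mm> x \<equiv> max_ideal X x"
abbreviation Rg :: "'a set \<Rightarrow> ('a, 'b) rat_fun set" (\<open>\<R>\<close>) where "\<R> U \<equiv> regular X U"

lemma regular_closed:
  assumes "nopn U"
  shows "\<R> U \<subseteq> carrier L" "\<one>\<^bsub>L\<^esub> \<in> \<R> U" "\<zero>\<^bsub>L\<^esub> \<in> \<R> U"
    "f \<in> \<R> U \<Longrightarrow> g \<in> \<R> U \<Longrightarrow> f \<boxplus> g \<in> \<R> U"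
    "f \<in> \<R> U \<Longrightarrow> g \<in> \<R> U \<Longrightarrow> f \<cdot> g \<in> \<R> U"
    "f \<in> \<R> U \<Longrightarrow> \<ominus>\<^bsub>L\<^esub> f \<in> \<R> U"
proof -
  interpret U: cring "sect X U" using sect_cring assms by blast
  show "\<R> U \<subseteq> carrier L" unfolding regular_def using germ_closed[OF assms] by blast
  show "\<one>\<^bsub>L\<^esub> \<in> \<R> U" unfolding regular_def using germ_one[OF assms] by (metis U.one_closed imageI)
  show "\<zero>\<^bsub>L\<^esub> \<in> \<R> U" unfolding regular_def using germ_zero[OF assms] by (metis U.zero_closed imageI)
  show "f \<in> \<R> U \<Longrightarrow> g \<in> \<R> U \<Longrightarrow> f \<boxplus> g \<in> \<R> U"
    unfolding regular_def using germ_add[OF assms] by auto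
  show "f \<in> \<R> U \<Longrightarrow> g \<in> \<R> U \<Longrightarrow> f \<cdot> g \<in> \<R> U"
    unfolding regular_def using germ_mult[OF assms] by auto
  show "\<ominus>\<^bsub>L\<^esub> f \<in> \<R> U" if f: "f \<in> \<R> U"
  proof -
    obtain s where s: "s \<in> carrier (sect X U)" "f = germ X \<eta> U s" using f unfolding regular_def by blast
    interpret h: ring_hom_cring "sect X U" L "germ X \<eta> U"
      by (rule ring_hom_cring_of[OF U.is_cring L_cring germ_hom[OF assms]])
    show ?thesis unfolding regular_def s(2) using s(1) by (metis U.a_inv_closed h.hom_a_inv imageI)
  qed
qed

lemma regular_mono: "nopn U \<Longrightarrow> nopn V \<Longrightarrow> V \<subseteq> U \<Longrightarrow> \<R> U \<subseteq> \<R> V"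
proof
  fix f assume UV: "nopn U" "nopn V" "V \<subseteq> U" and "f \<in> \<R> U"
  then obtain s where s: "s \<in> carrier (sect X U)" "f = germ X \<eta> U s" unfolding regular_def by blast
  have "rst X U V s \<in> carrier (sect X V)" using rst_closed[OF _ _ UV(3) s(1)] UV by blast
  then show "f \<in> \<R> V" unfolding regular_def s(2) germ_rst[OF UV s(1), symmetric] by (rule imageI)
qed

lemma regular_at_iff: "f \<in> \<O> x \<longleftrightarrow> (\<exists>U. opn U \<and> x \<in> U \<and> f \<in> \<R> U)"
  unfolding regular_at_def by blast

lemma regular_subset_at: "opn U \<Longrightarrow> x \<in> U \<Longrightarrow> \<R> U \<subseteq> \<O> x"
  unfolding regular_at_def by blast

lemma regular_at_pair:
  assumes "f \<in> \<O> x" "g \<in> \<O> x"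
  obtains U where "nopn U" "x \<in> U" "f \<in> \<R> U" "g \<in> \<R> U"
proof -
  obtain U V where U: "opn U" "x \<in> U" "f \<in> \<R> U" and V: "opn V" "x \<in> V" "g \<in> \<R> V"
    using assms unfolding regular_at_iff by blast
  have n: "nopn (U \<inter> V)" using U V by blast
  show thesis
  proof (rule that[OF n])
    show "f \<in> \<R> (U \<inter> V)" using regular_mono[of U "U \<inter> V"] U n by blast
    show "g \<in> \<R> (U \<inter> V)" using regular_mono[of V "U \<inter> V"] V n by blast
  qed (use U V in blast)
qed

lemma regular_at_closed:
  shows "\<O> x \<subseteq> carrier L"
    and "x \<in> points X \<Longrightarrow> \<one>\<^bsub>L\<^esub> \<in> \<O> x" "x \<in> points X \<Longrightarrow> \<zero>\<^bsub>L\<^esub> \<in> \<O> x"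
    "f \<in> \<O> x \<Longrightarrow> g \<in> \<O> x \<Longrightarrow> f \<boxplus> g \<in> \<O> x"
    "f \<in> \<O> x \<Longrightarrow> g \<in> \<O> x \<Longrightarrow> f \<cdot> g \<in> \<O> x"
    "f \<in> \<O> x \<Longrightarrow> \<ominus>\<^bsub>L\<^esub> f \<in> \<O> x"
proof -
  show "\<O> x \<subseteq> carrier L" unfolding regular_at_def using regular_closed(1) by blast
  show "x \<in> points X \<Longrightarrow> \<one>\<^bsub>L\<^esub> \<in> \<O> x" "x \<in> points X \<Longrightarrow> \<zero>\<^bsub>L\<^esub> \<in> \<O> x"
    unfolding regular_at_iff using nopn_points regular_closed(2,3)[OF nopn_points] by blast+
  show "f \<boxplus> g \<in> \<O> x" "f \<cdot> g \<in> \<O> x" if "f \<in> \<O> x" "g \<in> \<O> x"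
    using regular_at_pair[OF that] regular_closed(4,5) unfolding regular_at_iff by metis+
  show "f \<in> \<O> x \<Longrightarrow> \<ominus>\<^bsub>L\<^esub> f \<in> \<O> x" 
    unfolding regular_at_iff using regular_closed(6) by blast
qed

lemma max_ideal_iff: "f \<in> \<mm> x \<longleftrightarrow> f \<in> \<O> x \<and> \<not> (\<exists>g\<in>\<O> x. f \<cdot> g = \<one>\<^bsub>L\<^esub>)"
proof -
  have "f \<in> carrier L \<Longrightarrow> (\<exists>g\<in>\<O> x. g \<cdot> f = \<one>\<^bsub>L\<^esub> \<and> f \<cdot> g = \<one>\<^bsub>L\<^esub>) \<longleftrightarrow> (\<exists>g\<in>\<O> x. f \<cdot> g = \<one>\<^bsub>L\<^esub>)"
    by (rule bex_cong[OF refl]) (use L.m_comm subsetD[OF regular_at_closed(1)] in metis)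
  moreover have "f \<in> \<O> x \<Longrightarrow> f \<in> carrier L" using regular_at_closed(1) by blast
  moreover have "f \<in> \<mm> x \<longleftrightarrow> f \<in> \<O> x \<and> \<not> (\<exists>g\<in>\<O> x. g \<cdot> f = \<one>\<^bsub>L\<^esub> \<and> f \<cdot> g = \<one>\<^bsub>L\<^esub>)"
    unfolding max_ideal_def Units_def local_ring_def by simp blast
  ultimately show ?thesis by metis
qed

lemma max_ideal_carr: "f \<in> \<mm> x \<Longrightarrow> f \<in> carrier L"
  by (rule subsetD[OF regular_at_closed(1)[of x]]) (simp add: max_ideal_iff)

lemma one_notin_max: "x \<in> points X \<Longrightarrow> \<one>\<^bsub>L\<^esub> \<notin> \<mm> x"
  using regular_at_closed(2)[of x] by (auto simp: max_ideal_iff intro!: bexI[of _ "\<one>\<^bsub>L\<^esub>"])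

text \<open>Valid for the nonunits of any commutative ring: a product is a unit iff both factors
  are.\<close>

lemma max_ideal_mult_iff:
  assumes "f \<in> \<O> x" "g \<in> \<O> x" "x \<in> points X"
  shows "f \<cdot> g \<in> \<mm> x \<longleftrightarrow> f \<in> \<mm> x \<or> g \<in> \<mm> x"
proof -
  have c: "f \<in> carrier L" "g \<in> carrier L" using assms regular_at_closed(1) by auto
  have "\<exists>h\<in>\<O> x. f \<cdot> h = \<one>\<^bsub>L\<^esub>" "\<exists>h\<in>\<O> x. g \<cdot> h = \<one>\<^bsub>L\<^esub>"
    if h: "h \<in> \<O> x" "f \<cdot> g \<cdot> h = \<one>\<^bsub>L\<^esub>" for h
  proof -
    have "f \<cdot> (g \<cdot> h) = \<one>\<^bsub>L\<^esub>" "g \<cdot> (f \<cdot> h) = \<one>\<^bsub>L\<^esub>"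
      using h c subsetD[OF regular_at_closed(1) h(1)] by (simp_all add: L.m_ac)
    then show "\<exists>h\<in>\<O> x. f \<cdot> h = \<one>\<^bsub>L\<^esub>" "\<exists>h\<in>\<O> x. g \<cdot> h = \<one>\<^bsub>L\<^esub>"
      using regular_at_closed(5) assms h(1) by blast+
  qed
  moreover have "\<exists>h\<in>\<O> x. f \<cdot> g \<cdot> h = \<one>\<^bsub>L\<^esub>"
    if h: "h \<in> \<O> x" "f \<cdot> h = \<one>\<^bsub>L\<^esub>" "k \<in> \<O> x" "g \<cdot> k = \<one>\<^bsub>L\<^esub>" for h k
  proof
    have hk: "h \<in> carrier L" "k \<in> carrier L" using h regular_at_closed(1) by auto
    have "f \<cdot> g \<cdot> (h \<cdot> k) = (f \<cdot> h) \<cdot> (g \<cdot> k)"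
      using c hk by (simp add: L.m_ac)
    then show "f \<cdot> g \<cdot> (h \<cdot> k) = \<one>\<^bsub>L\<^esub>" using h by simp
    show "h \<cdot> k \<in> \<O> x" using h regular_at_closed(5) by blast
  qed
  ultimately have "(\<exists>h\<in>\<O> x. f \<cdot> g \<cdot> h = \<one>\<^bsub>L\<^esub>) \<longleftrightarrow>
      (\<exists>h\<in>\<O> x. f \<cdot> h = \<one>\<^bsub>L\<^esub>) \<and> (\<exists>h\<in>\<O> x. g \<cdot> h = \<one>\<^bsub>L\<^esub>)"
    by (auto 0 3)
  moreover have "f \<cdot> g \<in> \<O> x" using assms regular_at_closed(5) by blast
  ultimately show ?thesis unfolding max_ideal_iff using assms(1,2) by simp
qed

text \<open>An inverse of \<open>f\<close> in the local ring at y is regular on a neighbourhood of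
  y, and \<open>f\<close> stays invertible there.\<close>

lemma open_nonvanishing:
  assumes "nopn U" "f \<in> \<R> U"
  shows "opn {y \<in> U. f \<notin> \<mm> y}"
proof (rule openin_subopen[THEN iffD2], rule ballI)
  fix y assume y: "y \<in> {y \<in> U. f \<notin> \<mm> y}"
  have "f \<in> \<O> y" by (rule subsetD[OF regular_subset_at]) (use y assms in auto)
  then have "\<exists>g\<in>\<O> y. f \<cdot> g = \<one>\<^bsub>L\<^esub>" using y by (simp add: max_ideal_iff)
  then obtain g where g: "g \<in> \<O> y" "f \<cdot> g = \<one>\<^bsub>L\<^esub>" by (elim bexE)
  then obtain W where W: "opn W" "y \<in> W" "g \<in> \<R> W" unfolding regular_at_iff by blast
  have "g \<in> \<O> z" if "z \<in> W" for z using regular_subset_at W that by blast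
  then have "U \<inter> W \<subseteq> {y \<in> U. f \<notin> \<mm> y}" unfolding max_ideal_iff using g(2) by blast
  then show "\<exists>T. opn T \<and> y \<in> T \<and> T \<subseteq> {y \<in> U. f \<notin> \<mm> y}" using W assms y by blast
qed

section \<open>Charts and affine open sets inside the function field\<close>

definition chart_fun :: "'a set \<Rightarrow> ('b \<Rightarrow> 'b) \<Rightarrow> 'b \<Rightarrow> ('a, 'b) rat_fun" where
  "chart_fun V \<iota> a = germ X \<eta> V (\<iota> a)"

text \<open>The dictionary between a chart and subsets of \<open>L\<close>, from which the later
  statements about fractions, basic neighbourhoods and primes of an affine open set are
  derived.\<close>

lemma chart_facts:
  assumes ch: "affine_chart X V A \<phi> \<iota>" and ne: "V \<noteq> {}"
  shows "chart_fun V \<iota> \<in> ring_hom A L"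
    and "a \<in> carrier A \<Longrightarrow> chart_fun V \<iota> a \<in> \<R> V"
    and "x \<in> V \<Longrightarrow> f \<in> \<O> x \<Longrightarrow> \<exists>a c. a \<in> carrier A \<and> c \<in> carrier A \<and> c \<notin> \<phi> x \<and>
           chart_fun V \<iota> c \<cdot> f = chart_fun V \<iota> a"
    and "x \<in> V \<Longrightarrow> a \<in> carrier A \<Longrightarrow> chart_fun V \<iota> a \<in> \<mm> x \<longleftrightarrow> a \<in> \<phi> x"
proof -
  interpret affine_chart X V A \<phi> \<iota> by fact
  let ?j = "chart_fun V \<iota>"
  have V: "nopn V" using open_V ne by blast
  show hom: "?j \<in> ring_hom A L"
    using ring_hom_trans[OF chart_hom germ_hom[OF V]] unfolding chart_fun_def comp_def .
  show reg: "?j a \<in> \<R> V" if "a \<in> carrier A" for a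
    unfolding chart_fun_def regular_def using ring_hom_closed[OF chart_hom that] by blast
  have jW: "?j a = germ X \<eta> W (rst X V W (\<iota> a))" if "nopn W" "W \<subseteq> V" "a \<in> carrier A" for W a
    using germ_rst[OF V that(1,2) ring_hom_closed[OF chart_hom that(3)]] unfolding chart_fun_def by simp
  show frac: "\<exists>a c. a \<in> carrier A \<and> c \<in> carrier A \<and> c \<notin> \<phi> x \<and> ?j c \<cdot> f = ?j a"
    if x: "x \<in> V" and f: "f \<in> \<O> x" for x f
  proof -
    obtain U0 where U0: "opn U0" "x \<in> U0" "f \<in> \<R> U0" using f unfolding regular_at_iff by blast
    have U: "nopn (U0 \<inter> V)" "x \<in> U0 \<inter> V" using U0 x V by auto
    then obtain s where s: "s \<in> carrier (sect X (U0 \<inter> V))" "f = germ X \<eta> (U0 \<inter> V) s"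
      using regular_mono[of U0 "U0 \<inter> V"] U0 unfolding regular_def by blast
    obtain W a c where W: "opn W" "x \<in> W" "W \<subseteq> U0 \<inter> V" "a \<in> carrier A" "c \<in> carrier A" "\<forall>y\<in>W. c \<notin> \<phi> y"
      and eq: "rst X V W (\<iota> c) \<otimes>\<^bsub>sect X W\<^esub> rst X (U0 \<inter> V) W s = rst X V W (\<iota> a)"
      using chart_frac[OF _ _ s(1) U(2)] U(1) by blast
    have nW: "nopn W" "W \<subseteq> V" using W by auto
    have fW: "f = germ X \<eta> W (rst X (U0 \<inter> V) W s)" using germ_rst[OF U(1) nW(1) W(3) s(1)] s by simp
    have sW: "rst X (U0 \<inter> V) W s \<in> carrier (sect X W)" using rst_closed[OF _ W(1,3) s(1)] U by blast
    have cW: "rst X V W (\<iota> c) \<in> carrier (sect X W)"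
      using rst_closed[OF open_V W(1) nW(2) ring_hom_closed[OF chart_hom W(5)]] .
    have "?j c \<cdot> f = ?j a"
      unfolding jW[OF nW W(4)] jW[OF nW W(5)] fW germ_mult[OF nW(1) cW sW] eq ..
    then show ?thesis using W by blast
  qed
  show "?j a \<in> \<mm> x \<longleftrightarrow> a \<in> \<phi> x" if x: "x \<in> V" and a: "a \<in> carrier A" for x a
  proof -
    have P: "primeideal (\<phi> x) A" using bij_betw_imp_surj_on[OF chart_bij] x by blast
    then interpret P: primeideal "\<phi> x" A .
    have jO: "?j a \<in> \<O> x" using reg[OF a] regular_subset_at[OF open_V x] by blast
    have jc: "?j b \<in> carrier L" if "b \<in> carrier A" for b using ring_hom_closed[OF hom that] .
    show ?thesis
    proof
      assume m: "?j a \<in> \<mm> x"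
      show "a \<in> \<phi> x"
      proof (rule ccontr)
        assume na: "a \<notin> \<phi> x"
        define W where "W = {y \<in> V. a \<notin> \<phi> y}"
        have W: "nopn W" "W \<subseteq> V" "x \<in> W" unfolding W_def using chart_open[OF a] x na by auto
        interpret W: cring "sect X W" using sect_cring W by blast
        have "rst X V W (\<iota> a) \<in> Units (sect X W)"
          by (rule chart_unit[OF _ W(2) a]) (use W in \<open>auto simp: W_def\<close>)
        then obtain b where b: "b \<in> carrier (sect X W)" "rst X V W (\<iota> a) \<otimes>\<^bsub>sect X W\<^esub> b = \<one>\<^bsub>sect X W\<^esub>"
          and aW: "rst X V W (\<iota> a) \<in> carrier (sect X W)"
          unfolding W.Units_iff by blast
        have "?j a \<cdot> germ X \<eta> W b = \<one>\<^bsub>L\<^esub>"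
          unfolding jW[OF W(1,2) a] germ_mult[OF W(1) aW b(1)] b(2) germ_one[OF W(1)] ..
        moreover have "germ X \<eta> W b \<in> \<O> x" unfolding regular_at_iff regular_def using W b by blast
        ultimately show False using m max_ideal_iff by blast
      qed
    next
      \<comment> \<open>An inverse of \<open>?j a\<close> would be a fraction b/c with c outside
        \<open>\<phi> x\<close>, and then c - b a would be killed by some u outside
        \<open>\<phi> x\<close>. Primality would put c - b a, and hence c, into
        \<open>\<phi> x\<close>.\<close>
      assume ax: "a \<in> \<phi> x"
      show "?j a \<in> \<mm> x"
      proof (rule ccontr)
        assume "?j a \<notin> \<mm> x"
        then obtain g where g: "g \<in> \<O> x" "?j a \<cdot> g = \<one>\<^bsub>L\<^esub>" using jO max_ideal_iff by blast
        have gc: "g \<in> carrier L" using g regular_at_closed(1) by blast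
        obtain b c where bc: "b \<in> carrier A" "c \<in> carrier A" "c \<notin> \<phi> x" "?j c \<cdot> g = ?j b"
          using frac[OF x g(1)] by blast
        have "?j c = ?j c \<cdot> (?j a \<cdot> g)" using g(2) jc[OF bc(2)] by simp
        also have "\<dots> = (?j c \<cdot> g) \<cdot> ?j a" using jc[OF bc(2)] jc[OF a] gc by (simp add: L.m_ac)
        also have "\<dots> = ?j (b \<otimes>\<^bsub>A\<^esub> a)" unfolding bc(4) using ring_hom_mult[OF hom bc(1) a] by simp
        finally have "\<iota> c = \<iota> (b \<otimes>\<^bsub>A\<^esub> a)" 
          unfolding chart_fun_def using germ_inj[OF V] ring_hom_closed[OF chart_hom] bc a by simp
        interpret V: cring "sect X V" by (rule sect_cring[OF open_V])
        interpret h: ring_hom_cring A "sect X V" \<iota>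
          by (rule ring_hom_cring_of[OF A.is_cring V.is_cring chart_hom])
        have "\<iota> (c \<ominus>\<^bsub>A\<^esub> b \<otimes>\<^bsub>A\<^esub> a) = \<zero>\<^bsub>sect X V\<^esub>"
          unfolding a_minus_def using \<open>\<iota> c = \<iota> (b \<otimes>\<^bsub>A\<^esub> a)\<close> bc a
          by (metis A.a_inv_closed A.m_closed V.r_neg h.hom_a_inv h.hom_add h.hom_closed)
        then obtain u where u: "u \<in> carrier A - \<phi> x" "u \<otimes>\<^bsub>A\<^esub> (c \<ominus>\<^bsub>A\<^esub> b \<otimes>\<^bsub>A\<^esub> a) = \<zero>\<^bsub>A\<^esub>"
          using chart_zero[OF open_V order_refl _ _ x, of "c \<ominus>\<^bsub>A\<^esub> b \<otimes>\<^bsub>A\<^esub> a"]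
            rst_self[OF open_V, of "\<iota> (c \<ominus>\<^bsub>A\<^esub> b \<otimes>\<^bsub>A\<^esub> a)"] bc a by auto
        then have "c \<ominus>\<^bsub>A\<^esub> b \<otimes>\<^bsub>A\<^esub> a \<in> \<phi> x"
          using P.I_prime[of u "c \<ominus>\<^bsub>A\<^esub> b \<otimes>\<^bsub>A\<^esub> a"] bc a by auto
        moreover have "b \<otimes>\<^bsub>A\<^esub> a \<in> \<phi> x" using P.I_l_closed ax bc by blast
        ultimately have "(c \<ominus>\<^bsub>A\<^esub> b \<otimes>\<^bsub>A\<^esub> a) \<oplus>\<^bsub>A\<^esub> b \<otimes>\<^bsub>A\<^esub> a \<in> \<phi> x" by (rule P.a_closed)
        moreover have "(c \<ominus>\<^bsub>A\<^esub> b \<otimes>\<^bsub>A\<^esub> a) \<oplus>\<^bsub>A\<^esub> b \<otimes>\<^bsub>A\<^esub> a = c"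
          using bc a by (simp add: a_minus_def A.a_assoc A.l_neg)
        ultimately show False using bc by simp
      qed
    qed
  qed
qed

text \<open>\<open>max_ideal\<close> is defined by nonunits, so closure under addition says that the
  ring is local. It is inherited from the prime \<open>\<phi> x\<close> of a chart after
  multiplication by the common denominator of \<open>f\<close> and \<open>g\<close>.\<close>

lemma max_ideal_add:
  assumes "x \<in> points X" "f \<in> \<mm> x" "g \<in> \<mm> x"
  shows "f \<boxplus> g \<in> \<mm> x"
proof -
  obtain V A \<phi> \<iota> where V: "x \<in> V" and ch: "affine_chart X V A \<phi> \<iota>" by (rule chart[OF assms(1)])
  then interpret affine_chart X V A \<phi> \<iota> by blast
  have ne: "V \<noteq> {}" using V by blast
  note cf = chart_facts[OF ch ne]
  let ?j = "chart_fun V \<iota>"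
  have P: "primeideal (\<phi> x) A" using bij_betw_imp_surj_on[OF chart_bij] V by blast
  then interpret P: primeideal "\<phi> x" A .
  have jO: "?j a \<in> \<O> x" "?j a \<in> carrier L" if "a \<in> carrier A" for a
    using cf(2)[OF that] regular_subset_at[OF open_V V] regular_at_closed(1) by auto
  have fO: "f \<in> \<O> x" "g \<in> \<O> x" using assms max_ideal_iff by auto
  have fc: "f \<in> carrier L" "g \<in> carrier L" using fO regular_at_closed(1) by auto
  obtain b c where bc: "b \<in> carrier A" "c \<in> carrier A" "c \<notin> \<phi> x" "?j c \<cdot> f = ?j b"
    using cf(3)[OF V fO(1)] by blast
  obtain e d where de: "e \<in> carrier A" "d \<in> carrier A" "d \<notin> \<phi> x" "?j d \<cdot> g = ?j e"
    using cf(3)[OF V fO(2)] by blast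
  have "?j b \<in> \<mm> x" "?j e \<in> \<mm> x"
    using bc de max_ideal_mult_iff[OF jO(1)[OF bc(2)] fO(1) assms(1)] 
       max_ideal_mult_iff[OF jO(1)[OF de(2)] fO(2) assms(1)] assms by auto
  then have "b \<in> \<phi> x" "e \<in> \<phi> x" using cf(4)[OF V] bc de by auto
  then have "d \<otimes>\<^bsub>A\<^esub> b \<oplus>\<^bsub>A\<^esub> c \<otimes>\<^bsub>A\<^esub> e \<in> \<phi> x" using bc de P.I_l_closed P.a_closed by blast
  then have m: "?j (d \<otimes>\<^bsub>A\<^esub> b \<oplus>\<^bsub>A\<^esub> c \<otimes>\<^bsub>A\<^esub> e) \<in> \<mm> x" using cf(4)[OF V] bc de by simp
  interpret h: ring_hom_cring A L ?j
    by (rule ring_hom_cring_of[OF A.is_cring L_cring cf(1)])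
  have "(?j c \<cdot> ?j d) \<cdot> (f \<boxplus> g) = ?j d \<cdot> (?j c \<cdot> f) \<boxplus> ?j c \<cdot> (?j d \<cdot> g)"
    using jO[OF bc(2)] jO[OF de(2)] fc by (simp add: L.r_distr L.l_distr L.m_ac)
  also have "\<dots> = ?j (d \<otimes>\<^bsub>A\<^esub> b \<oplus>\<^bsub>A\<^esub> c \<otimes>\<^bsub>A\<^esub> e)" unfolding bc(4) de(4) using bc de by simp
  finally have "(?j c \<cdot> ?j d) \<cdot> (f \<boxplus> g) \<in> \<mm> x" using m by simp
  moreover have "?j c \<cdot> ?j d \<in> \<O> x" "f \<boxplus> g \<in> \<O> x" using regular_at_closed(4,5) jO bc de fO by blast+
  ultimately have "?j c \<cdot> ?j d \<in> \<mm> x \<or> f \<boxplus> g \<in> \<mm> x"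
    using max_ideal_mult_iff assms(1) by blast
  moreover have "?j c \<notin> \<mm> x" "?j d \<notin> \<mm> x" using cf(4)[OF V] bc de by auto
  ultimately show ?thesis using max_ideal_mult_iff[OF jO(1)[OF bc(2)] jO(1)[OF de(2)] assms(1)] by blast
qed

lemma aff_nopn: "affine_open X V \<Longrightarrow> x \<in> V \<Longrightarrow> nopn V"
  unfolding affine_open_def by blast

lemma aff_frac:
  assumes aff: "affine_open X V" and x: "x \<in> V" and f: "f \<in> \<O> x"
  obtains b c where "b \<in> \<R> V" "c \<in> \<R> V" "c \<notin> \<mm> x" "c \<cdot> f = b"
proof -
  obtain A \<phi> \<iota> where ch: "affine_chart X V A \<phi> \<iota>" by (rule affine_chart_exists[OF ringedX aff])
  have ne: "V \<noteq> {}" using x by blast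
  note cf = chart_facts[OF ch ne]
  obtain b c where bc: "b \<in> carrier A" "c \<in> carrier A" "c \<notin> \<phi> x" 
    "chart_fun V \<iota> c \<cdot> f = chart_fun V \<iota> b" using cf(3)[OF x f] by blast
  show thesis by (rule that[OF cf(2)[OF bc(1)] cf(2)[OF bc(2)] _ bc(4)]) (use cf(4)[OF x bc(2)] bc(3) in blast)
qed

lemma aff_basis:
  assumes aff: "affine_open X V" and x: "x \<in> V" and U: "opn U" "x \<in> U"
  obtains g where "g \<in> \<R> V" "g \<notin> \<mm> x" "{y \<in> V. g \<notin> \<mm> y} \<subseteq> U"
proof -
  obtain A \<phi> \<iota> where ch: "affine_chart X V A \<phi> \<iota>" by (rule affine_chart_exists[OF ringedX aff])
  then interpret affine_chart X V A \<phi> \<iota> .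
  have ne: "V \<noteq> {}" using x by blast
  note cf = chart_facts[OF ch ne]
  obtain a where a: "a \<in> carrier A" "a \<notin> \<phi> x" "{y \<in> V. a \<notin> \<phi> y} \<subseteq> U"
    using chart_basis[OF U x] by (elim bexE conjE)
  show thesis
    by (rule that[OF cf(2)[OF a(1)]]) (use cf(4)[OF _ a(1)] a(2,3) x in auto)
qed

text \<open>The primes of the ring of functions on \<open>V\<close> come from points. This produces
  both homes (functions of infinite value) and centers (functions of positive value). The preimage
  of \<open>P\<close> in \<open>A\<close> is a prime, hence some \<open>\<phi> x\<close>.\<close>

lemma aff_prime:
  assumes aff: "affine_open X V" and ne: "V \<noteq> {}"
    and P: "P \<subseteq> \<R> V" "\<zero>\<^bsub>L\<^esub> \<in> P" "\<one>\<^bsub>L\<^esub> \<notin> P"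
    and add: "\<And>f g. f \<in> P \<Longrightarrow> g \<in> P \<Longrightarrow> f \<boxplus> g \<in> P"
    and mult: "\<And>f g. f \<in> \<R> V \<Longrightarrow> g \<in> \<R> V \<Longrightarrow> f \<cdot> g \<in> P \<longleftrightarrow> f \<in> P \<or> g \<in> P"
  obtains x where "x \<in> V" "\<And>f. f \<in> \<R> V \<Longrightarrow> f \<in> P \<longleftrightarrow> f \<in> \<mm> x"
proof -
  obtain A \<phi> \<iota> where ch: "affine_chart X V A \<phi> \<iota>" by (rule affine_chart_exists[OF ringedX aff])
  then interpret affine_chart X V A \<phi> \<iota> .
  note cf = chart_facts[OF ch ne]
  have V: "nopn V" using ne open_V by blast
  let ?j = "chart_fun V \<iota>"
  interpret h: ring_hom_cring A L ?j
    by (rule ring_hom_cring_of[OF A.is_cring L_cring cf(1)])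
  define Q where "Q = {a \<in> carrier A. ?j a \<in> P}"
  have neg: "\<ominus>\<^bsub>L\<^esub> f \<in> P" if "f \<in> P" for f
  proof -
    have f: "f \<in> \<R> V" "f \<in> carrier L" using that P regular_closed(1)[OF V] by auto
    have "\<ominus>\<^bsub>L\<^esub> \<one>\<^bsub>L\<^esub> \<in> \<R> V" using regular_closed[OF V] by blast
    then have "\<ominus>\<^bsub>L\<^esub> \<one>\<^bsub>L\<^esub> \<cdot> f \<in> P" using mult that f by blast
    then show ?thesis using f by (simp add: L.l_minus)
  qed
  have "ideal Q A"
  proof (rule idealI[OF A.ring_axioms])
    show "subgroup Q (add_monoid A)"
    proof (rule A.add.subgroupI)
      show "Q \<subseteq> carrier A" "Q \<noteq> {}" unfolding Q_def using P(2) by auto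
      show "\<ominus>\<^bsub>A\<^esub> a \<in> Q" if "a \<in> Q" for a using that neg unfolding Q_def by simp
      show "a \<oplus>\<^bsub>A\<^esub> b \<in> Q" if "a \<in> Q" "b \<in> Q" for a b using that add unfolding Q_def by simp
    qed
    show "b \<otimes>\<^bsub>A\<^esub> a \<in> Q" "a \<otimes>\<^bsub>A\<^esub> b \<in> Q" if "a \<in> Q" "b \<in> carrier A" for a b
      using that mult[of "?j a" "?j b"] mult[of "?j b" "?j a"] cf(2) unfolding Q_def by auto
  qed
  then have "primeideal Q A"
  proof (rule primeidealI[OF _ A.is_cring])
    show "carrier A \<noteq> Q" using P(3) unfolding Q_def by force
    show "a \<in> Q \<or> b \<in> Q" if "a \<in> carrier A" "b \<in> carrier A" "a \<otimes>\<^bsub>A\<^esub> b \<in> Q" for a b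
      using that mult[of "?j a" "?j b"] cf(2) unfolding Q_def by auto
  qed
  then have "Q \<in> \<phi> ` V" using bij_betw_imp_surj_on[OF chart_bij] by simp
  then obtain x where x: "Q = \<phi> x" "x \<in> V" by (rule imageE)
  have xX: "x \<in> points X" using x open_V openin_subset by blast
  show thesis
  proof (rule that[OF x(2)])
    fix f assume f: "f \<in> \<R> V"
    have fO: "f \<in> \<O> x" using f regular_subset_at[OF open_V x(2)] by blast
    obtain b c where bc: "b \<in> carrier A" "c \<in> carrier A" "c \<notin> \<phi> x" "?j c \<cdot> f = ?j b"
      using cf(3)[OF x(2) fO] by blast
    have cO: "?j c \<in> \<O> x" using cf(2)[OF bc(2)] regular_subset_at[OF open_V x(2)] by blast
    \<comment> \<open>A function on \<open>V\<close> is not assumed to come from \<open>A\<close>.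
      It is tested through c f = b with b and c from \<open>A\<close> and c neither in
      \<open>P\<close> nor in \<open>\<mm> x\<close>.\<close>
    have "f \<in> P \<longleftrightarrow> ?j c \<cdot> f \<in> P" 
      using mult[OF cf(2)[OF bc(2)] f] bc(2,3) unfolding x(1)[symmetric] Q_def by blast
    also have "\<dots> \<longleftrightarrow> b \<in> \<phi> x" unfolding bc(4) x(1)[symmetric] Q_def using bc(1) by blast
    also have "\<dots> \<longleftrightarrow> ?j c \<cdot> f \<in> \<mm> x" unfolding bc(4) using cf(4)[OF x(2) bc(1)] by blast
    also have "\<dots> \<longleftrightarrow> f \<in> \<mm> x" using max_ideal_mult_iff[OF cO fO xX] cf(4)[OF x(2) bc(2)] bc(3) by blast
    finally show "f \<in> P \<longleftrightarrow> f \<in> \<mm> x" .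
  qed
qed

lemma pt_closure_iff: "z \<in> pt_closure X x \<longleftrightarrow> z \<in> points X \<and> (\<forall>U. opn U \<longrightarrow> z \<in> U \<longrightarrow> x \<in> U)"
  unfolding pt_closure_def by (rule closure_singleton)

lemma pt_closure_O: "z \<in> pt_closure X x \<Longrightarrow> \<O> z \<subseteq> \<O> x"
  unfolding pt_closure_iff regular_at_def by blast

text \<open>An inverse of \<open>f\<close> at z is also an inverse in the larger local ring at
  x.\<close>

lemma pt_closure_max: "z \<in> pt_closure X x \<Longrightarrow> f \<in> \<O> z \<Longrightarrow> f \<in> \<mm> x \<Longrightarrow> f \<in> \<mm> z"
  unfolding max_ideal_iff using pt_closure_O by blast

text \<open>A basic neighbourhood of z that missed x would be given by a function on
  \<open>V\<close> vanishing at x but not at z.\<close>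

lemma aff_closure:
  assumes aff: "affine_open X V" and z: "z \<in> V"
    and sub: "\<And>f. f \<in> \<R> V \<Longrightarrow> f \<in> \<mm> x \<Longrightarrow> f \<in> \<mm> z" and x: "x \<in> V"
  shows "z \<in> pt_closure X x"
  unfolding pt_closure_iff
proof (intro conjI allI impI)
  show "z \<in> points X" using aff_nopn[OF aff z] z openin_subset by blast
  fix U assume U: "opn U" "z \<in> U"
  obtain g where g: "g \<in> \<R> V" "g \<notin> \<mm> z" "{y \<in> V. g \<notin> \<mm> y} \<subseteq> U" using aff_basis[OF aff z U] .
  then show "x \<in> U" using sub x by blast
qed

text \<open>Each of the two points lies in the closure of the other, which \<open>T0\<close> allows
  only for equal points.\<close>

lemma aff_inj:
  assumes aff: "affine_open X V" and xy: "x \<in> V" "y \<in> V"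
    and eq: "\<And>f. f \<in> \<R> V \<Longrightarrow> f \<in> \<mm> x \<longleftrightarrow> f \<in> \<mm> y"
  shows "x = y"
proof (rule ccontr)
  assume "x \<noteq> y"
  have "x \<in> pt_closure X y" "y \<in> pt_closure X x" using aff_closure[OF aff] xy eq by blast+
  then show False using T0[OF _ _ \<open>x \<noteq> y\<close>] unfolding pt_closure_iff by metis
qed

end

section \<open>Semivaluations and their centers\<close>

context integral_space begin

lemma local_ring_simps [simp]:
  "carrier (local_ring X x) = \<O> x" "mult (local_ring X x) = mult L" "add (local_ring X x) = add L"
  "one (local_ring X x) = one L" "zero (local_ring X x) = zero L"
  unfolding local_ring_def by simp_all

lemma local_ring_cring: "x \<in> points X \<Longrightarrow> cring (local_ring X x)"
  unfolding local_ring_def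
proof -
  assume x: "x \<in> points X"
  have "subring (\<O> x) L"
    by (rule L.subringI[OF regular_at_closed(1) regular_at_closed(2)[OF x] regular_at_closed(6) regular_at_closed(5) regular_at_closed(4)])
  then have "subcring (\<O> x) L" by (rule L.subcringI')
  then show "cring (L\<lparr>carrier := \<O> x\<rparr>)" using L.subcring_iff[OF regular_at_closed(1)] by blast
qed

lemma max_ideal_closed:
  assumes "x \<in> points X"
  shows "\<mm> x \<subseteq> \<O> x" "\<zero>\<^bsub>L\<^esub> \<in> \<mm> x" "f \<in> \<mm> x \<Longrightarrow> \<ominus>\<^bsub>L\<^esub> f \<in> \<mm> x"
    "f \<in> \<O> x \<Longrightarrow> g \<in> \<mm> x \<Longrightarrow> f \<cdot> g \<in> \<mm> x"
proof -
  show "\<mm> x \<subseteq> \<O> x" unfolding max_ideal_def by blast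
  show "\<zero>\<^bsub>L\<^esub> \<in> \<mm> x" unfolding max_ideal_iff
    using regular_at_closed(1)[of x] regular_at_closed(3)[OF assms] by (auto simp: subset_iff)
  show m: "f \<cdot> g \<in> \<mm> x" if "f \<in> \<O> x" "g \<in> \<mm> x" for f g
    using max_ideal_mult_iff[OF that(1) _ assms] that max_ideal_iff by blast
  have "\<ominus>\<^bsub>L\<^esub> \<one>\<^bsub>L\<^esub> \<in> \<O> x" using regular_at_closed(2,6) assms by blast
  then have "f \<in> \<mm> x \<Longrightarrow> \<ominus>\<^bsub>L\<^esub> \<one>\<^bsub>L\<^esub> \<cdot> f \<in> \<mm> x" by (rule m)
  then show "f \<in> \<mm> x \<Longrightarrow> \<ominus>\<^bsub>L\<^esub> f \<in> \<mm> x" using max_ideal_carr[of f x] by (simp add: L.l_minus)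
qed

lemma max_ideal_ideal:
  assumes x: "x \<in> points X" shows "ideal (\<mm> x) (local_ring X x)"
proof -
  interpret R: cring "local_ring X x" by (rule local_ring_cring[OF x])
  show ?thesis
  proof (rule idealI[OF R.ring_axioms])
    \<comment> \<open>Negatives depend on the carrier of a ring record; the one of
      \<open>local_ring X x\<close> is identified with an element of \<open>L\<close> by its
      defining equation.\<close>
    have inv: "\<exists>g\<in>\<mm> x. g \<boxplus> f = \<zero>\<^bsub>L\<^esub>" if "f \<in> \<mm> x" for f
      using max_ideal_closed(3)[OF x that] max_ideal_carr[OF that] L.l_neg by blast
    show "subgroup (\<mm> x) (add_monoid (local_ring X x))"
    proof (rule R.add.subgroupI)
      show "\<mm> x \<subseteq> carrier (local_ring X x)" using max_ideal_closed(1)[OF x] by simp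
      show "\<mm> x \<noteq> {}" using max_ideal_closed(2)[OF x] by blast
      show "f \<oplus>\<^bsub>local_ring X x\<^esub> g \<in> \<mm> x" if "f \<in> \<mm> x" "g \<in> \<mm> x" for f g
        using max_ideal_add[OF x that] by simp
      show "\<ominus>\<^bsub>local_ring X x\<^esub> f \<in> \<mm> x" if f: "f \<in> \<mm> x" for f
      proof -
        obtain g where g: "g \<in> \<mm> x" "g \<boxplus> f = \<zero>\<^bsub>L\<^esub>" using inv f by blast
        have "\<ominus>\<^bsub>local_ring X x\<^esub> f = g"
          by (rule R.minus_equality) (use g f max_ideal_closed(1)[OF x] in auto)
        then show ?thesis using g by simp
      qed
    qed
    show "a \<otimes>\<^bsub>local_ring X x\<^esub> f \<in> \<mm> x" "f \<otimes>\<^bsub>local_ring X x\<^esub> a \<in> \<mm> x"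
      if "f \<in> \<mm> x" "a \<in> carrier (local_ring X x)" for f a
      using max_ideal_closed(4)[OF x, of a f] that L.m_comm max_ideal_carr[OF that(1)] regular_at_closed(1)[of x]
      by (auto simp: subset_iff)
  qed
qed

lemma residue_hom: "x \<in> points X \<Longrightarrow> residue X x \<in> ring_hom (local_ring X x) (residue_field X x)"
  using ideal.rcos_ring_hom[OF max_ideal_ideal] unfolding residue_field_def residue_def .

lemma residue_cring: "x \<in> points X \<Longrightarrow> cring (residue_field X x)"
  unfolding residue_field_def using ideal.quotient_is_cring[OF max_ideal_ideal local_ring_cring] .

lemma carrier_residue: "carrier (residue_field X x) = residue X x ` \<O> x"
  unfolding residue_field_def FactRing_def A_RCOSETS_def' residue_def by auto

lemma zero_residue: "\<zero>\<^bsub>residue_field X x\<^esub> = \<mm> x"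
  unfolding residue_field_def FactRing_def by simp

lemma residue_mult: "x \<in> points X \<Longrightarrow> f \<in> \<O> x \<Longrightarrow> g \<in> \<O> x \<Longrightarrow>
    residue X x (f \<cdot> g) = residue X x f \<otimes>\<^bsub>residue_field X x\<^esub> residue X x g"
  using ring_hom_mult[OF residue_hom] by simp

lemma residue_add: "x \<in> points X \<Longrightarrow> f \<in> \<O> x \<Longrightarrow> g \<in> \<O> x \<Longrightarrow>
    residue X x (f \<boxplus> g) = residue X x f \<oplus>\<^bsub>residue_field X x\<^esub> residue X x g"
  using ring_hom_add[OF residue_hom] by simp

lemma residue_set: "residue X x f = {m \<boxplus> f | m. m \<in> \<mm> x}"
  unfolding residue_def a_r_coset_def r_coset_def by auto

lemma residue_self:
  assumes "x \<in> points X" "f \<in> carrier L" shows "f \<in> residue X x f"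
proof -
  have "f = \<zero>\<^bsub>L\<^esub> \<boxplus> f" using assms by simp
  then show ?thesis unfolding residue_set using max_ideal_closed(2)[OF assms(1)] by blast
qed

lemma residue_eq_iff:
  assumes x: "x \<in> points X" and f: "f \<in> \<O> x" "g \<in> \<O> x"
  shows "residue X x f = residue X x g \<longleftrightarrow> (\<exists>m\<in>\<mm> x. f = m \<boxplus> g)"
proof
  assume "residue X x f = residue X x g"
  moreover have "f \<in> residue X x f" using residue_self[OF x] f(1) regular_at_closed(1) by blast
  ultimately show "\<exists>m\<in>\<mm> x. f = m \<boxplus> g" unfolding residue_set[of x g] by auto
next
  interpret K: cring "residue_field X x" by (rule residue_cring[OF x])
  assume "\<exists>m\<in>\<mm> x. f = m \<boxplus> g"
  then obtain m where m: "m \<in> \<mm> x" "f = m \<boxplus> g" by blast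
  have mO: "m \<in> \<O> x" using m max_ideal_closed(1)[OF x] by blast
  interpret R: cring "local_ring X x" by (rule local_ring_cring[OF x])
  have "residue X x m = \<mm> x" unfolding residue_def
  proof (rule abelian_subgroup.a_rcos_const)
    interpret I: ideal "\<mm> x" "local_ring X x" by (rule max_ideal_ideal[OF x])
    show "abelian_subgroup (\<mm> x) (local_ring X x)" by (rule I.abelian_subgroup_axioms)
    show "m \<in> \<mm> x" by fact
  qed
  then have "residue X x m = \<zero>\<^bsub>residue_field X x\<^esub>" by (simp add: zero_residue)
  moreover have "residue X x g \<in> carrier (residue_field X x)" unfolding carrier_residue using f by blast
  ultimately show "residue X x f = residue X x g" unfolding m(2) residue_add[OF x mO f(2)] by simp
qed

lemma residue_zero_iff:
  assumes x: "x \<in> points X" and f: "f \<in> \<O> x"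
  shows "residue X x f = \<zero>\<^bsub>residue_field X x\<^esub> \<longleftrightarrow> f \<in> \<mm> x"
proof -
  note z = regular_at_closed(3)[OF x]
  interpret R: cring "local_ring X x" by (rule local_ring_cring[OF x])
  interpret K: cring "residue_field X x" by (rule residue_cring[OF x])
  have 0: "residue X x \<zero>\<^bsub>L\<^esub> = \<zero>\<^bsub>residue_field X x\<^esub>"
    using ring_hom_zero[OF residue_hom[OF x] R.ring_axioms K.ring_axioms] by simp
  have "residue X x f = residue X x \<zero>\<^bsub>L\<^esub> \<longleftrightarrow> f \<in> \<mm> x"
    unfolding residue_eq_iff[OF x f z] using max_ideal_carr L.r_zero by (metis (full_types))
  then show ?thesis unfolding 0 .
qed

section \<open>Semivaluations as functions on local rings, and centers\<close>

abbreviation sval (\<open>\<nu>\<close>) where "\<nu> \<equiv> semival_at X"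

text \<open>The pullback to \<open>\<O> x\<close> of a valuation on the residue field. Working with
  it avoids cosets, and the existence of a center is kept as a separate condition.\<close>

definition semivaluation :: "'a \<Rightarrow> (('a, 'b) rat_fun \<Rightarrow> ereal) \<Rightarrow> bool" where
  "semivaluation x v \<longleftrightarrow> x \<in> points X \<and>
     (\<forall>f\<in>\<O> x. v f \<noteq> -\<infinity> \<and> (v f = \<infinity> \<longleftrightarrow> f \<in> \<mm> x)) \<and>
     (\<forall>f\<in>\<O> x. \<forall>g\<in>\<O> x. v (f \<cdot> g) = v f + v g \<and> min (v f) (v g) \<le> v (f \<boxplus> g))"

lemma semivaluation_one:
  assumes "semivaluation x v" shows "v \<one>\<^bsub>L\<^esub> = 0" "v (\<ominus>\<^bsub>L\<^esub> \<one>\<^bsub>L\<^esub>) = 0"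
proof -
  have x: "x \<in> points X" using assms unfolding semivaluation_def by blast
  have o: "\<one>\<^bsub>L\<^esub> \<in> \<O> x" "\<ominus>\<^bsub>L\<^esub> \<one>\<^bsub>L\<^esub> \<in> \<O> x" using regular_at_closed(2,6) x by blast+
  have "v \<one>\<^bsub>L\<^esub> = v \<one>\<^bsub>L\<^esub> + v \<one>\<^bsub>L\<^esub>" using assms o unfolding semivaluation_def by (metis L.r_one L.one_closed)
  moreover have "v \<one>\<^bsub>L\<^esub> \<noteq> -\<infinity>" "v \<one>\<^bsub>L\<^esub> \<noteq> \<infinity>" using assms o one_notin_max[OF x] unfolding semivaluation_def by auto
  ultimately show 1: "v \<one>\<^bsub>L\<^esub> = 0" by (cases "v \<one>\<^bsub>L\<^esub>") auto
  have "\<ominus>\<^bsub>L\<^esub> \<one>\<^bsub>L\<^esub> \<cdot> \<ominus>\<^bsub>L\<^esub> \<one>\<^bsub>L\<^esub> = \<one>\<^bsub>L\<^esub>" by (simp add: L.l_minus)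
  then have "v (\<ominus>\<^bsub>L\<^esub> \<one>\<^bsub>L\<^esub>) + v (\<ominus>\<^bsub>L\<^esub> \<one>\<^bsub>L\<^esub>) = 0" using assms o 1 unfolding semivaluation_def by metis
  moreover have "v (\<ominus>\<^bsub>L\<^esub> \<one>\<^bsub>L\<^esub>) \<noteq> -\<infinity>" using assms o unfolding semivaluation_def by auto
  ultimately show "v (\<ominus>\<^bsub>L\<^esub> \<one>\<^bsub>L\<^esub>) = 0" by (cases "v (\<ominus>\<^bsub>L\<^esub> \<one>\<^bsub>L\<^esub>)") auto
qed

lemma semivaluation_minus:
  assumes "semivaluation x v" "f \<in> \<O> x" shows "v (\<ominus>\<^bsub>L\<^esub> f) = v f"
proof -
  have x: "x \<in> points X" using assms unfolding semivaluation_def by blast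
  have "\<ominus>\<^bsub>L\<^esub> \<one>\<^bsub>L\<^esub> \<in> \<O> x" using regular_at_closed(2,6) x by blast
  then have "v (\<ominus>\<^bsub>L\<^esub> \<one>\<^bsub>L\<^esub> \<cdot> f) = v (\<ominus>\<^bsub>L\<^esub> \<one>\<^bsub>L\<^esub>) + v f" using assms unfolding semivaluation_def by blast
  then show ?thesis using semivaluation_one(2)[OF assms(1)] assms(2) regular_at_closed(1)[of x] by (simp add: L.l_minus subset_iff)
qed

text \<open>Elements of \<open>\<mm> x\<close> have value \<infinity>, so the ultrametric
  inequality, applied to f and to m + f, bounds either value by the other. Hence \<open>v\<close>
  descends to the residue field.\<close>

lemma semivaluation_cong:
  assumes v: "semivaluation x v" and m: "m \<in> \<mm> x" and f: "f \<in> \<O> x"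
  shows "v (m \<boxplus> f) = v f"
proof -
  have x: "x \<in> points X" using v unfolding semivaluation_def by blast
  have mO: "m \<in> \<O> x" "\<ominus>\<^bsub>L\<^esub> m \<in> \<O> x" "\<ominus>\<^bsub>L\<^esub> m \<in> \<mm> x" using m max_ideal_closed[OF x] by blast+
  have mf: "m \<boxplus> f \<in> \<O> x" using mO f regular_at_closed(4) by blast
  have inf: "v m = \<infinity>" "v (\<ominus>\<^bsub>L\<^esub> m) = \<infinity>" using v mO m unfolding semivaluation_def by auto
  have "min (v m) (v f) \<le> v (m \<boxplus> f)" using v mO f unfolding semivaluation_def by blast
  moreover have "min (v (\<ominus>\<^bsub>L\<^esub> m)) (v (m \<boxplus> f)) \<le> v (\<ominus>\<^bsub>L\<^esub> m \<boxplus> (m \<boxplus> f))"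
    using v mO mf unfolding semivaluation_def by blast
  moreover have "\<ominus>\<^bsub>L\<^esub> m \<boxplus> (m \<boxplus> f) = f"
    using mO(1) f regular_at_closed(1)[of x] by (simp add: L.r_neg1 subset_iff)
  ultimately show ?thesis unfolding inf by simp
qed

lemma beth_semivaluation:
  assumes "\<zeta> \<in> beth X" shows "semivaluation (home \<zeta>) (\<nu> \<zeta>)"
proof -
  let ?x = "home \<zeta>"
  have x: "?x \<in> points X" and w: "valuation (residue_field X ?x) (fst \<zeta>)"
    using assms unfolding beth_def by auto
  have c: "residue X ?x f \<in> carrier (residue_field X ?x)" if "f \<in> \<O> ?x" for f
    using that unfolding carrier_residue by blast
  show ?thesis unfolding semivaluation_def semival_at_def
    using w c unfolding valuation_def by (simp add: x residue_mult residue_add residue_zero_iff)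
qed

text \<open>Converse to \<open>beth_semivaluation\<close>: \<open>w\<close> evaluates
  \<open>v\<close> on a chosen representative of each coset, and by
  \<open>semivaluation_cong\<close> the choice does not matter.\<close>

lemma beth_exists:
  assumes v: "semivaluation x v" and z: "z \<in> pt_closure X x" "\<And>f. f \<in> \<O> z \<Longrightarrow> 0 \<le> v f"
  obtains \<zeta> where "\<zeta> \<in> beth X" "home \<zeta> = x" "\<And>f. f \<in> \<O> x \<Longrightarrow> \<nu> \<zeta> f = v f"
proof -
  have x: "x \<in> points X" using v unfolding semivaluation_def by blast
  define w where "w = (\<lambda>P\<in>carrier (residue_field X x). v (SOME f. f \<in> \<O> x \<and> residue X x f = P))"
  have w: "w (residue X x f) = v f" if f: "f \<in> \<O> x" for f
  proof -
    let ?g = "SOME g. g \<in> \<O> x \<and> residue X x g = residue X x f"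
    have g: "?g \<in> \<O> x \<and> residue X x ?g = residue X x f" by (rule someI[of _ f]) (use f in blast)
    then obtain m where "m \<in> \<mm> x" "?g = m \<boxplus> f" using residue_eq_iff[OF x _ f] by blast
    then have "v ?g = v f" using semivaluation_cong[OF v _ f] by simp
    then show ?thesis unfolding w_def using f by (simp add: carrier_residue)
  qed
  have "valuation (residue_field X x) w"
    unfolding valuation_def
  proof (intro conjI ballI)
    show "w \<in> extensional (carrier (residue_field X x))" unfolding w_def by simp
    fix a assume "a \<in> carrier (residue_field X x)"
    then obtain f where f: "f \<in> \<O> x" "a = residue X x f" unfolding carrier_residue by blast
    show "w a \<noteq> - \<infinity>" "(w a = \<infinity>) = (a = \<zero>\<^bsub>residue_field X x\<^esub>)"
      using v f w[OF f(1)] residue_zero_iff[OF x f(1)] unfolding semivaluation_def by auto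
    fix b assume "b \<in> carrier (residue_field X x)"
    then obtain g where g: "g \<in> \<O> x" "b = residue X x g" unfolding carrier_residue by blast
    show "w (a \<otimes>\<^bsub>residue_field X x\<^esub> b) = w a + w b" "min (w a) (w b) \<le> w (a \<oplus>\<^bsub>residue_field X x\<^esub> b)"
      using v f g w[OF f(1)] w[OF g(1)] w[OF regular_at_closed(4)[OF f(1) g(1)]] w[OF regular_at_closed(5)[OF f(1) g(1)]]
      unfolding semivaluation_def by (simp_all add: residue_mult[OF x, symmetric] residue_add[OF x, symmetric])
  qed
  moreover have "\<forall>a\<in>sub_regular_at X x z. 0 \<le> w a"
    unfolding sub_regular_at_def using w z pt_closure_O[OF z(1)] by auto
  ultimately have "(w, x) \<in> beth X" unfolding beth_def using x z(1) by blast
  then show thesis by (rule that) (simp_all add: semival_at_def w)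
qed

text \<open>Valuations are required to be extensional, so arguments outside the residue field cannot
  distinguish them.\<close>

lemma beth_eqI:
  assumes "\<zeta> \<in> beth X" "\<xi> \<in> beth X" "home \<zeta> = home \<xi>"
    and eq: "\<And>f. f \<in> \<O> (home \<zeta>) \<Longrightarrow> \<nu> \<zeta> f = \<nu> \<xi> f"
  shows "\<zeta> = \<xi>"
proof -
  have "fst \<zeta> a = fst \<xi> a" for a
  proof (cases "a \<in> carrier (residue_field X (home \<zeta>))")
    case True
    then obtain f where "f \<in> \<O> (home \<zeta>)" "a = residue X (home \<zeta>) f" unfolding carrier_residue by blast
    then show ?thesis using eq assms(3) unfolding semival_at_def by auto
  next
    case False
    then show ?thesis using assms unfolding beth_def valuation_def by (auto simp: extensional_def)
  qed
  then show ?thesis using assms(3) by (simp add: prod_eq_iff fun_eq_iff)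
qed

text \<open>Domination expressed on \<open>\<O> z\<close> rather than on its image in the residue
  field, and as a relation, so that existence and uniqueness can be proved before
  \<open>center\<close> is used.\<close>

definition center_of :: "'a \<Rightarrow> (('a, 'b) rat_fun \<Rightarrow> ereal) \<Rightarrow> 'a \<Rightarrow> bool" where
  "center_of x v z \<longleftrightarrow> z \<in> pt_closure X x \<and> (\<forall>f\<in>\<O> z. 0 \<le> v f \<and> (0 < v f \<longleftrightarrow> f \<in> \<mm> z))"

lemma center_of_iff:
  assumes "\<zeta> \<in> beth X"
  shows "center_of (home \<zeta>) (\<nu> \<zeta>) z \<longleftrightarrow> z \<in> pt_closure X (home \<zeta>) \<and>
     (\<forall>a\<in>sub_regular_at X (home \<zeta>) z. 0 \<le> fst \<zeta> a) \<and>
     {a \<in> sub_regular_at X (home \<zeta>) z. 0 < fst \<zeta> a} = sub_max_ideal X (home \<zeta>) z"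
proof (cases "z \<in> pt_closure X (home \<zeta>)")
  case z: True
  let ?x = "home \<zeta>" and ?v = "\<nu> \<zeta>"
  have x: "?x \<in> points X" using assms unfolding beth_def by auto
  have zX: "z \<in> points X" using z unfolding pt_closure_iff by blast
  have "{a \<in> sub_regular_at X ?x z. 0 < fst \<zeta> a} = sub_max_ideal X ?x z \<longleftrightarrow>
      (\<forall>f\<in>\<O> z. 0 < ?v f \<longleftrightarrow> f \<in> \<mm> z)"
  proof
    assume e: "{a \<in> sub_regular_at X ?x z. 0 < fst \<zeta> a} = sub_max_ideal X ?x z"
    show "\<forall>f\<in>\<O> z. 0 < ?v f \<longleftrightarrow> f \<in> \<mm> z"
    proof (intro ballI iffI)
      fix f assume f: "f \<in> \<O> z"
      { assume "0 < ?v f"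
        then have "residue X ?x f \<in> sub_max_ideal X ?x z"
          unfolding e[symmetric] semival_at_def sub_regular_at_def using f by blast
        then obtain g where g: "g \<in> \<mm> z" "residue X ?x f = residue X ?x g" unfolding sub_max_ideal_def by blast
        have gO: "g \<in> \<O> z" using g max_ideal_closed(1)[OF zX] by blast
        obtain m where m: "m \<in> \<mm> ?x" "f = m \<boxplus> g"
          using g(2) residue_eq_iff[OF x, of f g] pt_closure_O[OF z] f gO by blast
        \<comment> \<open>Two lifts of a residue differ by some m in \<open>\<mm> x\<close>. As a
          difference of elements of \<open>\<O> z\<close> it lies in \<open>\<O> z\<close> too, and
          therefore in \<open>\<mm> z\<close>.\<close>
        have "m = f \<boxplus> \<ominus>\<^bsub>L\<^esub> g" using m max_ideal_carr g(1) by (simp add: L.a_assoc L.r_neg)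
        then have "m \<in> \<O> z" using f gO regular_at_closed(4,6) by blast
        then have "m \<in> \<mm> z" using pt_closure_max[OF z] m by blast
        then show "f \<in> \<mm> z" unfolding m(2) using max_ideal_add[OF zX] g(1) by blast }
      { assume "f \<in> \<mm> z"
        then have "residue X ?x f \<in> sub_max_ideal X ?x z" unfolding sub_max_ideal_def by blast
        then show "0 < ?v f" unfolding e[symmetric] semival_at_def by blast }
    qed
  next
    assume e: "\<forall>f\<in>\<O> z. 0 < ?v f \<longleftrightarrow> f \<in> \<mm> z"
    then show "{a \<in> sub_regular_at X ?x z. 0 < fst \<zeta> a} = sub_max_ideal X ?x z"
      unfolding sub_regular_at_def sub_max_ideal_def semival_at_def using max_ideal_closed(1)[OF zX] by blast
  qed
  then show ?thesis unfolding center_of_def using z unfolding sub_regular_at_def semival_at_def by auto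
qed (simp add: center_of_def)

text \<open>Where \<open>v\<close> is nonnegative, the functions on \<open>V\<close> of positive
  value form a prime, whose point is the center. Functions in \<open>\<mm> x\<close> have infinite
  value and so vanish there, which puts the center into the closure of x.\<close>

lemma semivaluation_center:
  assumes v: "semivaluation x v" and aff: "affine_open X V" and xV: "x \<in> V"
    and nonneg: "\<And>f. f \<in> \<R> V \<Longrightarrow> 0 \<le> v f"
  obtains z where "z \<in> V" "center_of x v z"
proof -
  have V: "nopn V" using aff_nopn[OF aff xV] .
  have RO: "\<R> V \<subseteq> \<O> x" using regular_subset_at V xV by blast
  have x: "x \<in> points X" using v unfolding semivaluation_def by blast
  note vm = v[unfolded semivaluation_def]
  obtain z where z: "z \<in> V" "\<And>f. f \<in> \<R> V \<Longrightarrow> f \<in> {f \<in> \<R> V. 0 < v f} \<longleftrightarrow> f \<in> \<mm> z"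
  proof (rule aff_prime[OF aff, of "{f \<in> \<R> V. 0 < v f}"])
    show "V \<noteq> {}" using V by blast
    have "v \<zero>\<^bsub>L\<^esub> = \<infinity>" using vm max_ideal_closed(1,2)[OF x] by blast
    then show "\<zero>\<^bsub>L\<^esub> \<in> {f \<in> \<R> V. 0 < v f}" using regular_closed(3)[OF V] by simp
    show "\<one>\<^bsub>L\<^esub> \<notin> {f \<in> \<R> V. 0 < v f}" using semivaluation_one(1)[OF v] by simp
    show "f \<boxplus> g \<in> {f \<in> \<R> V. 0 < v f}" if "f \<in> {f \<in> \<R> V. 0 < v f}" "g \<in> {f \<in> \<R> V. 0 < v f}" for f g
    proof -
      have "min (v f) (v g) \<le> v (f \<boxplus> g)" using vm that RO by blast
      moreover have "0 < min (v f) (v g)" using that by simp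
      ultimately have "0 < v (f \<boxplus> g)" by (rule order.strict_trans2[rotated])
      then show ?thesis using that regular_closed(4)[OF V] by blast
    qed
    show "f \<cdot> g \<in> {f \<in> \<R> V. 0 < v f} \<longleftrightarrow> f \<in> {f \<in> \<R> V. 0 < v f} \<or> g \<in> {f \<in> \<R> V. 0 < v f}"
      if f: "f \<in> \<R> V" "g \<in> \<R> V" for f g
    proof -
      have "v (f \<cdot> g) = v f + v g" using vm f RO by blast
      moreover have "0 < v f + v g \<longleftrightarrow> 0 < v f \<or> 0 < v g"
        using nonneg[OF f(1)] nonneg[OF f(2)] add_nonneg_eq_0_iff[of "v f" "v g"] add_nonneg_nonneg[of "v f" "v g"]
        by (simp add: less_le)
      ultimately show ?thesis using f regular_closed(5)[OF V] by simp
    qed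
  qed (auto intro: that)
  have zX: "z \<in> points X" using z V openin_subset by blast
  have zm: "0 < v f \<longleftrightarrow> f \<in> \<mm> z" if "f \<in> \<R> V" for f using z(2)[OF that] that by blast
  have cl: "z \<in> pt_closure X x"
  proof (rule aff_closure[OF aff z(1) _ xV])
    fix f assume f: "f \<in> \<R> V" "f \<in> \<mm> x"
    then have "v f = \<infinity>" using vm RO by blast
    then show "f \<in> \<mm> z" using zm[OF f(1)] by simp
  qed
  show thesis
  proof (rule that[OF z(1)])
    show "center_of x v z" unfolding center_of_def
    proof (intro conjI ballI cl)
      fix f assume f: "f \<in> \<O> z"
      obtain b c where bc: "b \<in> \<R> V" "c \<in> \<R> V" "c \<notin> \<mm> z" "c \<cdot> f = b" using aff_frac[OF aff z(1) f] .
      \<comment> \<open>Denominators at z do not vanish there, so they have value 0 and the sign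
        conditions on \<open>\<O> z\<close> reduce to those on \<open>\<R> V\<close>.\<close>
      have "v c = 0" using zm[OF bc(2)] bc(3) nonneg[OF bc(2)] by (simp add: less_le)
      moreover have "v (c \<cdot> f) = v c + v f" using vm bc(2) RO f pt_closure_O[OF cl] by blast
      ultimately have e: "v f = v b" using bc(4) by simp
      show "0 \<le> v f" using e nonneg bc(1) by simp
      have "c \<in> \<O> z" using bc(2) regular_subset_at V z(1) by blast
      then show "0 < v f \<longleftrightarrow> f \<in> \<mm> z"
        using e zm[OF bc(1)] bc(3,4) max_ideal_mult_iff[OF _ f zX, of c] by simp
    qed
  qed
qed

end

locale separated_space = integral_space +
  assumes separated: "separated_scheme X"
begin

lemma affine_Int: "affine_open X U \<Longrightarrow> affine_open X V \<Longrightarrow> affine_open X (U \<inter> V)"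
  using separated unfolding separated_scheme_def by blast

lemma sect_Int_generated: "affine_open X U \<Longrightarrow> affine_open X V \<Longrightarrow>
  generate_ring (sect X (U \<inter> V)) (rst X U (U \<inter> V) ` carrier (sect X U) \<union> rst X V (U \<inter> V) ` carrier (sect X V)) =
        carrier (sect X (U \<inter> V))"
  using separated unfolding separated_scheme_def by blast

text \<open>By separatedness \<open>v\<close> is nonnegative on \<open>\<O>(U \<inter> U')\<close>, for affine neighbourhoods \<open>U\<close> and \<open>U'\<close> of the two
  centers. Hence there is a center in \<open>U \<inter> U'\<close>, and centers in the same affine open set coincide.\<close>

lemma center_of_unique:
  assumes v: "semivaluation x v" and z: "center_of x v z" "center_of x v z'"
  shows "z = z'"
proof -
  have cl: "z \<in> pt_closure X x" "z' \<in> pt_closure X x" using z unfolding center_of_def by auto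
  have zX: "z \<in> points X" "z' \<in> points X" using cl unfolding pt_closure_iff by auto
  obtain U U' where U: "z \<in> U" "affine_open X U" "z' \<in> U'" "affine_open X U'"
    using zX schemeX unfolding scheme_def by blast
  let ?W = "U \<inter> U'"
  have oU: "opn U" "opn U'" using U unfolding affine_open_def by auto
  have xW: "x \<in> ?W" using cl U oU unfolding pt_closure_iff by blast
  have W: "affine_open X ?W" using affine_Int U by blast
  have nW: "nopn ?W" by (rule aff_nopn[OF W xW])
  have nU: "nopn U" "nopn U'" using oU U by auto
  interpret W: cring "sect X ?W" using sect_cring nW by blast
  interpret h: ring_hom_cring "sect X ?W" L "germ X \<eta> ?W"
    by (rule ring_hom_cring_of[OF W.is_cring L_cring germ_hom[OF nW]])
  have RO: "\<R> ?W \<subseteq> \<O> x" using regular_subset_at nW xW by blast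
  note vm = v[unfolded semivaluation_def]
  let ?G = "rst X U ?W ` carrier (sect X U) \<union> rst X U' ?W ` carrier (sect X U')"
  have Gc: "s \<in> carrier (sect X ?W)" if "s \<in> generate_ring (sect X ?W) ?G" for s
    using that sect_Int_generated[OF U(2,4)] by simp
  have gen: "0 \<le> v (germ X \<eta> ?W s)" if "s \<in> generate_ring (sect X ?W) ?G" for s
    using that
  proof (induction rule: generate_ring.induct)
    case one
    then show ?case using semivaluation_one(1)[OF v] by simp
  next
    case (incl s)
    then have "germ X \<eta> ?W s \<in> \<O> z \<or> germ X \<eta> ?W s \<in> \<O> z'"
    proof
      assume "s \<in> rst X U ?W ` carrier (sect X U)"
      then have "germ X \<eta> ?W s \<in> \<R> U" using germ_rst[OF nU(1) nW] unfolding regular_def by auto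
      then show ?thesis using regular_subset_at oU U by blast
    next
      assume "s \<in> rst X U' ?W ` carrier (sect X U')"
      then have "germ X \<eta> ?W s \<in> \<R> U'" using germ_rst[OF nU(2) nW] unfolding regular_def by auto
      then show ?thesis using regular_subset_at oU U by blast
    qed
    then show ?case using z unfolding center_of_def by blast
  next
    case (a_inv s)
    have "germ X \<eta> ?W s \<in> \<O> x" using Gc[OF a_inv.hyps] RO unfolding regular_def by blast
    then show ?case using a_inv.IH semivaluation_minus[OF v] Gc[OF a_inv.hyps] by simp
  next
    case (eng_add s t)
    have O: "germ X \<eta> ?W s \<in> \<O> x" "germ X \<eta> ?W t \<in> \<O> x" using Gc[OF eng_add.hyps(1)] Gc[OF eng_add.hyps(2)] RO unfolding regular_def by blast+
    then have "min (v (germ X \<eta> ?W s)) (v (germ X \<eta> ?W t)) \<le> v (germ X \<eta> ?W s \<boxplus> germ X \<eta> ?W t)" using vm by blast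
    moreover have "0 \<le> min (v (germ X \<eta> ?W s)) (v (germ X \<eta> ?W t))" using eng_add.IH by simp
    ultimately have "0 \<le> v (germ X \<eta> ?W s \<boxplus> germ X \<eta> ?W t)" by (rule order_trans[rotated])
    then show ?case using Gc[OF eng_add.hyps(1)] Gc[OF eng_add.hyps(2)] by simp
  next
    case (eng_mult s t)
    have O: "germ X \<eta> ?W s \<in> \<O> x" "germ X \<eta> ?W t \<in> \<O> x" using Gc[OF eng_mult.hyps(1)] Gc[OF eng_mult.hyps(2)] RO unfolding regular_def by blast+
    then have "v (germ X \<eta> ?W s \<cdot> germ X \<eta> ?W t) = v (germ X \<eta> ?W s) + v (germ X \<eta> ?W t)" using vm by blast
    then have "0 \<le> v (germ X \<eta> ?W s \<cdot> germ X \<eta> ?W t)"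
      using eng_mult.IH add_nonneg_nonneg by simp
    then show ?case using Gc[OF eng_mult.hyps(1)] Gc[OF eng_mult.hyps(2)] by simp
  qed
  have nonneg: "0 \<le> v f" if "f \<in> \<R> ?W" for f
    using that gen unfolding sect_Int_generated[OF U(2,4)] regular_def by blast
  obtain y where y: "y \<in> ?W" "center_of x v y"
    by (rule semivaluation_center[OF v W xW nonneg])
  have same: "y = u" if u: "u \<in> T" "center_of x v u" and T: "affine_open X T" "y \<in> T" for u T
  proof (rule aff_inj[OF T u(1)])
    fix f assume "f \<in> \<R> T"
    then have "f \<in> \<O> y" "f \<in> \<O> u" using regular_subset_at T u unfolding affine_open_def by blast+
    then show "f \<in> \<mm> y \<longleftrightarrow> f \<in> \<mm> u" using y(2) u(2) unfolding center_of_def by blast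
  qed
  show ?thesis using same[OF U(1) z(1) U(2)] same[OF U(3) z(2) U(4)] y by blast
qed

text \<open>\<open>beth\<close> only asks for a point at whose local ring the valuation is
  nonnegative. An affine neighbourhood of that point contains a dominated one, and
  \<open>center_of_unique\<close> justifies the definite description.\<close>

lemma center_props:
  assumes \<zeta>: "\<zeta> \<in> beth X"
  shows "center_of (home \<zeta>) (\<nu> \<zeta>) (center X \<zeta>)"
    and "center_of (home \<zeta>) (\<nu> \<zeta>) z \<Longrightarrow> center X \<zeta> = z"
proof -
  note v = beth_semivaluation[OF \<zeta>]
  obtain z0 where z0: "z0 \<in> pt_closure X (home \<zeta>)" "\<forall>a\<in>sub_regular_at X (home \<zeta>) z0. 0 \<le> fst \<zeta> a"
    using \<zeta> unfolding beth_def by auto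
  then have "z0 \<in> points X" unfolding pt_closure_iff by blast
  then obtain V where V: "z0 \<in> V" "affine_open X V" using schemeX unfolding scheme_def by blast
  have oV: "opn V" using V unfolding affine_open_def by blast
  have xV: "home \<zeta> \<in> V" using z0(1) V oV unfolding pt_closure_iff by blast
  have "0 \<le> \<nu> \<zeta> f" if "f \<in> \<R> V" for f
    using z0(2) regular_subset_at[OF oV V(1)] that unfolding sub_regular_at_def semival_at_def by blast
  then obtain y where y: "center_of (home \<zeta>) (\<nu> \<zeta>) y"
    using semivaluation_center[OF v V(2) xV] by blast
  have c: "center X \<zeta> = z" if z: "center_of (home \<zeta>) (\<nu> \<zeta>) z" for z
    unfolding center_def center_of_iff[OF \<zeta>, symmetric]
    by (rule the_equality, rule z) (rule center_of_unique[OF v _ z])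
  show "center_of (home \<zeta>) (\<nu> \<zeta>) (center X \<zeta>)" using c[OF y] y by simp
  show "center_of (home \<zeta>) (\<nu> \<zeta>) z \<Longrightarrow> center X \<zeta> = z" by (rule c)
qed

text \<open>A neighbourhood of the center also contains the home. Conversely, nonnegativity on
  \<open>V\<close> yields a center inside \<open>V\<close>, which is the center by
  uniqueness.\<close>

lemma beth_on_iff:
  assumes "affine_open X V"
  shows "\<zeta> \<in> beth_on X V \<longleftrightarrow> \<zeta> \<in> beth X \<and> home \<zeta> \<in> V \<and> (\<forall>f\<in>\<R> V. 0 \<le> \<nu> \<zeta> f)"
proof
  have oV: "opn V" using assms unfolding affine_open_def by blast
  assume "\<zeta> \<in> beth_on X V"
  then have \<zeta>: "\<zeta> \<in> beth X" and c: "center X \<zeta> \<in> V" unfolding beth_on_def by auto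
  note cp = center_props(1)[OF \<zeta>, unfolded center_of_def]
  show "\<zeta> \<in> beth X \<and> home \<zeta> \<in> V \<and> (\<forall>f\<in>\<R> V. 0 \<le> \<nu> \<zeta> f)"
    using \<zeta> cp c oV regular_subset_at[OF oV c] unfolding pt_closure_iff by blast
next
  assume a: "\<zeta> \<in> beth X \<and> home \<zeta> \<in> V \<and> (\<forall>f\<in>\<R> V. 0 \<le> \<nu> \<zeta> f)"
  then obtain z where "z \<in> V" "center_of (home \<zeta>) (\<nu> \<zeta>) z"
    using semivaluation_center[OF beth_semivaluation assms] by blast
  then show "\<zeta> \<in> beth_on X V" using center_props(2) a unfolding beth_on_def by blast
qed

end

section \<open>Topology of the beth space\<close>

context separated_space begin

text \<open>Any \<open>W\<close> with these properties comes from a semivaluation centered on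
  \<open>V\<close>, so \<open>V^\<beth>\<close> is cut out by conditions on values. The prime of
  functions of infinite value gives the home x, and \<open>W\<close> extends to fractions b/c by the
  difference W b - W c, where c is nonzero at x and hence W c finite.\<close>

lemma semivaluation_extend:
  fixes W :: "('a, 'b) rat_fun \<Rightarrow> ereal"
  assumes aff: "affine_open X V" and ne: "V \<noteq> {}"
    and W0: "W \<zero>\<^bsub>L\<^esub> = \<infinity>" and W1: "W \<one>\<^bsub>L\<^esub> = 0"
    and Wpos: "\<And>f. f \<in> \<R> V \<Longrightarrow> 0 \<le> W f"
    and Wmult: "\<And>f g. f \<in> \<R> V \<Longrightarrow> g \<in> \<R> V \<Longrightarrow> W (f \<cdot> g) = W f + W g"
    and Wadd: "\<And>f g. f \<in> \<R> V \<Longrightarrow> g \<in> \<R> V \<Longrightarrow> min (W f) (W g) \<le> W (f \<boxplus> g)"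
  shows "\<exists>\<zeta>\<in>beth_on X V. \<forall>f\<in>\<R> V. \<nu> \<zeta> f = W f"
proof -
  have oV: "opn V" using aff unfolding affine_open_def by blast
  have V: "nopn V" using oV ne by blast
  note RL = regular_closed(1)[OF V]
  obtain x where x: "x \<in> V" "\<And>f. f \<in> \<R> V \<Longrightarrow> f \<in> {f \<in> \<R> V. W f = \<infinity>} \<longleftrightarrow> f \<in> \<mm> x"
  proof (rule aff_prime[OF aff ne, of "{f \<in> \<R> V. W f = \<infinity>}"])
    show "\<zero>\<^bsub>L\<^esub> \<in> {f \<in> \<R> V. W f = \<infinity>}" using W0 regular_closed(3)[OF V] by simp
    show "\<one>\<^bsub>L\<^esub> \<notin> {f \<in> \<R> V. W f = \<infinity>}" using W1 by simp
    show "f \<boxplus> g \<in> {f \<in> \<R> V. W f = \<infinity>}" if "f \<in> {f \<in> \<R> V. W f = \<infinity>}" "g \<in> {f \<in> \<R> V. W f = \<infinity>}" for f g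
      using Wadd[of f g] that regular_closed(4)[OF V] by simp
    show "f \<cdot> g \<in> {f \<in> \<R> V. W f = \<infinity>} \<longleftrightarrow> f \<in> {f \<in> \<R> V. W f = \<infinity>} \<or> g \<in> {f \<in> \<R> V. W f = \<infinity>}"
      if "f \<in> \<R> V" "g \<in> \<R> V" for f g
      using Wmult[OF that] that regular_closed(5)[OF V that] by simp
  qed (auto intro: that)
  have xm: "W f = \<infinity> \<longleftrightarrow> f \<in> \<mm> x" if "f \<in> \<R> V" for f using x(2)[OF that] that by blast
  have xX: "x \<in> points X" using x oV openin_subset by blast
  have RO: "\<R> V \<subseteq> \<O> x" using regular_subset_at oV x by blast
  have fin: "\<exists>r. W c = ereal r" if "c \<in> \<R> V" "c \<notin> \<mm> x" for c
    using xm[OF that(1)] that Wpos[OF that(1)] by (cases "W c") auto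
  \<comment> \<open>The value r depends only on f: for two fractions one has c' b = c b'. The form r
    + W c = W b also covers an infinite W b.\<close>
  have "\<exists>r. \<forall>b\<in>\<R> V. \<forall>c\<in>\<R> V. c \<notin> \<mm> x \<longrightarrow> c \<cdot> f = b \<longrightarrow> r + W c = W b" if f: "f \<in> \<O> x" for f
  proof -
    have fL: "f \<in> carrier L" using f regular_at_closed(1) by blast
    obtain b c where bc: "b \<in> \<R> V" "c \<in> \<R> V" "c \<notin> \<mm> x" "c \<cdot> f = b" using aff_frac[OF aff x(1) f] .
    obtain r where r: "W c = ereal r" using fin bc by blast
    have "W b - W c + W c' = W b'"
      if bc': "b' \<in> \<R> V" "c' \<in> \<R> V" "c' \<notin> \<mm> x" "c' \<cdot> f = b'" for b' c'
    proof -
      obtain r' where r': "W c' = ereal r'" using fin bc' by blast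
      have "c' \<cdot> b = c \<cdot> b'"
        unfolding bc(4)[symmetric] bc'(4)[symmetric] using RL bc bc' fL L.m_lcomm by blast
      then have "W c' + W b = W c + W b'" using Wmult bc bc' by metis
      then show ?thesis unfolding r r' by (cases "W b"; cases "W b'") auto
    qed
    then show ?thesis by blast
  qed
  then obtain v where v: "\<And>f b c. f \<in> \<O> x \<Longrightarrow> b \<in> \<R> V \<Longrightarrow> c \<in> \<R> V \<Longrightarrow> c \<notin> \<mm> x \<Longrightarrow> c \<cdot> f = b \<Longrightarrow> v f + W c = W b"
    by metis
  have vW: "v f = W f" if "f \<in> \<R> V" for f
    using v[of f f "\<one>\<^bsub>L\<^esub>"] that RO regular_closed(2)[OF V] one_notin_max[OF xX] RL W1 by (auto simp: subset_iff)
  have "semivaluation x v" unfolding semivaluation_def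
  proof (intro conjI ballI xX)
    fix f assume f: "f \<in> \<O> x"
    obtain b c where bc: "b \<in> \<R> V" "c \<in> \<R> V" "c \<notin> \<mm> x" "c \<cdot> f = b" using aff_frac[OF aff x(1) f] .
    obtain r where r: "W c = ereal r" using fin bc by blast
    note vf = v[OF f bc, unfolded r]
    show "v f \<noteq> -\<infinity>" using vf Wpos[OF bc(1)] by (cases "W b"; cases "v f") auto
    have "v f = \<infinity> \<longleftrightarrow> W b = \<infinity>" using vf by (cases "v f") auto
    also have "\<dots> \<longleftrightarrow> f \<in> \<mm> x"
      using xm[OF bc(1)] max_ideal_mult_iff[OF _ f xX, of c] bc RO by auto
    finally show "v f = \<infinity> \<longleftrightarrow> f \<in> \<mm> x" .
    fix g assume g: "g \<in> \<O> x"
    obtain e d where ed: "e \<in> \<R> V" "d \<in> \<R> V" "d \<notin> \<mm> x" "d \<cdot> g = e" using aff_frac[OF aff x(1) g] .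
    obtain s where s: "W d = ereal s" using fin ed by blast
    note vg = v[OF g ed, unfolded s]
    have car: "f \<in> carrier L" "g \<in> carrier L" "c \<in> carrier L" "d \<in> carrier L"
      using f g regular_at_closed(1) RL bc ed by auto
    have cd: "c \<cdot> d \<in> \<R> V" "c \<cdot> d \<notin> \<mm> x" "W (c \<cdot> d) = ereal (r + s)"
      using regular_closed(5)[OF V bc(2) ed(2)] max_ideal_mult_iff[of c x d] xX bc ed RO Wmult[OF bc(2) ed(2)] r s by auto
    have m: "c \<cdot> d \<cdot> (f \<cdot> g) = b \<cdot> e"
      unfolding bc(4)[symmetric] ed(4)[symmetric] using car by (simp add: L.m_ac)
    have a: "c \<cdot> d \<cdot> (f \<boxplus> g) = d \<cdot> b \<boxplus> c \<cdot> e"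
      unfolding bc(4)[symmetric] ed(4)[symmetric] using car by (simp add: L.m_ac L.r_distr L.l_distr)
    have RR: "b \<cdot> e \<in> \<R> V" "d \<cdot> b \<in> \<R> V" "c \<cdot> e \<in> \<R> V" "d \<cdot> b \<boxplus> c \<cdot> e \<in> \<R> V"
      using regular_closed(4,5)[OF V] bc ed by blast+
    have "v (f \<cdot> g) + ereal (r + s) = W b + W e"
      using v[OF regular_at_closed(5)[OF f g] RR(1) cd(1,2) m] cd(3) Wmult[OF bc(1) ed(1)] by simp
    then show "v (f \<cdot> g) = v f + v g" unfolding vf[symmetric] vg[symmetric]
      by (cases "v f"; cases "v g"; cases "v (f \<cdot> g)") auto
    have "min (W (d \<cdot> b)) (W (c \<cdot> e)) \<le> v (f \<boxplus> g) + ereal (r + s)"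
      using v[OF regular_at_closed(4)[OF f g] RR(4) cd(1,2) a] cd(3) Wadd[OF RR(2,3)] by simp
    then show "min (v f) (v g) \<le> v (f \<boxplus> g)"
      unfolding Wmult[OF ed(2) bc(1)] Wmult[OF bc(2) ed(1)] r s vf[symmetric] vg[symmetric]
      by (cases "v f"; cases "v g"; cases "v (f \<boxplus> g)") (auto simp: min_def split: if_splits)
  qed
  note sv = this
  obtain z where z: "z \<in> V" "center_of x v z"
    by (rule semivaluation_center[OF sv aff x(1)]) (use vW Wpos in simp)
  obtain \<zeta> where \<zeta>: "\<zeta> \<in> beth X" "home \<zeta> = x" "\<And>f. f \<in> \<O> x \<Longrightarrow> \<nu> \<zeta> f = v f"
    using beth_exists[OF sv, of z] z(2) unfolding center_of_def by blast
  have "\<nu> \<zeta> f = W f" if "f \<in> \<R> V" for f using \<zeta>(3) RO vW that by auto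
  moreover from this have "\<zeta> \<in> beth_on X V" unfolding beth_on_iff[OF aff] using \<zeta> x Wpos by simp
  ultimately show ?thesis by blast
qed

text \<open>The functions of infinite value determine the home. At a fraction c f = b the value of c
  is finite and can be cancelled, which determines the value of f.\<close>

lemma beth_on_eqI:
  assumes aff: "affine_open X V" and \<zeta>: "\<zeta> \<in> beth_on X V" "\<xi> \<in> beth_on X V"
    and eq: "\<And>f. f \<in> \<R> V \<Longrightarrow> \<nu> \<zeta> f = \<nu> \<xi> f"
  shows "\<zeta> = \<xi>"
proof -
  note b = \<zeta>[unfolded beth_on_iff[OF aff]]
  note b' = b
  note sv = beth_semivaluation[of \<zeta>] beth_semivaluation[of \<xi>]
  have V: "nopn V" using aff_nopn aff b by blast
  have RO: "\<R> V \<subseteq> \<O> (home \<zeta>)" "\<R> V \<subseteq> \<O> (home \<xi>)" using regular_subset_at V b by blast+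
  have h: "home \<zeta> = home \<xi>"
  proof (rule aff_inj[OF aff])
    show "f \<in> \<mm> (home \<zeta>) \<longleftrightarrow> f \<in> \<mm> (home \<xi>)" if f: "f \<in> \<R> V" for f
    proof -
      have "\<nu> \<zeta> f = \<infinity> \<longleftrightarrow> f \<in> \<mm> (home \<zeta>)" "\<nu> \<xi> f = \<infinity> \<longleftrightarrow> f \<in> \<mm> (home \<xi>)"
        using sv b f RO unfolding semivaluation_def by blast+
      then show ?thesis using eq[OF f] by simp
    qed
  qed (use b in auto)
  show ?thesis
  proof (rule beth_eqI[OF _ _ h])
    fix f assume f: "f \<in> \<O> (home \<zeta>)"
    obtain b c where bc: "b \<in> \<R> V" "c \<in> \<R> V" "c \<notin> \<mm> (home \<zeta>)" "c \<cdot> f = b"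
      using aff_frac[OF aff _ f] b by blast
    have "\<nu> \<zeta> b = \<nu> \<zeta> c + \<nu> \<zeta> f" 
      "\<nu> \<zeta> c \<noteq> \<infinity>" "\<nu> \<zeta> c \<noteq> -\<infinity>"
      using sv(1) b f bc RO unfolding semivaluation_def by blast+
    moreover have "\<nu> \<xi> b = \<nu> \<xi> c + \<nu> \<xi> f" 
    proof -
      have "f \<in> \<O> (home \<xi>)" "c \<in> \<O> (home \<xi>)" using f h bc(2) RO(2) by auto
      then have "\<nu> \<xi> (c \<cdot> f) = \<nu> \<xi> c + \<nu> \<xi> f"
        using sv(2) b' unfolding semivaluation_def by blast
      then show ?thesis using bc(4) by simp
    qed
    ultimately show "\<nu> \<zeta> f = \<nu> \<xi> f" using eq[OF bc(1)] eq[OF bc(2)]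
      by (cases "\<nu> \<zeta> c") (auto simp: ereal_add_cancel_left)
  qed (use b in auto)
qed

lemma topspace_beth_affine:
  assumes "affine_open X V" shows "topspace (beth_top_affine X V) = beth_on X V"
proof (cases "V = {}")
  case True
  then show ?thesis unfolding beth_top_affine_def topology_generated_by_topspace beth_on_def by auto
next
  case False
  then have "\<one>\<^bsub>L\<^esub> \<in> \<R> V" using regular_closed(2) assms unfolding affine_open_def by blast
  then have "{\<zeta> \<in> beth_on X V. \<nu> \<zeta> \<one>\<^bsub>L\<^esub> \<in> UNIV} \<in> {{\<zeta> \<in> beth_on X V. \<nu> \<zeta> f \<in> W} | f W. f \<in> \<R> V \<and> open W}"
    by (intro CollectI exI[of _ "\<one>\<^bsub>L\<^esub>"] exI[of _ UNIV]) simp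
  then show ?thesis unfolding beth_top_affine_def topology_generated_by_topspace by blast
qed

lemma beth_affine_open:
  "f \<in> \<R> V \<Longrightarrow> open W \<Longrightarrow> openin (beth_top_affine X V) {\<zeta> \<in> beth_on X V. \<nu> \<zeta> f \<in> W}"
  unfolding beth_top_affine_def by (rule topology_generated_by_Basis) blast

lemma e2ennreal_add: "0 \<le> a \<Longrightarrow> 0 \<le> b \<Longrightarrow> e2ennreal (a + b) = e2ennreal a + e2ennreal b"
  by (metis add_nonneg_nonneg e2ennreal_enn2ereal enn2ereal_e2ennreal plus_ennreal.rep_eq)

text \<open>The values are taken in \<^typ>\<open>ennreal\<close>, on which addition is continuous everywhere.\<close>

lemma compact_beth_affine:
  assumes aff: "affine_open X V"
  shows "compactin (beth_top_affine X V) (beth_on X V)"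
proof (cases "V = {}")
  case True
  then show ?thesis unfolding beth_on_def by simp
next
  case ne: False
  then have V: "nopn V" using aff unfolding affine_open_def by blast
  \<comment> \<open>Coordinates outside \<open>\<R> V\<close> are unconstrained, so many elements of
    \<open>S\<close> give the same semivaluation. A continuous surjection from the compact set
    \<open>S\<close> is enough.\<close>
  define S :: "(('a, 'b) rat_fun \<Rightarrow> ennreal) set" where
    "S = {w. w \<zero>\<^bsub>L\<^esub> = \<infinity>} \<inter> {w. w \<one>\<^bsub>L\<^esub> = 0} \<inter>
      (\<Inter>f\<in>\<R> V. \<Inter>g\<in>\<R> V. {w. w (f \<cdot> g) = w f + w g} \<inter> {w. min (w f) (w g) \<le> w (f \<boxplus> g)})"
  have "closed S" unfolding S_def
    by (intro closed_Int closed_INT ballI closed_Collect_eq closed_Collect_le continuous_on_product_coordinates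
          continuous_on_const continuous_on_add continuous_on_min)
  moreover have "compact (UNIV :: (('a, 'b) rat_fun \<Rightarrow> ennreal) set)"
  proof -
    have "compact_space (product_topology (\<lambda>i :: ('a, 'b) rat_fun. euclidean :: ennreal topology) UNIV)"
      unfolding compact_space_product_topology
      by (simp add: compact_space_def compact_eq_closed)
    then show ?thesis unfolding euclidean_product_topology compact_space_def by simp
  qed
  ultimately have "compact S" using closed_Int_compact[of S UNIV] by simp
  then have cS: "compactin (top_of_set S) S" by (simp add: compactin_subtopology)
  have "\<forall>w\<in>S. \<exists>\<zeta>\<in>beth_on X V. \<forall>f\<in>\<R> V. \<nu> \<zeta> f = enn2ereal (w f)"
  proof
    fix w assume w: "w \<in> S"
    show "\<exists>\<zeta>\<in>beth_on X V. \<forall>f\<in>\<R> V. \<nu> \<zeta> f = enn2ereal (w f)"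
    proof (rule semivaluation_extend[OF aff ne])
      show "enn2ereal (w \<zero>\<^bsub>L\<^esub>) = \<infinity>" "enn2ereal (w \<one>\<^bsub>L\<^esub>) = 0" using w unfolding S_def by (auto simp: zero_ennreal.rep_eq)
      show "0 \<le> enn2ereal (w f)" for f by simp
      fix f g assume fg: "f \<in> \<R> V" "g \<in> \<R> V"
      then have "w (f \<cdot> g) = w f + w g" "min (w f) (w g) \<le> w (f \<boxplus> g)" using w unfolding S_def by auto
      then show "enn2ereal (w (f \<cdot> g)) = enn2ereal (w f) + enn2ereal (w g)"
        "min (enn2ereal (w f)) (enn2ereal (w g)) \<le> enn2ereal (w (f \<boxplus> g))"
        by (auto simp: plus_ennreal.rep_eq less_eq_ennreal.rep_eq min_def split: if_splits)
    qed
  qed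
  then obtain \<Phi> where \<Phi>: "\<And>w. w \<in> S \<Longrightarrow> \<Phi> w \<in> beth_on X V"
    "\<And>w f. w \<in> S \<Longrightarrow> f \<in> \<R> V \<Longrightarrow> \<nu> (\<Phi> w) f = enn2ereal (w f)" by metis
  have "continuous_map (top_of_set S) (beth_top_affine X V) \<Phi>"
    unfolding beth_top_affine_def continuous_on_generated_topo_iff
  proof (intro conjI allI impI)
    fix U assume "U \<in> {{\<zeta> \<in> beth_on X V. \<nu> \<zeta> f \<in> W} |f W. f \<in> \<R> V \<and> open W}"
    then obtain f W where U: "U = {\<zeta> \<in> beth_on X V. \<nu> \<zeta> f \<in> W}" "f \<in> \<R> V" "open W" by blast
    have "open ((\<lambda>w. enn2ereal (w f)) -` W)"
    proof (rule open_vimage[OF U(3)])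
      show "continuous_on UNIV (\<lambda>w :: ('a, 'b) rat_fun \<Rightarrow> ennreal. enn2ereal (w f))"
        by (rule continuous_on_compose2[OF continuous_on_enn2ereal]) auto
    qed
    moreover have "\<Phi> -` U \<inter> topspace (top_of_set S) = S \<inter> (\<lambda>w. enn2ereal (w f)) -` W"
      unfolding U(1) using \<Phi> U(2) by auto
    ultimately show "openin (top_of_set S) (\<Phi> -` U \<inter> topspace (top_of_set S))" by (simp add: openin_open_Int)
  next
    have "\<Phi> ` topspace (top_of_set S) \<subseteq> topspace (beth_top_affine X V)"
      unfolding topspace_beth_affine[OF aff] using \<Phi>(1) by auto
    then show "\<Phi> ` topspace (top_of_set S) \<subseteq> \<Union> {{\<zeta> \<in> beth_on X V. \<nu> \<zeta> f \<in> W} |f W. f \<in> \<R> V \<and> open W}"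
      unfolding beth_top_affine_def topology_generated_by_topspace .
  qed
  then have "compactin (beth_top_affine X V) (\<Phi> ` S)" using image_compactin cS by blast
  moreover have "\<Phi> ` S = beth_on X V"
  proof
    show "\<Phi> ` S \<subseteq> beth_on X V" using \<Phi>(1) by blast
    show "beth_on X V \<subseteq> \<Phi> ` S"
    proof
      fix \<zeta> assume \<zeta>: "\<zeta> \<in> beth_on X V"
      note b = \<zeta>[unfolded beth_on_iff[OF aff]]
      have sv: "semivaluation (home \<zeta>) (\<nu> \<zeta>)" using beth_semivaluation b by blast
      have hX: "home \<zeta> \<in> points X" using sv unfolding semivaluation_def by blast
      have RO: "\<R> V \<subseteq> \<O> (home \<zeta>)" using regular_subset_at V b by blast
      define w where "w f = e2ennreal (\<nu> \<zeta> f)" for f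
      have w: "enn2ereal (w f) = \<nu> \<zeta> f" if "f \<in> \<R> V" for f
        unfolding w_def using b that by (simp add: enn2ereal_e2ennreal)
      have "\<nu> \<zeta> \<zero>\<^bsub>L\<^esub> = \<infinity>"
        using sv max_ideal_closed(1,2)[OF hX] unfolding semivaluation_def by blast
      then have "w \<zero>\<^bsub>L\<^esub> = \<infinity>" "w \<one>\<^bsub>L\<^esub> = 0" unfolding w_def semivaluation_one(1)[OF sv]
        using e2ennreal_enn2ereal[of \<infinity>] e2ennreal_enn2ereal[of 0] by (simp_all add: zero_ennreal.rep_eq)
      moreover have "w (f \<cdot> g) = w f + w g" "min (w f) (w g) \<le> w (f \<boxplus> g)"
        if fg: "f \<in> \<R> V" "g \<in> \<R> V" for f g
      proof -
        have 1: "\<nu> \<zeta> (f \<cdot> g) = \<nu> \<zeta> f + \<nu> \<zeta> g"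
          "min (\<nu> \<zeta> f) (\<nu> \<zeta> g) \<le> \<nu> \<zeta> (f \<boxplus> g)"
          using sv fg RO unfolding semivaluation_def by blast+
        show "w (f \<cdot> g) = w f + w g" unfolding w_def 1(1) using b fg by (simp add: e2ennreal_add)
        show "min (w f) (w g) \<le> w (f \<boxplus> g)"
          using e2ennreal_mono[OF 1(2)] unfolding w_def by (auto simp: min_def split: if_splits intro: order_trans)
      qed
      ultimately have "w \<in> S" unfolding S_def by blast
      moreover have "\<Phi> w = \<zeta>"
        by (rule beth_on_eqI[OF aff \<Phi>(1)[OF \<open>w \<in> S\<close>] \<zeta>]) (use \<Phi>(2)[OF \<open>w \<in> S\<close>] w in simp)
      ultimately show "\<zeta> \<in> \<Phi> ` S" by blast
    qed
  qed
  ultimately show ?thesis by simp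
qed

lemma topspace_beth: "topspace (beth_top X) = beth X"
proof
  show "topspace (beth_top X) \<subseteq> beth X" using openin_topspace[of "beth_top X"] openin_beth_top by blast
  have "openin (beth_top X) (beth X)" unfolding openin_beth_top
  proof (intro conjI allI impI)
    fix V assume V: "affine_open X V"
    have "beth X \<inter> beth_on X V = topspace (beth_top_affine X V)"
      using topspace_beth_affine[OF V] unfolding beth_on_def by auto
    then show "openin (beth_top_affine X V) (beth X \<inter> beth_on X V)" by simp
  qed simp
  then show "beth X \<subseteq> topspace (beth_top X)" using openin_subset by blast
qed

lemma closedin_beth_affine:
  assumes "closedin (beth_top X) F" "affine_open X V"
  shows "closedin (beth_top_affine X V) (F \<inter> beth_on X V)"
proof -
  have "openin (beth_top X) (beth X - F)" using assms(1) unfolding closedin_def topspace_beth by blast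
  then have "openin (beth_top_affine X V) ((beth X - F) \<inter> beth_on X V)" using assms(2) openin_beth_top by blast
  moreover have "(beth X - F) \<inter> beth_on X V = topspace (beth_top_affine X V) - F \<inter> beth_on X V"
    unfolding topspace_beth_affine[OF assms(2)] unfolding beth_on_def by blast
  ultimately show ?thesis unfolding closedin_def topspace_beth_affine[OF assms(2)] by auto
qed

text \<open>Of the integrality of discrete valuations only the gap between \<open>0\<close> and \<open>1\<close> is used: it makes
  \<open>\<zeta>(f) = 0\<close> both an open and a closed condition.\<close>

definition gap_points :: "('a, 'b) semival set" where
  "gap_points = {\<zeta> \<in> beth X. \<forall>f\<in>\<O> (center X \<zeta>). \<nu> \<zeta> f \<le> 0 \<or> 1 \<le> \<nu> \<zeta> f}"

text \<open>Denominators at the center have value 0, so the condition on the local ring at the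
  center reduces to functions on \<open>V\<close>, whose values are continuous on
  \<open>V^\<beth>\<close>.\<close>

lemma gap_points_affine:
  assumes aff: "affine_open X V"
  shows "gap_points \<inter> beth_on X V = {\<zeta> \<in> beth_on X V. \<forall>f\<in>\<R> V. \<nu> \<zeta> f \<le> 0 \<or> 1 \<le> \<nu> \<zeta> f}"
proof -
  have "(\<forall>f\<in>\<O> (center X \<zeta>). \<nu> \<zeta> f \<le> 0 \<or> 1 \<le> \<nu> \<zeta> f) \<longleftrightarrow>
      (\<forall>f\<in>\<R> V. \<nu> \<zeta> f \<le> 0 \<or> 1 \<le> \<nu> \<zeta> f)" if \<zeta>: "\<zeta> \<in> beth_on X V" for \<zeta>
  proof
    have c: "center X \<zeta> \<in> V" "\<zeta> \<in> beth X" using \<zeta> unfolding beth_on_def by auto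
    have V: "nopn V" using aff_nopn[OF aff c(1)] .
    have RO: "\<R> V \<subseteq> \<O> (center X \<zeta>)" using regular_subset_at V c(1) by blast
    { assume "\<forall>f\<in>\<O> (center X \<zeta>). \<nu> \<zeta> f \<le> 0 \<or> 1 \<le> \<nu> \<zeta> f"
      then show "\<forall>f\<in>\<R> V. \<nu> \<zeta> f \<le> 0 \<or> 1 \<le> \<nu> \<zeta> f" using RO by blast }
    assume R: "\<forall>f\<in>\<R> V. \<nu> \<zeta> f \<le> 0 \<or> 1 \<le> \<nu> \<zeta> f"
    note cp = center_props(1)[OF c(2), unfolded center_of_def]
    have OO: "\<O> (center X \<zeta>) \<subseteq> \<O> (home \<zeta>)" using pt_closure_O cp by blast
    show "\<forall>f\<in>\<O> (center X \<zeta>). \<nu> \<zeta> f \<le> 0 \<or> 1 \<le> \<nu> \<zeta> f"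
    proof
      fix f assume f: "f \<in> \<O> (center X \<zeta>)"
      obtain b d where bd: "b \<in> \<R> V" "d \<in> \<R> V" "d \<notin> \<mm> (center X \<zeta>)" "d \<cdot> f = b" using aff_frac[OF aff c(1) f] .
      have "0 \<le> \<nu> \<zeta> d \<and> (0 < \<nu> \<zeta> d \<longleftrightarrow> d \<in> \<mm> (center X \<zeta>))" using cp bd(2) RO by blast
      then have "\<nu> \<zeta> d = 0" using bd(3) by auto
      moreover have "\<nu> \<zeta> (d \<cdot> f) = \<nu> \<zeta> d + \<nu> \<zeta> f"
        using beth_semivaluation[OF c(2)] bd(2) RO OO f unfolding semivaluation_def by blast
      ultimately show "\<nu> \<zeta> f \<le> 0 \<or> 1 \<le> \<nu> \<zeta> f" using R bd(1,4) by auto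
    qed
  qed
  then show ?thesis unfolding gap_points_def beth_on_def by blast
qed

lemma closedin_gap_points: "closedin (beth_top X) gap_points"
  unfolding closedin_def topspace_beth
proof
  show "gap_points \<subseteq> beth X" unfolding gap_points_def by blast
  show "openin (beth_top X) (beth X - gap_points)" unfolding openin_beth_top
  proof (intro conjI allI impI)
    fix V assume aff: "affine_open X V"
    have "(beth X - gap_points) \<inter> beth_on X V = beth_on X V - (gap_points \<inter> beth_on X V)" unfolding beth_on_def by blast
    also have "\<dots> = (\<Union>f\<in>\<R> V. {\<zeta> \<in> beth_on X V. \<nu> \<zeta> f \<in> {0<..<1}})"
      unfolding gap_points_affine[OF aff] by (auto simp: not_le)
    finally show "openin (beth_top_affine X V) ((beth X - gap_points) \<inter> beth_on X V)"
      using beth_affine_open[of _ V "{0<..<1}"] by auto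
  qed blast
qed

lemma discrete_closure_gap: "\<DD> X \<subseteq> gap_points"
  unfolding discrete_closure_def
proof (rule closure_of_minimal[OF _ closedin_gap_points], rule subsetI)
  fix \<zeta> assume \<zeta>: "\<zeta> \<in> {\<zeta> \<in> Val X. \<forall>f \<in> carrier L - {\<zero>\<^bsub>L\<^esub>}. \<exists>n :: int. \<nu> \<zeta> f = ereal (of_int n)}"
  then have b: "\<zeta> \<in> beth X" unfolding Val_def by blast
  have hX: "home \<zeta> \<in> points X" using beth_semivaluation[OF b] unfolding semivaluation_def by blast
  have z: "\<nu> \<zeta> \<zero>\<^bsub>L\<^esub> = \<infinity>"
    using beth_semivaluation[OF b] max_ideal_closed(1,2)[OF hX] unfolding semivaluation_def by blast
  have "\<nu> \<zeta> f \<le> 0 \<or> 1 \<le> \<nu> \<zeta> f" if f: "f \<in> carrier L" for f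
  proof (cases "f = \<zero>\<^bsub>L\<^esub>")
    case False
    then obtain n :: int where "\<nu> \<zeta> f = ereal (of_int n)" using \<zeta> f by blast
    moreover have "n \<le> 0 \<or> 1 \<le> n" by linarith
    ultimately show ?thesis by (simp add: zero_ereal_def one_ereal_def)
  qed (simp add: z)
  then show "\<zeta> \<in> gap_points" unfolding gap_points_def using b regular_at_closed(1) by blast
qed

lemma closedin_discrete_closure: "affine_open X V \<Longrightarrow> closedin (beth_top_affine X V) (\<DD> X \<inter> beth_on X V)"
  unfolding discrete_closure_def by (rule closedin_beth_affine[OF closedin_closure_of])

text \<open>\<open>F\<close> generates the ideal of functions on \<open>V\<close> vanishing on
  \<open>V - U\<close>. If all generators vanished at a point y of \<open>U\<close>, then so would
  the whole ideal, but it contains the function of a basic neighbourhood of y inside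
  \<open>U\<close>.\<close>

lemma noetherian_basic_opens:
  assumes aff: "affine_open X V" and noeth: "noetherian_ring (sect X V)" and ne: "V \<noteq> {}" and U: "opn U"
  obtains F where "finite F" "F \<subseteq> \<R> V" "\<forall>y\<in>V. y \<in> U \<longleftrightarrow> (\<exists>f\<in>F. f \<notin> \<mm> y)"
proof -
  have V: "nopn V" using aff ne unfolding affine_open_def by blast
  interpret V: noetherian_ring "sect X V" by fact
  interpret V: cring "sect X V" using sect_cring V by blast
  interpret h: ring_hom_cring "sect X V" L "germ X \<eta> V"
    by (rule ring_hom_cring_of[OF V.is_cring L_cring germ_hom[OF V]])
  \<comment> \<open>Stated for arbitrary \<open>Y\<close> because it serves twice: for
    \<open>V - U\<close>, to obtain generators, and for a single point, to pass from generators to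
    the ideal.\<close>
  have vanish: "ideal {s \<in> carrier (sect X V). \<forall>y\<in>Y. germ X \<eta> V s \<in> \<mm> y} (sect X V)" if Y: "Y \<subseteq> V" for Y
  proof (rule idealI[OF V.ring_axioms])
    let ?I = "{s \<in> carrier (sect X V). \<forall>y\<in>Y. germ X \<eta> V s \<in> \<mm> y}"
    have YX: "y \<in> points X" if "y \<in> Y" for y using that Y V openin_subset by blast
    have gO: "germ X \<eta> V s \<in> \<O> y" if "s \<in> carrier (sect X V)" "y \<in> Y" for s y
      using that Y regular_subset_at[of V y] V unfolding regular_def by blast
    show "subgroup ?I (add_monoid (sect X V))"
      by (rule V.add.subgroupI) (use YX max_ideal_closed(2,3) max_ideal_add V.zero_closed in \<open>auto simp del: V.zero_closed\<close>)
    show "t \<otimes>\<^bsub>sect X V\<^esub> s \<in> ?I" "s \<otimes>\<^bsub>sect X V\<^esub> t \<in> ?I" if "s \<in> ?I" "t \<in> carrier (sect X V)" for s t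
      using that YX gO max_ideal_mult_iff by auto
  qed
  obtain A where A: "A \<subseteq> carrier (sect X V)" "finite A"
    and I: "{s \<in> carrier (sect X V). \<forall>y\<in>V - U. germ X \<eta> V s \<in> \<mm> y} = Idl\<^bsub>sect X V\<^esub> A"
    using V.finetely_gen[OF vanish[of "V - U"]] by blast
  show thesis
  proof (rule that[of "germ X \<eta> V ` A"])
    show "finite (germ X \<eta> V ` A)" using A by blast
    show "germ X \<eta> V ` A \<subseteq> \<R> V" using A unfolding regular_def by blast
    show "\<forall>y\<in>V. y \<in> U \<longleftrightarrow> (\<exists>f\<in>germ X \<eta> V ` A. f \<notin> \<mm> y)"
    proof
      fix y assume y: "y \<in> V"
      show "y \<in> U \<longleftrightarrow> (\<exists>f\<in>germ X \<eta> V ` A. f \<notin> \<mm> y)"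
      proof
        assume yU: "y \<in> U"
        obtain g where g: "g \<in> \<R> V" "g \<notin> \<mm> y" "{y \<in> V. g \<notin> \<mm> y} \<subseteq> U" using aff_basis[OF aff y U yU] .
        obtain s where s: "s \<in> carrier (sect X V)" "g = germ X \<eta> V s" using g(1) unfolding regular_def by blast
        have "s \<in> {s \<in> carrier (sect X V). \<forall>y\<in>V - U. germ X \<eta> V s \<in> \<mm> y}" using s g(3) by blast
        then have sI: "s \<in> Idl\<^bsub>sect X V\<^esub> A" unfolding I .
        show "\<exists>f\<in>germ X \<eta> V ` A. f \<notin> \<mm> y"
        proof (rule ccontr)
          assume "\<not> ?thesis"
          then have "A \<subseteq> {s \<in> carrier (sect X V). \<forall>y\<in>{y}. germ X \<eta> V s \<in> \<mm> y}" using A by blast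
          then have "Idl\<^bsub>sect X V\<^esub> A \<subseteq> {s \<in> carrier (sect X V). \<forall>y\<in>{y}. germ X \<eta> V s \<in> \<mm> y}"
            using V.genideal_minimal[OF vanish[of "{y}"]] y by blast
          then show False using sI s g(2) by blast
        qed
      next
        assume "\<exists>f\<in>germ X \<eta> V ` A. f \<notin> \<mm> y"
        then obtain s where s: "s \<in> A" "germ X \<eta> V s \<notin> \<mm> y" by blast
        have "s \<in> Idl\<^bsub>sect X V\<^esub> A" using V.genideal_self[OF A(1)] s by blast
        then show "y \<in> U" using s(2) y unfolding I[symmetric] by blast
      qed
    qed
  qed
qed

lemma topspace_constructible: "topspace (constructible_top (zariski X)) = points X"
  unfolding constructible_top_def topology_generated_by_topspace
  using openin_subset closedin_subset openin_topspace by fastforce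

text \<open>An open set that tells two points apart and its complement are both open in the
  constructible topology.\<close>

lemma Hausdorff_constructible: "Hausdorff_space (constructible_top (zariski X))"
  unfolding Hausdorff_space_def topspace_constructible
proof (intro allI impI)
  fix x y assume "x \<in> points X \<and> y \<in> points X \<and> x \<noteq> y"
  then obtain U where U: "opn U" "(x \<in> U) \<noteq> (y \<in> U)" and xy: "x \<in> points X" "y \<in> points X" using T0 by metis
  have o: "openin (constructible_top (zariski X)) U" "openin (constructible_top (zariski X)) (points X - U)"
    unfolding constructible_top_def using U(1) by (auto intro!: topology_generated_by_Basis)
  show "\<exists>S T. openin (constructible_top (zariski X)) S \<and> openin (constructible_top (zariski X)) T \<and>
      x \<in> S \<and> y \<in> T \<and> disjnt S T"
  proof (cases "x \<in> U")
    case True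
    then show ?thesis using o U xy by (intro exI[of _ U] exI[of _ "points X - U"]) (auto simp: disjnt_def)
  next
    case False
    then show ?thesis using o U xy by (intro exI[of _ "points X - U"] exI[of _ U]) (auto simp: disjnt_def)
  qed
qed

lemma center_continuous:
  assumes aff: "affine_open X V" and noeth: "noetherian_ring (sect X V)"
  shows "continuous_map (subtopology (beth_top_affine X V) (\<DD> X \<inter> beth_on X V)) (constructible_top (zariski X)) (center X)"
proof -
  let ?T = "subtopology (beth_top_affine X V) (\<DD> X \<inter> beth_on X V)"
  have tT: "topspace ?T = \<DD> X \<inter> beth_on X V" using topspace_beth_affine[OF aff] by auto
  have cX: "center X \<zeta> \<in> points X" if "\<zeta> \<in> beth_on X V" for \<zeta>
    using that aff openin_subset unfolding beth_on_def affine_open_def by blast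
  have clopen: "openin ?T {\<zeta> \<in> \<DD> X \<inter> beth_on X V. center X \<zeta> \<in> U}"
    "openin ?T {\<zeta> \<in> \<DD> X \<inter> beth_on X V. center X \<zeta> \<notin> U}" if U: "opn U" for U
  proof -
    show "openin ?T {\<zeta> \<in> \<DD> X \<inter> beth_on X V. center X \<zeta> \<in> U}"
      "openin ?T {\<zeta> \<in> \<DD> X \<inter> beth_on X V. center X \<zeta> \<notin> U}"
    proof (atomize(full), cases "V = {}")
      case True
      then have "beth_on X V = {}" unfolding beth_on_def by blast
      then show "openin ?T {\<zeta> \<in> \<DD> X \<inter> beth_on X V. center X \<zeta> \<in> U} \<and> openin ?T {\<zeta> \<in> \<DD> X \<inter> beth_on X V. center X \<zeta> \<notin> U}" by simp
    next
      case ne: False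
      have V: "nopn V" using aff ne unfolding affine_open_def by blast
      obtain F where F: "finite F" "F \<subseteq> \<R> V" "\<forall>y\<in>V. y \<in> U \<longleftrightarrow> (\<exists>f\<in>F. f \<notin> \<mm> y)"
        using noetherian_basic_opens[OF aff noeth ne U] .
      \<comment> \<open>The value is 0 or at least 1 here. So nonvanishing at the center can be
        tested by the open condition \<open>< 1\<close> and vanishing by the open condition
        \<open>0 <\<close>.\<close>
      have v: "\<nu> \<zeta> f < 1 \<longleftrightarrow> f \<notin> \<mm> (center X \<zeta>)" "0 < \<nu> \<zeta> f \<longleftrightarrow> f \<in> \<mm> (center X \<zeta>)"
        if \<zeta>: "\<zeta> \<in> \<DD> X \<inter> beth_on X V" and f: "f \<in> F" for \<zeta> f
      proof -
        have b: "\<zeta> \<in> beth X" "center X \<zeta> \<in> V" using \<zeta> unfolding beth_on_def by auto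
        have fO: "f \<in> \<O> (center X \<zeta>)" using f F(2) regular_subset_at[of V] V b(2) by blast
        have "0 < \<nu> \<zeta> f \<longleftrightarrow> f \<in> \<mm> (center X \<zeta>)" using center_props(1)[OF b(1)] fO unfolding center_of_def by blast
        moreover have "\<nu> \<zeta> f \<le> 0 \<or> 1 \<le> \<nu> \<zeta> f"
          using \<zeta> discrete_closure_gap fO unfolding gap_points_def by blast
        moreover have "(0::ereal) < 1" by simp
        ultimately show "\<nu> \<zeta> f < 1 \<longleftrightarrow> f \<notin> \<mm> (center X \<zeta>)" "0 < \<nu> \<zeta> f \<longleftrightarrow> f \<in> \<mm> (center X \<zeta>)"
          by (meson not_le order.strict_trans1 order.strict_trans2)+
      qed
      have cV: "center X \<zeta> \<in> V" if "\<zeta> \<in> beth_on X V" for \<zeta> using that unfolding beth_on_def by blast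
      have o1: "openin (beth_top_affine X V) (\<Union>f\<in>F. {\<zeta> \<in> beth_on X V. \<nu> \<zeta> f \<in> {..<1}})"
        using F(2) beth_affine_open[of _ V "{..<1}"] by (intro openin_Union) auto
      \<comment> \<open>Lying outside \<open>U\<close> is an intersection of open conditions; it is
        open because \<open>F\<close> is finite.\<close>
      have o2: "openin (beth_top_affine X V) (topspace (beth_top_affine X V) \<inter> (\<Inter>f\<in>F. {\<zeta> \<in> beth_on X V. \<nu> \<zeta> f \<in> {0<..}}))"
        using F beth_affine_open[of _ V "{0<..}"] by (intro openin_Int_Inter) auto
      have "{\<zeta> \<in> \<DD> X \<inter> beth_on X V. center X \<zeta> \<in> U} =
          (\<Union>f\<in>F. {\<zeta> \<in> beth_on X V. \<nu> \<zeta> f \<in> {..<1}}) \<inter> (\<DD> X \<inter> beth_on X V)"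
        using v(1) F(3)[rule_format, OF cV] by auto
      moreover have "{\<zeta> \<in> \<DD> X \<inter> beth_on X V. center X \<zeta> \<notin> U} =
          (topspace (beth_top_affine X V) \<inter> (\<Inter>f\<in>F. {\<zeta> \<in> beth_on X V. \<nu> \<zeta> f \<in> {0<..}})) \<inter> (\<DD> X \<inter> beth_on X V)"
        using v(2) F(3)[rule_format, OF cV] unfolding topspace_beth_affine[OF aff] by auto
      ultimately show "openin ?T {\<zeta> \<in> \<DD> X \<inter> beth_on X V. center X \<zeta> \<in> U} \<and> openin ?T {\<zeta> \<in> \<DD> X \<inter> beth_on X V. center X \<zeta> \<notin> U}"
        unfolding openin_subtopology using o1 o2 by blast
    qed
  qed
  show ?thesis unfolding constructible_top_def continuous_on_generated_topo_iff tT
  proof (intro conjI allI impI)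
    fix U assume "U \<in> {U. opn U} \<union> {C. closedin (zariski X) C}"
    then show "openin ?T (center X -` U \<inter> (\<DD> X \<inter> beth_on X V))"
    proof
      assume "U \<in> {U. opn U}"
      then have "openin ?T {\<zeta> \<in> \<DD> X \<inter> beth_on X V. center X \<zeta> \<in> U}" using clopen(1) by blast
      moreover have "{\<zeta> \<in> \<DD> X \<inter> beth_on X V. center X \<zeta> \<in> U} = center X -` U \<inter> (\<DD> X \<inter> beth_on X V)" by blast
      ultimately show ?thesis by simp
    next
      assume "U \<in> {C. closedin (zariski X) C}"
      then have "opn (points X - U)" by blast
      then have "openin ?T {\<zeta> \<in> \<DD> X \<inter> beth_on X V. center X \<zeta> \<notin> points X - U}" using clopen(2) by blast
      moreover have "{\<zeta> \<in> \<DD> X \<inter> beth_on X V. center X \<zeta> \<notin> points X - U} = center X -` U \<inter> (\<DD> X \<inter> beth_on X V)" using cX by blast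
      ultimately show ?thesis by simp
    qed
  next
    show "center X ` (\<DD> X \<inter> beth_on X V) \<subseteq> \<Union> ({U. opn U} \<union> {C. closedin (zariski X) C})"
      using cX openin_topspace by blast
  qed
qed

end

section \<open>Log discrepancies\<close>

text \<open>Arithmetic behind the choice of r in \<open>less_log_disc_iff\<close>: the summand added
  to K + N is half of the slack s - N - M.\<close>

lemma midpoint_less: "(M::real) < s - N \<Longrightarrow> K + N + (s - N - M) / 2 + M < K + s"
  by (simp add: field_simps)

locale cartier_space = separated_space X for X :: "('a, 'b) ringed_space" +
  fixes p :: nat and D :: "nat \<Rightarrow> 'a set \<Rightarrow> ('a, 'b) rat_map set"
  assumes char_p: "scheme_char X p" and cartier: "cartier_subalgebra X p D"
begin

section \<open>Cartier maps on sections, local rings and residue fields\<close>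

lemma p_gt1: "1 < p"
  using char_p prime_gt_1_nat unfolding scheme_char_def by blast

lemma D_facts:
  shows D_maps: "nopn U \<Longrightarrow> D e U \<subseteq> cartier_maps X p e U"
    and D_comp: "nopn U \<Longrightarrow> \<psi> \<in> D d U \<Longrightarrow> \<phi> \<in> D e U \<Longrightarrow> compose (carrier L) \<psi> \<phi> \<in> D (d + e) U"
    and D_mono: "nopn U \<Longrightarrow> nopn V \<Longrightarrow> V \<subseteq> U \<Longrightarrow> D e U \<subseteq> D e V"
    and D_basic: "nopn U \<Longrightarrow> affine_open X U \<Longrightarrow> f \<in> \<R> U \<Longrightarrow> f \<noteq> \<zero>\<^bsub>L\<^esub> \<Longrightarrow>
        D e {y \<in> U. f \<notin> \<mm> y} =
        {\<psi> \<in> p_linear L p e. \<exists>n::nat. (\<lambda>g\<in>carrier L. (f [^]\<^bsub>L\<^esub> n) \<cdot> \<psi> g) \<in> D e U}"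
proof goal_cases
  note c = cartier[unfolded cartier_subalgebra_def Let_def]
  note c1 = c[THEN conjunct2] note c2 = c1[THEN conjunct2] note c3 = c2[THEN conjunct2]
  note c4 = c3[THEN conjunct2] note c5 = c4[THEN conjunct2] note c6 = c5[THEN conjunct2]
  { case 1 then show ?case using c[THEN conjunct1] by simp }
  { case 2 then show ?case using c2[THEN conjunct1] by blast }
  { case 3 then show ?case using c4[THEN conjunct1] by simp }
  { case 4 then show ?case using c6 by simp }
qed

lemma D_linear:
  assumes "nopn U" "\<psi> \<in> D e U"
  shows "f \<in> carrier L \<Longrightarrow> \<psi> f \<in> carrier L"
    and "f \<in> carrier L \<Longrightarrow> g \<in> carrier L \<Longrightarrow> \<psi> (f \<boxplus> g) = \<psi> f \<boxplus> \<psi> g"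
    and "f \<in> carrier L \<Longrightarrow> g \<in> carrier L \<Longrightarrow> \<psi> ((f [^]\<^bsub>L\<^esub> (p ^ e)) \<cdot> g) = f \<cdot> \<psi> g"
    and "nopn V \<Longrightarrow> V \<subseteq> U \<Longrightarrow> f \<in> \<R> V \<Longrightarrow> \<psi> f \<in> \<R> V"
    and "x \<in> U \<Longrightarrow> f \<in> \<O> x \<Longrightarrow> \<psi> f \<in> \<O> x"
proof -
  have m: "\<psi> \<in> cartier_maps X p e U" using D_maps assms by blast
  show "f \<in> carrier L \<Longrightarrow> \<psi> f \<in> carrier L"
    "f \<in> carrier L \<Longrightarrow> g \<in> carrier L \<Longrightarrow> \<psi> (f \<boxplus> g) = \<psi> f \<boxplus> \<psi> g"
    "f \<in> carrier L \<Longrightarrow> g \<in> carrier L \<Longrightarrow> \<psi> ((f [^]\<^bsub>L\<^esub> (p ^ e)) \<cdot> g) = f \<cdot> \<psi> g"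
    using m unfolding cartier_maps_def p_linear_def by auto
  show R: "\<psi> f \<in> \<R> V" if "nopn V" "V \<subseteq> U" "f \<in> \<R> V" for V f
    using m that unfolding cartier_maps_def by blast
  assume x: "x \<in> U" "f \<in> \<O> x"
  then obtain W where W: "opn W" "x \<in> W" "f \<in> \<R> W" unfolding regular_at_iff by blast
  have n: "nopn (W \<inter> U)" "x \<in> W \<inter> U" using W assms x by auto
  have "f \<in> \<R> (W \<inter> U)" using regular_mono[of W "W \<inter> U"] n W by blast
  then have "\<psi> f \<in> \<R> (W \<inter> U)" by (rule R[OF n(1) Int_lower2])
  then show "\<psi> f \<in> \<O> x" using n unfolding regular_at_iff by blast
qed

lemma pow_closed_notin:
  fixes n :: nat
  assumes x: "x \<in> points X" and f: "f \<in> \<O> x" "f \<notin> \<mm> x"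
  shows "f [^]\<^bsub>L\<^esub> n \<in> \<O> x \<and> f [^]\<^bsub>L\<^esub> n \<notin> \<mm> x"
proof (induction n)
  case 0
  then show ?case using regular_at_closed(2)[OF x] one_notin_max[OF x] by simp
next
  case (Suc n)
  then show ?case using f regular_at_closed(5) max_ideal_mult_iff[OF _ f(1) x, of "f [^]\<^bsub>L\<^esub> n"] by simp
qed

lemma regular_pow:
  fixes n :: nat
  assumes "nopn U" "f \<in> \<R> U" shows "f [^]\<^bsub>L\<^esub> n \<in> \<R> U"
  by (induction n) (use assms regular_closed in auto)

lemma semivaluation_pow:
  fixes n :: nat
  assumes v: "semivaluation x v" and f: "f \<in> \<O> x" "f \<notin> \<mm> x" "v f = ereal r"
  shows "v (f [^]\<^bsub>L\<^esub> n) = ereal (real n * r)"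
proof (induction n)
  case 0
  then show ?case using semivaluation_one(1)[OF v] by simp
next
  case (Suc n)
  have x: "x \<in> points X" using v unfolding semivaluation_def by blast
  have "v (f [^]\<^bsub>L\<^esub> n \<cdot> f) = v (f [^]\<^bsub>L\<^esub> n) + v f"
    using v pow_closed_notin[OF x f(1,2)] f(1) unfolding semivaluation_def by blast
  then show ?case using Suc f by (simp add: algebra_simps)
qed

text \<open>\<open>c\<close> is a denominator of \<open>f\<close>, and \<open>\<psi> (c\<^sup>q f) = c \<psi> f\<close>; \<open>g\<close>, a power of a function that does not
  vanish at \<open>z\<close> but does vanish outside \<open>U\<close>, extends \<open>\<psi>\<close> to \<open>V\<close> by quasi-coherence.\<close>

lemma clear_denominators:
  assumes aff: "affine_open X V" and x: "x \<in> V" and z: "z \<in> V" and U: "opn U" "z \<in> U"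
    and \<psi>: "\<psi> \<in> D e U" and f: "f \<in> \<O> x"
  obtains \<phi> c g where "\<phi> \<in> D e V" "c \<in> \<R> V" "c \<notin> \<mm> x" "g \<in> \<R> V" "g \<notin> \<mm> z"
    "c [^]\<^bsub>L\<^esub> (p ^ e) \<cdot> f \<in> \<R> V" "\<phi> (c [^]\<^bsub>L\<^esub> (p ^ e) \<cdot> f) = g \<cdot> (c \<cdot> \<psi> f)"
proof -
  have V: "nopn V" using aff_nopn aff x by blast
  have RL: "\<R> V \<subseteq> carrier L" using regular_closed(1)[OF V] .
  have zX: "z \<in> points X" using z V openin_subset by blast
  have nU: "nopn U" using U by blast
  obtain b c where bc: "b \<in> \<R> V" "c \<in> \<R> V" "c \<notin> \<mm> x" "c \<cdot> f = b" using aff_frac[OF aff x f] .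
  have car: "c \<in> carrier L" "f \<in> carrier L" using bc RL f regular_at_closed(1) by auto
  \<comment> \<open>Since q is at least 1, one factor c of c^q turns f into the regular function b,
    and k = q - 1 factors remain.\<close>
  obtain k where k: "p ^ e = Suc k" using p_gt1 by (metis not0_implies_Suc not_less0 power_not_zero)
  have cf: "c [^]\<^bsub>L\<^esub> (p ^ e) \<cdot> f = c [^]\<^bsub>L\<^esub> k \<cdot> b"
    unfolding k bc(4)[symmetric] using car by (simp add: L.m_assoc)
  obtain h where h: "h \<in> \<R> V" "h \<notin> \<mm> z" "{y \<in> V. h \<notin> \<mm> y} \<subseteq> U" using aff_basis[OF aff z U] .
  have h0: "h \<noteq> \<zero>\<^bsub>L\<^esub>" using h max_ideal_closed(2)[OF zX] by blast
  have nh: "nopn {y \<in> V. h \<notin> \<mm> y}" using open_nonvanishing[OF V h(1)] z h by blast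
  have "\<psi> \<in> D e {y \<in> V. h \<notin> \<mm> y}" using D_mono[OF nU nh h(3)] \<psi> by blast
  then obtain n :: nat where n: "(\<lambda>g\<in>carrier L. (h [^]\<^bsub>L\<^esub> n) \<cdot> \<psi> g) \<in> D e V"
    unfolding D_basic[OF V aff h(1) h0] by blast
  have hO: "h \<in> \<O> z" using h regular_subset_at V z by blast
  show thesis
  proof (rule that[OF n bc(2,3)])
    show "h [^]\<^bsub>L\<^esub> n \<in> \<R> V" by (rule regular_pow[OF V h(1)])
    show "h [^]\<^bsub>L\<^esub> n \<notin> \<mm> z" using pow_closed_notin[OF zX hO h(2)] by blast
    show "c [^]\<^bsub>L\<^esub> (p ^ e) \<cdot> f \<in> \<R> V" unfolding cf using regular_closed(5)[OF V] regular_pow[OF V bc(2)] bc(1) by blast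
    then have "c [^]\<^bsub>L\<^esub> (p ^ e) \<cdot> f \<in> carrier L" using RL by blast
    then show "(\<lambda>g\<in>carrier L. h [^]\<^bsub>L\<^esub> n \<cdot> \<psi> g) (c [^]\<^bsub>L\<^esub> (p ^ e) \<cdot> f) = h [^]\<^bsub>L\<^esub> n \<cdot> (c \<cdot> \<psi> f)"
      using D_linear(3)[OF nU \<psi> car] by simp
  qed
qed

text \<open>Vanishing along the closure of x is vanishing at x, by \<open>pt_closure_max\<close>. A
  point y off the closure has a neighbourhood disjoint from it, on which the condition is
  void.\<close>

lemma ideal_at_iff:
  assumes "y \<in> points X" "x \<in> points X"
  shows "f \<in> ideal_at X x y \<longleftrightarrow> f \<in> \<O> y \<and> (y \<in> pt_closure X x \<longrightarrow> f \<in> \<mm> x)"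
proof
  have xx: "x \<in> pt_closure X x" using assms unfolding pt_closure_iff by blast
  assume "f \<in> ideal_at X x y"
  then obtain U where U: "opn U" "y \<in> U" "f \<in> \<R> U" "\<forall>z\<in>pt_closure X x \<inter> U. f \<in> \<mm> z"
    unfolding ideal_at_def by blast
  have "f \<in> \<O> y" using U(1-3) unfolding regular_at_iff by blast
  moreover have "f \<in> \<mm> x" if "y \<in> pt_closure X x"
  proof -
    have "x \<in> U" using that U(1,2) unfolding pt_closure_iff by blast
    then show ?thesis using U(4) xx by blast
  qed
  ultimately show "f \<in> \<O> y \<and> (y \<in> pt_closure X x \<longrightarrow> f \<in> \<mm> x)" by blast
next
  assume f: "f \<in> \<O> y \<and> (y \<in> pt_closure X x \<longrightarrow> f \<in> \<mm> x)"
  then obtain U where U: "opn U" "y \<in> U" "f \<in> \<R> U" unfolding regular_at_iff by blast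
  show "f \<in> ideal_at X x y"
  proof (cases "y \<in> pt_closure X x")
    case True
    then have "f \<in> \<mm> z" if "z \<in> pt_closure X x \<inter> U" for z
      using f that pt_closure_max[of z x f] regular_subset_at[OF U(1)] U(3) by blast
    then show ?thesis unfolding ideal_at_def using U by blast
  next
    case False
    then obtain T where T: "opn T" "y \<in> T" "x \<notin> T" using assms unfolding pt_closure_iff by blast
    have n: "nopn (U \<inter> T)" "y \<in> U \<inter> T" using U T by auto
    have "f \<in> \<R> (U \<inter> T)" using regular_mono[of U "U \<inter> T"] n U by blast
    moreover have "pt_closure X x \<inter> (U \<inter> T) = {}" using T pt_closure_iff[of _ x] by blast
    ultimately show ?thesis unfolding ideal_at_def using n by blast
  qed
qed

text \<open>Reduces the condition at all y to the generic point x of the subscheme: by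
  \<open>ideal_at_iff\<close> the ideal at y is governed by vanishing at x, any neighbourhood of a
  point of the closure contains x, and Cartier maps preserve the local ring at y anyway.\<close>

lemma uniformly_compatible_iff:
  assumes x: "x \<in> points X"
  shows "uniformly_compatible X D x \<longleftrightarrow> (\<forall>e\<ge>1. \<forall>U. opn U \<longrightarrow> x \<in> U \<longrightarrow> (\<forall>\<psi>\<in>D e U. \<psi> ` \<mm> x \<subseteq> \<mm> x))"
proof
  have xx: "x \<in> pt_closure X x" using x unfolding pt_closure_iff by blast
  have m: "ideal_at X x x = \<mm> x" using ideal_at_iff[OF x x] xx max_ideal_closed(1)[OF x] by blast
  assume u: "uniformly_compatible X D x"
  show "\<forall>e\<ge>1. \<forall>U. opn U \<longrightarrow> x \<in> U \<longrightarrow> (\<forall>\<psi>\<in>D e U. \<psi> ` \<mm> x \<subseteq> \<mm> x)"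
  proof (intro allI impI ballI)
    fix e U \<psi> assume e: "1 \<le> (e::nat)" "opn U" "x \<in> U" "\<psi> \<in> D e U"
    then have "\<psi> \<in> cartier_stalk X D e x" unfolding cartier_stalk_def by blast
    then have "\<psi> ` ideal_at X x x \<subseteq> ideal_at X x x" using u x e(1) unfolding uniformly_compatible_def by blast
    then show "\<psi> ` \<mm> x \<subseteq> \<mm> x" unfolding m .
  qed
next
  assume u: "\<forall>e\<ge>1. \<forall>U. opn U \<longrightarrow> x \<in> U \<longrightarrow> (\<forall>\<psi>\<in>D e U. \<psi> ` \<mm> x \<subseteq> \<mm> x)"
  show "uniformly_compatible X D x" unfolding uniformly_compatible_def
  proof (intro ballI allI impI subsetI)
    fix y e \<psi> g assume y: "y \<in> points X" and e: "1 \<le> (e::nat)" and \<psi>: "\<psi> \<in> cartier_stalk X D e y" and g: "g \<in> \<psi> ` ideal_at X x y"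
    obtain U where U: "opn U" "y \<in> U" "\<psi> \<in> D e U" using \<psi> unfolding cartier_stalk_def by blast
    have nU: "nopn U" using U by blast
    obtain f where f: "f \<in> ideal_at X x y" "g = \<psi> f" using g by blast
    note fi = f(1)[unfolded ideal_at_iff[OF y x]]
    have "g \<in> \<O> y" using D_linear(5)[OF nU U(3,2)] fi f(2) by blast
    moreover have "g \<in> \<mm> x" if c: "y \<in> pt_closure X x"
    proof -
      have "x \<in> U" using c U unfolding pt_closure_iff by blast
      then show ?thesis using u e U fi c f(2) by blast
    qed
    ultimately show "g \<in> ideal_at X x y" unfolding ideal_at_iff[OF y x] by blast
  qed
qed

text \<open>Representatives of a residue differ by elements of \<open>\<mm> x\<close>, which
  \<open>\<psi>\<close> keeps in \<open>\<mm> x\<close>; so all cosets in the defining union of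
  \<open>induced_map\<close> coincide.\<close>

lemma induced_map_residue:
  assumes x: "x \<in> U" "opn U" and \<psi>: "\<psi> \<in> D e U" and comp: "\<psi> ` \<mm> x \<subseteq> \<mm> x" and f: "f \<in> \<O> x"
  shows "induced_map X x \<psi> (residue X x f) = residue X x (\<psi> f)"
proof -
  have nU: "nopn U" using x by blast
  have xX: "x \<in> points X" using x openin_subset by blast
  have "residue X x (\<psi> a) = residue X x (\<psi> f)" if a: "a \<in> residue X x f" for a
  proof -
    obtain m where m: "m \<in> \<mm> x" "a = m \<boxplus> f" using a unfolding residue_set by blast
    have mO: "m \<in> \<O> x" using m max_ideal_closed(1)[OF xX] by blast
    have e: "\<psi> a = \<psi> m \<boxplus> \<psi> f" unfolding m(2) using D_linear(2)[OF nU \<psi>] mO f regular_at_closed(1)[of x] by blast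
    have aO: "a \<in> \<O> x" unfolding m(2) using mO f regular_at_closed(4) by blast
    show ?thesis
      using residue_eq_iff[OF xX D_linear(5)[OF nU \<psi> x(1) aO] D_linear(5)[OF nU \<psi> x(1) f]] e comp m(1) by blast
  qed
  moreover have "f \<in> residue X x f" using residue_self[OF xX] f regular_at_closed(1) by blast
  ultimately have "(\<Union>a\<in>residue X x f. residue X x (\<psi> a)) = residue X x (\<psi> f)" by blast
  then show ?thesis unfolding induced_map_def using f by (simp add: carrier_residue)
qed

text \<open>Lets the iterates in \<open>log_disc_map\<close> be replaced by one element of degree n
  e.\<close>

lemma iterate_D:
  assumes U: "nopn U" and \<psi>: "\<psi> \<in> D e U" and n: "1 \<le> n"
  shows "\<exists>\<phi>\<in>D (n * e) U. \<forall>g\<in>carrier L. \<phi> g = (\<psi> ^^ n) g"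
  using n
proof (induction n rule: dec_induct)
  case base
  then show ?case using \<psi> by (intro bexI[of _ \<psi>]) simp_all
next
  case (step n)
  then obtain \<phi> where \<phi>: "\<phi> \<in> D (n * e) U" "\<forall>g\<in>carrier L. \<phi> g = (\<psi> ^^ n) g" by blast
  have "compose (carrier L) \<psi> \<phi> \<in> D (Suc n * e) U" using D_comp[OF U \<psi> \<phi>(1)] by simp
  moreover have "\<forall>g\<in>carrier L. compose (carrier L) \<psi> \<phi> g = (\<psi> ^^ Suc n) g" using \<phi>(2) by (simp add: compose_def)
  ultimately show ?case by blast
qed

lemma iterate_induced:
  assumes x: "x \<in> U" "opn U" and \<psi>: "\<psi> \<in> D e U" and comp: "\<psi> ` \<mm> x \<subseteq> \<mm> x" and f: "f \<in> \<O> x"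
  shows "(\<psi> ^^ n) f \<in> \<O> x \<and> (induced_map X x \<psi> ^^ n) (residue X x f) = residue X x ((\<psi> ^^ n) f)"
proof (induction n)
  case (Suc n)
  then show ?case using induced_map_residue[OF x \<psi> comp] D_linear(5)[OF _ \<psi> x(1)] x by auto
qed (use f in simp)

lemma E_disc_real:
  fixes s t :: real
  assumes "w g = ereal s" "w (\<psi> g) = ereal t" "1 \<le> e"
  shows "ereal a < E_disc p e g \<psi> w \<longleftrightarrow> (real (p ^ e) - 1) * a < s - real (p ^ e) * t"
proof -
  have "1 < p ^ e" by (rule one_less_power[OF p_gt1]) (use assms(3) in simp)
  then have "real 1 < real (p ^ e)" by (rule of_nat_less_iff[THEN iffD2])
  then have q: "0 < real (p ^ e) - 1" by (simp only: of_nat_1 diff_gt_0_iff_gt)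
  have "E_disc p e g \<psi> w = ereal ((s - real (p ^ e) * t) / (real (p ^ e) - 1))"
    unfolding E_disc_def assms(1,2) using q by simp
  then show ?thesis using q by (simp add: pos_less_divide_eq mult.commute)
qed

text \<open>The right side involves neither the home, nor the center, nor iterates. Compatibility is
  not mentioned either: an incompatible home meets the condition for every \<open>a\<close>. Nor is
  the nonvanishing of the induced map, since a finite bound on the value of \<psi> f keeps it out of
  \<open>\<mm> x\<close>.\<close>

lemma less_log_disc_iff:
  assumes aff: "affine_open X V" and \<zeta>: "\<zeta> \<in> beth_on X V"
  shows "ereal a < log_disc X p D \<zeta> \<longleftrightarrow>
    (\<exists>e\<ge>1. \<exists>\<psi>\<in>D e V. \<exists>f\<in>\<R> V. \<exists>r. \<nu> \<zeta> (\<psi> f) < ereal r \<and>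
       ereal (real (p ^ e) * r + (real (p ^ e) - 1) * a) < \<nu> \<zeta> f)"
    (is "_ \<longleftrightarrow> ?R")
proof -
  define x where "x = home \<zeta>"
  define z where "z = center X \<zeta>"
  define v where "v = \<nu> \<zeta>"
  define w where "w = fst \<zeta>"
  let ?K = "residue_field X x"
  have b: "\<zeta> \<in> beth X" and zV: "z \<in> V" using \<zeta> unfolding beth_on_def z_def by auto
  have xV: "x \<in> V" using \<zeta> unfolding beth_on_iff[OF aff] x_def by blast
  have V: "nopn V" using aff_nopn[OF aff xV] .
  have xX: "x \<in> points X" using xV V openin_subset by blast
  have sv: "semivaluation x v" using beth_semivaluation[OF b] unfolding x_def v_def .
  have cp: "center_of x v z" using center_props(1)[OF b] unfolding x_def v_def z_def .
  have zcl: "z \<in> pt_closure X x" using cp unfolding center_of_def by blast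
  have RO: "\<R> V \<subseteq> \<O> x" using regular_subset_at V xV by blast
  have ROz: "\<R> V \<subseteq> \<O> z" using regular_subset_at V zV by blast
  have wv: "w (residue X x f) = v f" for f unfolding w_def v_def semival_at_def x_def ..
  have fin: "\<exists>r. v f = ereal r" if "f \<in> \<O> x" "f \<notin> \<mm> x" for f
    using sv that unfolding semivaluation_def by (cases "v f") auto
  have inf: "v f = \<infinity>" if "f \<in> \<mm> x" for f
    using sv that max_ideal_closed(1)[OF xX] unfolding semivaluation_def by blast
  have vm: "v (f \<cdot> g) = v f + v g" if "f \<in> \<O> x" "g \<in> \<O> x" for f g
    using sv that unfolding semivaluation_def by blast
  have R_eq: "?R \<longleftrightarrow> (\<exists>e\<ge>1. \<exists>\<psi>\<in>D e V. \<exists>f\<in>\<R> V. \<exists>r. v (\<psi> f) < ereal r \<and>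
       ereal (real (p ^ e) * r + (real (p ^ e) - 1) * a) < v f)" unfolding v_def ..
  show ?thesis
  proof (cases "uniformly_compatible X D x")
    case True
    then have comp: "\<psi> ` \<mm> x \<subseteq> \<mm> x" if "1 \<le> e" "opn U" "x \<in> U" "\<psi> \<in> D e U" for e U \<psi>
      using that unfolding uniformly_compatible_iff[OF xX] by blast
    have ld: "log_disc X p D \<zeta> = Sup {log_disc_map ?K p e \<psi> w | e \<psi>. 1 \<le> e \<and>
                \<psi> \<in> induced_stalk X D x e z \<and> (\<exists>a\<in>carrier ?K. \<psi> a \<noteq> \<zero>\<^bsub>?K\<^esub>)}"
      using True unfolding log_disc_def x_def z_def w_def Let_def by simp
    show ?thesis
    proof
      assume "ereal a < log_disc X p D \<zeta>"
      then obtain e \<psi>' where e: "1 \<le> e" and \<psi>': "\<psi>' \<in> induced_stalk X D x e z" and l: "ereal a < log_disc_map ?K p e \<psi>' w"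
        unfolding ld less_Sup_iff by blast
      obtain U \<psi> where U: "opn U" "z \<in> U" "\<psi> \<in> D e U" "\<psi>' = induced_map X x \<psi>"
        using \<psi>' unfolding induced_stalk_def cartier_stalk_def by blast
      have xU: "x \<in> U" using zcl U unfolding pt_closure_iff by blast
      have nU: "nopn U" using U by blast
      obtain f' n where f': "f' \<in> carrier ?K" "f' \<noteq> \<zero>\<^bsub>?K\<^esub>" and n: "1 \<le> n"
        and E: "ereal a < E_disc p (n * e) f' (\<psi>' ^^ n) w"
        using l unfolding log_disc_map_def less_Sup_iff by blast
      obtain f where f: "f \<in> \<O> x" "f' = residue X x f" using f'(1) unfolding carrier_residue by blast
      have fm: "f \<notin> \<mm> x" using f'(2) residue_zero_iff[OF xX f(1)] f(2) by blast
      have fL: "f \<in> carrier L" using f(1) regular_at_closed(1) by blast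
      obtain \<phi> where \<phi>: "\<phi> \<in> D (n * e) U" "\<forall>g\<in>carrier L. \<phi> g = (\<psi> ^^ n) g"
        using iterate_D[OF nU U(3) n] by blast
      have it: "(\<psi> ^^ n) f \<in> \<O> x" "(\<psi>' ^^ n) f' = residue X x ((\<psi> ^^ n) f)"
        using iterate_induced[OF xU U(1,3) comp[OF e U(1) xU U(3)] f(1)] unfolding U(4) f(2) by auto
      have \<phi>f: "\<phi> f \<in> \<O> x" "w ((\<psi>' ^^ n) f') = v (\<phi> f)" using \<phi>(2) fL it wv by auto
      have ne: "1 \<le> n * e" using n e by simp
      define Q where "Q = real (p ^ (n * e))"
      have "1 < p ^ (n * e)" by (rule one_less_power[OF p_gt1]) (use ne in simp)
      then have "real 1 < Q" unfolding Q_def by (rule of_nat_less_iff[THEN iffD2])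
      then have Q: "1 < Q" by (simp only: of_nat_1)
      obtain s where s: "v f = ereal s" using fin[OF f(1) fm] by blast
      \<comment> \<open>Otherwise the value subtracted in \<open>E_disc\<close> is \<infinity> and
        \<open>E_disc\<close> is -\<infinity>, not above \<open>a\<close>.\<close>
      have nm: "\<phi> f \<notin> \<mm> x"
      proof
        assume "\<phi> f \<in> \<mm> x"
        then have "w ((\<psi>' ^^ n) f') = \<infinity>" using inf \<phi>f(2) by simp
        then have "E_disc p (n * e) f' (\<psi>' ^^ n) w = -\<infinity>"
          unfolding E_disc_def f(2) wv s Q_def[symmetric] using Q by simp
        then show False using E by simp
      qed
      obtain t where t: "v (\<phi> f) = ereal t" using fin[OF \<phi>f(1) nm] by blast
      have E': "(Q - 1) * a < s - Q * t"
        using E E_disc_real[where w = w and g = f' and \<psi> = "\<psi>' ^^ n" and s = s and t = t and a = a, OF _ _ ne]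
        unfolding Q_def using s t \<phi>f(2) wv f(2) by simp
      obtain \<phi>' c g where c: "\<phi>' \<in> D (n * e) V" "c \<in> \<R> V" "c \<notin> \<mm> x" "g \<in> \<R> V" "g \<notin> \<mm> z"
        "c [^]\<^bsub>L\<^esub> (p ^ (n * e)) \<cdot> f \<in> \<R> V"
        "\<phi>' (c [^]\<^bsub>L\<^esub> (p ^ (n * e)) \<cdot> f) = g \<cdot> (c \<cdot> \<phi> f)"
        by (rule clear_denominators[OF aff xV zV U(1,2) \<phi>(1) f(1)])
      have cO: "c \<in> \<O> x" "g \<in> \<O> x" using c RO by auto
      obtain k where k: "v c = ereal k" using fin[OF cO(1) c(3)] by blast
      have "0 \<le> v g \<and> (0 < v g \<longleftrightarrow> g \<in> \<mm> z)" using cp c(4) ROz unfolding center_of_def by blast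
      then have vg: "v g = 0" using c(5) by auto
      \<comment> \<open>Passing to c^Q f raises the value of the argument by Q k and that of the
        image by k only, as g has value 0. The difference s - Q t in \<open>E_disc\<close> is
        therefore unchanged.\<close>
      have v1: "v (c [^]\<^bsub>L\<^esub> (p ^ (n * e)) \<cdot> f) = ereal (Q * k + s)"
        using vm[OF _ f(1)] pow_closed_notin[OF xX cO(1) c(3)] semivaluation_pow[OF sv cO(1) c(3) k] s unfolding Q_def by simp
      have v2: "v (\<phi>' (c [^]\<^bsub>L\<^esub> (p ^ (n * e)) \<cdot> f)) = ereal (k + t)"
        unfolding c(7) using vm[OF cO(2) regular_at_closed(5)[OF cO(1) \<phi>f(1)]] vm[OF cO(1) \<phi>f(1)] vg k t by simp
      \<comment> \<open>r exceeds the value k + t of the image by half of the slack s - Q t - (Q -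
        1) a, divided by Q. This leaves both inequalities strict.\<close>
      define r where "r = k + t + (s - Q * t - (Q - 1) * a) / (2 * Q)"
      have d: "Q * ((s - Q * t - (Q - 1) * a) / (2 * Q)) = (s - Q * t - (Q - 1) * a) / 2" using Q by simp
      have "0 < (s - Q * t - (Q - 1) * a) / (2 * Q)" using E' Q by simp
      then have r1: "k + t < r" unfolding r_def by simp
      have r2: "Q * r = Q * k + Q * t + (s - Q * t - (Q - 1) * a) / 2" unfolding r_def distrib_left d ..
      have "Q * r + (Q - 1) * a < Q * k + s"
        unfolding r2 by (rule midpoint_less[OF E'])
      then have r: "v (\<phi>' (c [^]\<^bsub>L\<^esub> (p ^ (n * e)) \<cdot> f)) < ereal r \<and>
          ereal (Q * r + (Q - 1) * a) < v (c [^]\<^bsub>L\<^esub> (p ^ (n * e)) \<cdot> f)"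
        unfolding v1 v2 less_ereal.simps using r1 by (rule conjI[rotated])
      show ?R unfolding R_eq
        by (rule exI[of _ "n * e"], rule conjI[OF ne], rule bexI[OF _ c(1)], rule bexI[OF _ c(6)], rule exI[of _ r])
          (rule r[unfolded Q_def])
    next
      assume ?R
      then obtain e \<psi> f r where e: "1 \<le> e" "\<psi> \<in> D e V" "f \<in> \<R> V" "v (\<psi> f) < ereal r"
        "ereal (real (p ^ e) * r + (real (p ^ e) - 1) * a) < v f" unfolding R_eq by (elim exE conjE bexE)
      have fO: "f \<in> \<O> x" "\<psi> f \<in> \<O> x" using e(3) RO D_linear(4)[OF V e(2) V order_refl] by auto
      have oV: "opn V" using V by blast
      note cm = comp[OF e(1) oV xV e(2)]
      \<comment> \<open>A finite bound rules out the value \<infinity>. By compatibility f is then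
        outside \<open>\<mm> x\<close> as well, so both values are finite and r can be
        eliminated.\<close>
      have "\<psi> f \<notin> \<mm> x"
      proof
        assume "\<psi> f \<in> \<mm> x"
        then have "v (\<psi> f) = \<infinity>" by (rule inf)
        then show False using e(4) by simp
      qed
      moreover from this have fm: "f \<notin> \<mm> x" using cm by blast
      ultimately obtain s t where st: "v f = ereal s" "v (\<psi> f) = ereal t" using fin fO by blast
      let ?g = "residue X x f" and ?\<psi> = "induced_map X x \<psi>"
      have ir: "?\<psi> ?g = residue X x (\<psi> f)" by (rule induced_map_residue[OF xV oV e(2) cm fO(1)])
      have gK: "?g \<in> carrier ?K" "?g \<noteq> \<zero>\<^bsub>?K\<^esub>" "?\<psi> ?g \<noteq> \<zero>\<^bsub>?K\<^esub>"
        using carrier_residue fO residue_zero_iff[OF xX] fm \<open>\<psi> f \<notin> \<mm> x\<close> ir by auto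
      have "real (p ^ e) * t < real (p ^ e) * r" using e(4) st p_gt1 by simp
      then have "(real (p ^ e) - 1) * a < s - real (p ^ e) * t" using e(5) st by simp
      \<comment> \<open>For this direction the first iterate, n = 1, is enough.\<close>
      then have E: "ereal a < E_disc p (1 * e) ?g (?\<psi> ^^ 1) w"
        using E_disc_real[where w = w and g = ?g and \<psi> = ?\<psi> and s = s and t = t and a = a, OF _ _ e(1)] st wv ir by simp
      have "E_disc p (1 * e) ?g (?\<psi> ^^ 1) w \<le> log_disc_map ?K p e ?\<psi> w" unfolding log_disc_map_def
        using gK(1,2) order_refl[of "1::nat"] by (intro Sup_upper CollectI exI[of _ ?g] exI[of _ "1::nat"] conjI refl)
      note E = order.strict_trans2[OF E this]
      have "?\<psi> \<in> induced_stalk X D x e z"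
        unfolding induced_stalk_def cartier_stalk_def using e(2) oV zV by blast
      then have "log_disc_map ?K p e ?\<psi> w \<le> log_disc X p D \<zeta>" unfolding ld
        using e(1) gK by (intro Sup_upper) blast
      then show "ereal a < log_disc X p D \<zeta>" using E by (rule order.strict_trans2[rotated])
    qed
  next
    case False
    then have ld: "log_disc X p D \<zeta> = \<infinity>" unfolding log_disc_def x_def by simp
    obtain e U \<psi> f where U: "1 \<le> e" "opn U" "x \<in> U" "\<psi> \<in> D e U" "f \<in> \<mm> x" "\<psi> f \<notin> \<mm> x"
      using False unfolding uniformly_compatible_iff[OF xX] by blast
    have nU: "nopn U" using U by blast
    have fO: "f \<in> \<O> x" using U(5) max_ideal_closed(1)[OF xX] by blast
    have \<psi>fO: "\<psi> f \<in> \<O> x" by (rule D_linear(5)[OF nU U(4,3) fO])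
    \<comment> \<open>\<open>U\<close> is only known to contain the home x, so x itself takes the
      place of the center: g is nonzero at x, hence of finite value, which suffices here.\<close>
    obtain \<phi> c g where c: "\<phi> \<in> D e V" "c \<in> \<R> V" "c \<notin> \<mm> x" "g \<in> \<R> V" "g \<notin> \<mm> x"
        "c [^]\<^bsub>L\<^esub> (p ^ e) \<cdot> f \<in> \<R> V"
        "\<phi> (c [^]\<^bsub>L\<^esub> (p ^ e) \<cdot> f) = g \<cdot> (c \<cdot> \<psi> f)"
      by (rule clear_denominators[OF aff xV xV U(2,3,4) fO])
    have cO: "c \<in> \<O> x" "g \<in> \<O> x" "c \<cdot> \<psi> f \<in> \<O> x" using c RO \<psi>fO regular_at_closed(5) by auto
    have "c [^]\<^bsub>L\<^esub> (p ^ e) \<cdot> f \<in> \<mm> x"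
      using max_ideal_closed(4)[OF xX _ U(5)] pow_closed_notin[OF xX cO(1) c(3)] by blast
    then have "v (c [^]\<^bsub>L\<^esub> (p ^ e) \<cdot> f) = \<infinity>" by (rule inf)
    moreover have "g \<cdot> (c \<cdot> \<psi> f) \<notin> \<mm> x"
      using max_ideal_mult_iff[OF cO(2,3) xX] max_ideal_mult_iff[OF cO(1) \<psi>fO xX] c U by blast
    then obtain t where "v (\<phi> (c [^]\<^bsub>L\<^esub> (p ^ e) \<cdot> f)) = ereal t"
      using fin regular_at_closed(5)[OF cO(2,3)] unfolding c(7) by blast
    \<comment> \<open>The argument has value \<infinity> and its image the finite value t. Any r
      above t satisfies both inequalities, whatever \<open>a\<close> is.\<close>
    ultimately have "v (\<phi> (c [^]\<^bsub>L\<^esub> (p ^ e) \<cdot> f)) < ereal (t + 1) \<and>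
        ereal (real (p ^ e) * (t + 1) + (real (p ^ e) - 1) * a) < v (c [^]\<^bsub>L\<^esub> (p ^ e) \<cdot> f)" by simp
    then have ?R unfolding R_eq using U(1) c(1,6) by blast
    then show ?thesis using ld by simp
  qed
qed

text \<open>With f also \<psi> f is a function on \<open>V\<close>, so each of the two inequalities
  in \<open>less_log_disc_iff\<close> defines a basic open set.\<close>

lemma openin_less_log_disc:
  assumes aff: "affine_open X V"
  shows "openin (beth_top_affine X V) {\<zeta> \<in> beth_on X V. ereal a < log_disc X p D \<zeta>}"
proof (cases "V = {}")
  case True
  then have "beth_on X V = {}" unfolding beth_on_def by blast
  then show ?thesis by simp
next
  case ne: False
  then have V: "nopn V" using aff unfolding affine_open_def by blast
  have "{\<zeta> \<in> beth_on X V. ereal a < log_disc X p D \<zeta>} =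
     (\<Union>e\<in>{1..}. \<Union>\<psi>\<in>D e V. \<Union>f\<in>\<R> V. \<Union>r. {\<zeta> \<in> beth_on X V. \<nu> \<zeta> (\<psi> f) \<in> {..<ereal r}} \<inter>
        {\<zeta> \<in> beth_on X V. \<nu> \<zeta> f \<in> {ereal (real (p ^ e) * r + (real (p ^ e) - 1) * a)<..}})"
    (is "?A = ?B")
  proof (rule Set.set_eqI)
    fix \<zeta>
    show "\<zeta> \<in> ?A \<longleftrightarrow> \<zeta> \<in> ?B"
    proof (cases "\<zeta> \<in> beth_on X V")
      case True
      show ?thesis unfolding mem_Collect_eq less_log_disc_iff[OF aff True] using True
        by (simp del: split_paired_Ex) blast
    qed simp
  qed
  moreover have "openin (beth_top_affine X V) ({\<zeta> \<in> beth_on X V. \<nu> \<zeta> (\<psi> f) \<in> {..<ereal r}} \<inter>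
        {\<zeta> \<in> beth_on X V. \<nu> \<zeta> f \<in> {s<..}})" if "\<psi> \<in> D e V" "f \<in> \<R> V" for e \<psi> f r s
    by (intro openin_Int beth_affine_open open_lessThan open_greaterThan that D_linear(4)[OF V that(1) V order_refl])
  ultimately show ?thesis by (auto intro!: openin_Union)
qed

text \<open>Compactness is available over each member of a finite noetherian affine covering. The
  images of the pieces are compact in a Hausdorff space, hence closed, and there are finitely many
  of them.\<close>

lemma closedin_center_image:
  assumes noeth: "noetherian_scheme X"
  shows "closedin (constructible_top (zariski X)) (center X ` {\<zeta> \<in> \<DD> X. log_disc X p D \<zeta> \<le> ereal b})"
proof -
  obtain \<U> where \<U>: "finite \<U>" "\<Union>\<U> = points X" "\<forall>U\<in>\<U>. affine_open X U \<and> noetherian_ring (sect X U)"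
    using noeth unfolding noetherian_scheme_def by blast
  let ?A = "\<lambda>V. {\<zeta> \<in> \<DD> X \<inter> beth_on X V. log_disc X p D \<zeta> \<le> ereal b}"
  have "{\<zeta> \<in> \<DD> X. log_disc X p D \<zeta> \<le> ereal b} = (\<Union>V\<in>\<U>. ?A V)"
  proof (intro equalityI subsetI)
    fix \<zeta> assume \<zeta>: "\<zeta> \<in> {\<zeta> \<in> \<DD> X. log_disc X p D \<zeta> \<le> ereal b}"
    then have b: "\<zeta> \<in> beth X" using discrete_closure_gap unfolding gap_points_def by blast
    then have "center X \<zeta> \<in> \<Union>\<U>"
      using center_props(1)[OF b] unfolding center_of_def pt_closure_iff \<U>(2) by blast
    then obtain V where "V \<in> \<U>" "\<zeta> \<in> beth_on X V" using b unfolding beth_on_def by blast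
    then show "\<zeta> \<in> (\<Union>V\<in>\<U>. ?A V)" using \<zeta> by blast
  qed blast
  then have eq: "center X ` {\<zeta> \<in> \<DD> X. log_disc X p D \<zeta> \<le> ereal b} = (\<Union>V\<in>\<U>. center X ` ?A V)" by (simp add: image_UN)
  have "closedin (constructible_top (zariski X)) (center X ` ?A V)" if V: "V \<in> \<U>" for V
  proof -
    have aff: "affine_open X V" and nr: "noetherian_ring (sect X V)" using \<U>(3) V by auto
    have "?A V = \<DD> X \<inter> beth_on X V - {\<zeta> \<in> beth_on X V. ereal b < log_disc X p D \<zeta>}" by (auto simp: not_less)
    then have "closedin (beth_top_affine X V) (?A V)"
      using closedin_diff[OF closedin_discrete_closure[OF aff] openin_less_log_disc[OF aff]] by simp
    then have "compactin (beth_top_affine X V) (?A V)"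
      by (intro closed_compactin[OF compact_beth_affine[OF aff]]) auto
    then have "compactin (subtopology (beth_top_affine X V) (\<DD> X \<inter> beth_on X V)) (?A V)"
      by (auto simp: compactin_subtopology)
    then have "compactin (constructible_top (zariski X)) (center X ` ?A V)"
      by (rule image_compactin[OF _ center_continuous[OF aff nr]])
    then show ?thesis by (rule compactin_imp_closedin[OF Hausdorff_constructible])
  qed
  then show ?thesis unfolding eq using \<U>(1) by (intro closedin_Union) auto
qed

text \<open>An infimum exceeds \<open>a\<close> iff some b > a is a strict lower bound of all its
  members. So the set in question is the union over b > a of the complements of the closed sets from
  \<open>closedin_center_image\<close>.\<close>

lemma mld_semicontinuous:
  assumes noeth: "noetherian_scheme X"
  shows "lower_semicontinuous (constructible_top (zariski X)) (mld_beth X p D)"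
  unfolding lower_semicontinuous_def topspace_constructible
proof
  fix a :: real
  let ?C = "\<lambda>b. center X ` {\<zeta> \<in> \<DD> X. log_disc X p D \<zeta> \<le> ereal b}"
  have "{y \<in> points X. ereal a < mld_beth X p D y} = (\<Union>b\<in>{a<..}. points X - ?C b)"
  proof (intro equalityI subsetI)
    fix y assume y: "y \<in> {y \<in> points X. ereal a < mld_beth X p D y}"
    then obtain b where b: "a < b" "ereal b < mld_beth X p D y" using ereal_dense2[of "ereal a"] by auto
    have "y \<notin> ?C b"
    proof
      assume "y \<in> ?C b"
      then obtain \<zeta> where \<zeta>: "\<zeta> \<in> \<DD> X" "log_disc X p D \<zeta> \<le> ereal b" "center X \<zeta> = y" by blast
      then have "mld_beth X p D y \<le> log_disc X p D \<zeta>" unfolding mld_beth_def by (intro Inf_lower) blast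
      then show False using \<zeta>(2) b(2) by (meson leD order_trans)
    qed
    then show "y \<in> (\<Union>b\<in>{a<..}. points X - ?C b)" using y b(1) by blast
  next
    fix y assume "y \<in> (\<Union>b\<in>{a<..}. points X - ?C b)"
    then obtain b where b: "a < b" "y \<in> points X" "y \<notin> ?C b" by blast
    have "ereal b \<le> mld_beth X p D y" unfolding mld_beth_def
    proof (rule Inf_greatest)
      fix t assume "t \<in> {log_disc X p D \<zeta> |\<zeta>. \<zeta> \<in> \<DD> X \<and> center X \<zeta> = y}"
      then obtain \<zeta> where "t = log_disc X p D \<zeta>" "\<zeta> \<in> \<DD> X" "center X \<zeta> = y" by blast
      then show "ereal b \<le> t" using b(3) by (auto simp: not_le intro: less_imp_le)
    qed
    moreover have "ereal a < ereal b" using b(1) by simp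
    ultimately have "ereal a < mld_beth X p D y" by (rule order.strict_trans2[rotated])
    then show "y \<in> {y \<in> points X. ereal a < mld_beth X p D y}" using b(2) by blast
  qed
  moreover have C: "openin (constructible_top (zariski X)) (points X - ?C b)" for b
    using closedin_center_image[OF noeth] unfolding closedin_def topspace_constructible by blast
  have "openin (constructible_top (zariski X)) (\<Union>b\<in>{a<..}. points X - ?C b)"
    by (intro openin_Union) (use C in blast)
  ultimately show "openin (constructible_top (zariski X)) {y \<in> points X. ereal a < mld_beth X p D y}"
    by simp
qed

end

text \<open>Locally closed sets include all open and all closed sets and are stable under
  intersection; hence they contain a basis of the constructible topology.\<close>

lemma constructible_locally_closed:
  assumes "openin (constructible_top T) U" "x \<in> U"
  shows "\<exists>G. locally_closed_in T G \<and> x \<in> G \<and> G \<subseteq> U"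
proof -
  have "\<forall>x\<in>U. \<exists>G. locally_closed_in T G \<and> x \<in> G \<and> G \<subseteq> U"
    using assms(1) unfolding constructible_top_def openin_topology_generated_by_iff
  proof induction
    case (Int A B)
    have "locally_closed_in T (G \<inter> H)" if "locally_closed_in T G" "locally_closed_in T H" for G H
    proof -
      obtain U C U' C' where "openin T U" "closedin T C" "G = U \<inter> C" "openin T U'" "closedin T C'" "H = U' \<inter> C'"
        using \<open>locally_closed_in T G\<close> \<open>locally_closed_in T H\<close> unfolding locally_closed_in_def by blast
      then have "openin T (U \<inter> U')" "closedin T (C \<inter> C')" "G \<inter> H = (U \<inter> U') \<inter> (C \<inter> C')" by auto
      then show ?thesis unfolding locally_closed_in_def by blast
    qed
    then show ?case using Int.IH by (meson Int_iff Int_mono)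
  next
    case (UN K)
    then show ?case by (meson Union_iff Union_upper order_trans)
  next
    case (Basis s)
    then have "locally_closed_in T s"
    proof
      assume "s \<in> {U. openin T U}"
      then have "openin T s" "closedin T (topspace T)" "s = s \<inter> topspace T" using openin_subset by auto
      then show ?thesis unfolding locally_closed_in_def by blast
    next
      assume "s \<in> {C. closedin T C}"
      then have "openin T (topspace T)" "closedin T s" "s = topspace T \<inter> s" using closedin_subset by auto
      then show ?thesis unfolding locally_closed_in_def by blast
    qed
    then show ?case by blast
  qed simp
  then show ?thesis using assms(2) by blast
qed

theorem theorem6p17:
  fixes X :: "('a, 'b) ringed_space"
    and p :: nat
    and D :: "nat \<Rightarrow> 'a set \<Rightarrow> ('a, 'b) rat_map set"
  assumes "integral_scheme X"
    and "separated_scheme X"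
    and "noetherian_scheme X"
    and "scheme_char X p"
    and "cartier_subalgebra X p D"
  shows "lower_semicontinuous (constructible_top (zariski X)) (mld_beth X p D) \<and>
    (\<forall>x \<in> points X. \<forall>\<epsilon>::real. 0 < \<epsilon> \<longrightarrow> \<bar>mld_beth X p D x\<bar> \<noteq> \<infinity> \<longrightarrow>
       (\<exists>G. locally_closed_in (zariski X) G \<and> x \<in> G \<and>
          (\<forall>x' \<in> G. mld_beth X p D x' > mld_beth X p D x - ereal \<epsilon>)))"
proof -
  interpret cartier_space X p D
    by (rule cartier_space.intro[OF separated_space.intro[OF integral_space.intro[OF assms(1)]
          separated_space_axioms.intro[OF assms(2)]] cartier_space_axioms.intro[OF assms(4,5)]])
  note semi = mld_semicontinuous[OF assms(3)]
  have G: "\<exists>G. locally_closed_in (zariski X) G \<and> x \<in> G \<and>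
      (\<forall>x'\<in>G. mld_beth X p D x' > mld_beth X p D x - ereal \<epsilon>)"
    if x: "x \<in> points X" and \<epsilon>: "0 < \<epsilon>" and fin: "\<bar>mld_beth X p D x\<bar> \<noteq> \<infinity>" for x and \<epsilon> :: real
  proof -
    obtain m where m: "mld_beth X p D x = ereal m" using fin by (cases "mld_beth X p D x") auto
    let ?U = "{y \<in> points X. ereal (m - \<epsilon>) < mld_beth X p D y}"
    have "openin (constructible_top (zariski X)) ?U"
      using semi unfolding lower_semicontinuous_def topspace_constructible by blast
    moreover have "x \<in> ?U" using x \<epsilon> m by simp
    ultimately obtain G where G: "locally_closed_in (zariski X) G" "x \<in> G" "G \<subseteq> ?U"
      using constructible_locally_closed[of "zariski X" ?U x] by blast
    then have "\<forall>x'\<in>G. mld_beth X p D x' > mld_beth X p D x - ereal \<epsilon>"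
      unfolding m by auto
    then show ?thesis using G by blast
  qed
  show ?thesis
    by (intro conjI ballI allI impI semi) (rule G)
qed

end
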